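(* Let $k$ be a field, $0\neq q\in k$, let $m\le n$ be positive integers, and let $\alpha$ be the length of a maximal path in $\mathcal{G}_q(m,n)$. Then the Gelfand-Kirillov dimension of the quantum grassmannian satisfies $$\operatorname{GKdim}(\mathcal{G}_q(m,n))=\alpha=m(n-m)+1.$$
   Context: $\mathcal{O}_q(M_{mn})$ is the (unital associative) $k$-algebra generated by $X_{ij}$, $1\le i\le m$, $1\le j\le n$, subject to the relations, for $1\le i<k\le m$ and $1\le j<l\le n$: $X_{ij}X_{il}=qX_{il}X_{ij}$, $X_{ij}X_{kj}=qX_{kj}X_{ij}$, $X_{il}X_{kj}=X_{kj}X_{il}$, $X_{ij}X_{kl}-X_{kl}X_{ij}=(q-q^{-1})X_{il}X_{kj}$. For an $m$-element subset $J=\{j_1<\dots<j_m\}\subseteq\{1,\dots,n\}$ the maximal quantum minor is $[J]=\sum_{\sigma\in S_m}(-q)^{\ell(\sigma)}X_{1 j_{\sigma(1)}}\cdots X_{m j_{\sigma(m)}}$, where $\ell(\sigma)$ is the length of $\sigma$. The quantum grassmannian $\mathcal{G}_q(m,n)$ is the $k$-subalgebra of $\mathcal{O}_q(M_{mn})$ generated by all the $[J]$. The generating minors are partially ordered by: $[A]\le_c[B]$ iff $a_i\le b_i$ for all $i=1,\dots,m$, where $A=\{a_1<\dots<a_m\}$, $B=\{b_1<\dots<b_m\}$. A saturated path between minors $a<_c b$ is a chain $a=a_1<_c a_2<_c\dots<_c a_l=b$ of generating minors such that for no $i$ is there a generating minor $d$ with $a_i<_c d<_c a_{i+1}$; its length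 is $l$ (the number of minors in it). A maximal path is a saturated path from $[1\ldots m]$ to $[n-m+1\ldots n]$ (if $m=n$, it is the one-element chain, of length 1). For an algebra $A$ generated by a finite-dimensional subspace $V$, $\operatorname{GKdim}(A)=\limsup_{N\to\infty}\log_N\dim_k\left(\sum_{i=0}^N V^i\right)$. *)

theory Defs
  imports
    Complex_Main
    "HOL-Library.Extended_Real"
    "HOL-Library.Liminf_Limsup"
    "HOL-Library.Poly_Mapping"
    "HOL-Combinatorics.Permutations"
    "HOL-Algebra.QuotRing"
    "HOL-Algebra.Ideal_Product"
    "HOL-Algebra.Generated_Rings"
    "HOL-Algebra.Embedded_Algebras"
begin

section \<open>Free algebras\<close>

text \<open>
  The free monoid on \<^typ>\<open>'a\<close>, written additively, so that the type
  \<open>'a fword \<Rightarrow>\<^sub>0 'k\<close> of finitely supported functions with its convolution product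
  is the free associative unital algebra over \<open>'k\<close> on the letters \<^typ>\<open>'a\<close>.
\<close>

datatype 'a fword = FWord (letters: "'a list")

instantiation fword :: (type) monoid_add
begin

definition zero_fword :: "'a fword" where
  "0 = FWord []"

definition plus_fword :: "'a fword \<Rightarrow> 'a fword \<Rightarrow> 'a fword" where
  "u + v = FWord (letters u @ letters v)"

instance
  by standard (simp_all add: zero_fword_def plus_fword_def)

end

definition fa_const :: "'k::field \<Rightarrow> 'a fword \<Rightarrow>\<^sub>0 'k" where
  "fa_const c = Poly_Mapping.single 0 c"

definition fa_gen :: "'a \<Rightarrow> 'a fword \<Rightarrow>\<^sub>0 'k::field" where
  "fa_gen x = Poly_Mapping.single (FWord [x]) 1"

text \<open>The free algebra on a set \<open>S\<close> of letters.\<close>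

definition free_algebra :: "'a set \<Rightarrow> ('a fword \<Rightarrow>\<^sub>0 'k::field) ring" where
  "free_algebra S =
     \<lparr>carrier = {p. \<forall>w \<in> Poly_Mapping.keys p. set (letters w) \<subseteq> S},
      mult = (*), one = 1, zero = 0, add = (+)\<rparr>"


section \<open>Gelfand-Kirillov dimension\<close>

text \<open>
  An algebra over a field is a ring \<open>A\<close> together with a (central) subfield \<open>K\<close>, as in
  \<^theory>\<open>HOL-Algebra.Embedded_Algebras\<close>. Despite its name, \<^const>\<open>ideal_prod\<close> is the set of
  finite sums of products, which is the product of two subspaces.
\<close>

fun subspace_power :: "('a, 'b) ring_scheme \<Rightarrow> 'a set \<Rightarrow> 'a set \<Rightarrow> nat \<Rightarrow> 'a set" where
  "subspace_power A K V 0 = K"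
| "subspace_power A K V (Suc i) = ideal_prod A (subspace_power A K V i) V"

fun subspace_power_sum :: "('a, 'b) ring_scheme \<Rightarrow> 'a set \<Rightarrow> 'a set \<Rightarrow> nat \<Rightarrow> 'a set" where
  "subspace_power_sum A K V 0 = subspace_power A K V 0"
| "subspace_power_sum A K V (Suc N) =
     subspace_power_sum A K V N <+>\<^bsub>A\<^esub> subspace_power A K V (Suc N)"

definition growth_exponent :: "('a, 'b) ring_scheme \<Rightarrow> 'a set \<Rightarrow> 'a set \<Rightarrow> ereal" where
  "growth_exponent A K V =
     limsup (\<lambda>N. ereal (log (real N) (real (ring.dim A K (subspace_power_sum A K V N)))))"

definition fin_dim_generating_subspace ::
    "('a, 'b) ring_scheme \<Rightarrow> 'a set \<Rightarrow> 'a set \<Rightarrow> bool" where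
  "fin_dim_generating_subspace A K V \<longleftrightarrow>
     subalgebra K V A \<and> V \<subseteq> carrier A \<and> ring.finite_dimension A K V \<and>
     generate_ring A (K \<union> V) = carrier A"

text \<open>
  The exponent of growth does not depend on the generating subspace, so the description
  below determines the dimension of every finitely generated algebra. Note that
  \<^locale>\<open>subalgebra\<close> in HOL-Algebra only asks for a linear subspace.
\<close>

definition GKdim :: "('a, 'b) ring_scheme \<Rightarrow> 'a set \<Rightarrow> ereal" where
  "GKdim A K =
     (THE d. \<exists>V. fin_dim_generating_subspace A K V \<and> d = growth_exponent A K V)"


section \<open>Quantum matrices and the quantum grassmannian\<close>

text \<open>
  The row relations are imposed in every row and the column relations in every column,
  including the last ones (and also if \<open>m = 1\<close> or \<open>n = 1\<close>).
\<close>

definition qmat_relations :: "'k::field \<Rightarrow> nat \<Rightarrow> nat \<Rightarrow> ((nat \<times> nat) fword \<Rightarrow>\<^sub>0 'k) set" where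
  "qmat_relations q m n =
     {fa_gen (i, j) * fa_gen (i, l) - fa_const q * fa_gen (i, l) * fa_gen (i, j) | i j l.
        1 \<le> i \<and> i \<le> m \<and> 1 \<le> j \<and> j < l \<and> l \<le> n} \<union>
     {fa_gen (i, j) * fa_gen (k, j) - fa_const q * fa_gen (k, j) * fa_gen (i, j) | i k j.
        1 \<le> i \<and> i < k \<and> k \<le> m \<and> 1 \<le> j \<and> j \<le> n} \<union>
     {fa_gen (i, l) * fa_gen (k, j) - fa_gen (k, j) * fa_gen (i, l) | i k j l.
        1 \<le> i \<and> i < k \<and> k \<le> m \<and> 1 \<le> j \<and> j < l \<and> l \<le> n} \<union>
     {fa_gen (i, j) * fa_gen (k, l) - fa_gen (k, l) * fa_gen (i, j)
        - fa_const (q - inverse q) * fa_gen (i, l) * fa_gen (k, j) | i k j l.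
        1 \<le> i \<and> i < k \<and> k \<le> m \<and> 1 \<le> j \<and> j < l \<and> l \<le> n}"

abbreviation qmat_free :: "nat \<Rightarrow> nat \<Rightarrow> ((nat \<times> nat) fword \<Rightarrow>\<^sub>0 'k::field) ring" where
  "qmat_free m n \<equiv> free_algebra ({1..m} \<times> {1..n})"

definition qmat_ideal :: "'k::field \<Rightarrow> nat \<Rightarrow> nat \<Rightarrow> ((nat \<times> nat) fword \<Rightarrow>\<^sub>0 'k) set" where
  "qmat_ideal q m n = Idl\<^bsub>qmat_free m n\<^esub> (qmat_relations q m n)"

definition quantum_matrices ::
    "'k::field \<Rightarrow> nat \<Rightarrow> nat \<Rightarrow> ((nat \<times> nat) fword \<Rightarrow>\<^sub>0 'k) set ring" where
  "quantum_matrices q m n = qmat_free m n Quot qmat_ideal q m n"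

definition qmat_class ::
    "'k::field \<Rightarrow> nat \<Rightarrow> nat \<Rightarrow> ((nat \<times> nat) fword \<Rightarrow>\<^sub>0 'k) \<Rightarrow> ((nat \<times> nat) fword \<Rightarrow>\<^sub>0 'k) set" where
  "qmat_class q m n f = qmat_ideal q m n +>\<^bsub>qmat_free m n\<^esub> f"

text \<open>The copy of the ground field inside the algebra of quantum matrices.\<close>

definition qmat_scalars :: "'k::field \<Rightarrow> nat \<Rightarrow> nat \<Rightarrow> ((nat \<times> nat) fword \<Rightarrow>\<^sub>0 'k) set set" where
  "qmat_scalars q m n = range (\<lambda>c. qmat_class q m n (fa_const c))"

definition perm_length :: "nat \<Rightarrow> (nat \<Rightarrow> nat) \<Rightarrow> nat" where
  "perm_length m \<sigma> = card {(i, j). 1 \<le> i \<and> i < j \<and> j \<le> m \<and> \<sigma> j < \<sigma> i}"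

text \<open>\<open>elem_at J i\<close> is \<open>j\<^sub>i\<close> in \<open>J = {j\<^sub>1 < j\<^sub>2 < \<dots>}\<close>, counting from 1.\<close>

definition elem_at :: "nat set \<Rightarrow> nat \<Rightarrow> nat" where
  "elem_at J i = sorted_list_of_set J ! (i - 1)"

text \<open>
  The sum and the products are formed in the free algebra, in the given order of the
  factors, before passing to the quotient.
\<close>

definition qminor :: "'k::field \<Rightarrow> nat \<Rightarrow> nat \<Rightarrow> nat set \<Rightarrow> ((nat \<times> nat) fword \<Rightarrow>\<^sub>0 'k) set" where
  "qminor q m n J = qmat_class q m n
     (\<Sum>\<sigma> | \<sigma> permutes {1..m}.
        fa_const ((- q) ^ perm_length m \<sigma>) *
        prod_list (map (\<lambda>i. fa_gen (i, elem_at J (\<sigma> i))) [1..<m + 1]))"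

definition minor_indices :: "nat \<Rightarrow> nat \<Rightarrow> nat set set" where
  "minor_indices m n = {J. J \<subseteq> {1..n} \<and> card J = m}"

definition qminors :: "'k::field \<Rightarrow> nat \<Rightarrow> nat \<Rightarrow> ((nat \<times> nat) fword \<Rightarrow>\<^sub>0 'k) set set" where
  "qminors q m n = qminor q m n ` minor_indices m n"

definition quantum_grassmannian ::
    "'k::field \<Rightarrow> nat \<Rightarrow> nat \<Rightarrow> ((nat \<times> nat) fword \<Rightarrow>\<^sub>0 'k) set ring" where
  "quantum_grassmannian q m n = (quantum_matrices q m n)
     \<lparr>carrier := generate_ring (quantum_matrices q m n) (qmat_scalars q m n \<union> qminors q m n)\<rparr>"


section \<open>Paths of minors\<close>

definition minor_le ::
    "'k::field \<Rightarrow> nat \<Rightarrow> nat \<Rightarrow> ((nat \<times> nat) fword \<Rightarrow>\<^sub>0 'k) set \<Rightarrow>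
     ((nat \<times> nat) fword \<Rightarrow>\<^sub>0 'k) set \<Rightarrow> bool" where
  "minor_le q m n a b \<longleftrightarrow>
     (\<exists>A \<in> minor_indices m n. \<exists>B \<in> minor_indices m n.
        a = qminor q m n A \<and> b = qminor q m n B \<and> (\<forall>i \<in> {1..m}. elem_at A i \<le> elem_at B i))"

definition minor_less ::
    "'k::field \<Rightarrow> nat \<Rightarrow> nat \<Rightarrow> ((nat \<times> nat) fword \<Rightarrow>\<^sub>0 'k) set \<Rightarrow>
     ((nat \<times> nat) fword \<Rightarrow>\<^sub>0 'k) set \<Rightarrow> bool" where
  "minor_less q m n a b \<longleftrightarrow> minor_le q m n a b \<and> a \<noteq> b"

definition saturated_path ::
    "'k::field \<Rightarrow> nat \<Rightarrow> nat \<Rightarrow> ((nat \<times> nat) fword \<Rightarrow>\<^sub>0 'k) set \<Rightarrow>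
     ((nat \<times> nat) fword \<Rightarrow>\<^sub>0 'k) set \<Rightarrow> ((nat \<times> nat) fword \<Rightarrow>\<^sub>0 'k) set list \<Rightarrow> bool" where
  "saturated_path q m n a b p \<longleftrightarrow>
     p \<noteq> [] \<and> set p \<subseteq> qminors q m n \<and> hd p = a \<and> last p = b \<and>
     (\<forall>i. Suc i < length p \<longrightarrow> minor_less q m n (p ! i) (p ! Suc i) \<and>
        \<not> (\<exists>d \<in> qminors q m n. minor_less q m n (p ! i) d \<and> minor_less q m n d (p ! Suc i)))"

definition maximal_path ::
    "'k::field \<Rightarrow> nat \<Rightarrow> nat \<Rightarrow> ((nat \<times> nat) fword \<Rightarrow>\<^sub>0 'k) set list \<Rightarrow> bool" where
  "maximal_path q m n p \<longleftrightarrow>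
     saturated_path q m n (qminor q m n {1..m}) (qminor q m n {n - m + 1..n}) p"

text \<open>Well defined because all maximal paths have the same number of minors.\<close>

definition maximal_path_length :: "'k::field \<Rightarrow> nat \<Rightarrow> nat \<Rightarrow> nat" where
  "maximal_path_length q m n = (THE l. \<exists>p. maximal_path q m n p \<and> l = length p)"

end

theory Submission
  imports Defs "HOL-Combinatorics.Multiset_Permutations" "HOL-Library.Function_Algebras"
    "HOL-Library.Product_Lexorder"
begin

text \<open>
  Bidiagonal matrices whose entries \<open>q\<close>-commute along the staircase are quantum matrices, and so are
  products of quantum matrices with mutually commuting entries. A suitable product \<open>X\<close> of bidiagonal
  matrices of monomial operators makes every \<open>X\<^sub>i\<^sub>j\<close> a sum of monomials with a dominant one. The dominant
  exponents are linearly independent and their weights are strictly supermodular in \<open>(i, j)\<close>. Together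
  with straightening into sorted words, independence shows that \<open>X\<close> gives a faithful representation
  of the algebra of quantum matrices; supermodularity shows that the diagonal term of a minor dominates.

  For the upper bound write \<open>X = Z x\<close>, where \<open>Z\<close> is square and \<open>x\<close> is the product of the last \<open>n - m\<close>
  bidiagonal factors, so that \<open>x\<^sub>i\<^sub>j = 0\<close> unless \<open>i \<le> j \<le> i + n - m\<close>. Then \<open>[J](X) = det\<^sub>q(Z) [J](x)\<close>, and a
  product of \<open>r\<close> minors lies in \<open>det\<^sub>q(Z)\<^sup>r\<close> times the span of the sorted words in the entries of the band
  that use every row \<open>r\<close> times; there are at most \<open>(r + 1)\<close> to the power \<open>m (n - m)\<close> of these.
  For the lower bound, the monomials in the minors of a maximal chain have distinct leading exponents.
\<close>

section \<open>Products of quantum matrices\<close>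

text \<open>The factor \<open>Z\<close> answers an obstacle in the upper bound: sorted words in the
  entries of \<open>X\<close> that use every row r times still leave n - 1 free multiplicities per
  row, which is too many. Geometrically, a change of basis of the m rows multiplies all maximal
  minors by one common factor, and the matrices supported on the band parametrize a dense part of
  the Grassmannian. The band has n - m + 1 entries per row, and fixing the degree in each row
  removes one of them. This leaves m (n - m) parameters, and the degree r supplies the last one.

  Bidiagonal factors are borrowed from the factorization of totally positive matrices: an entry of
  the product is a sum over lattice paths through a planar network, with one variable per step, and
  the weights are chosen so that for every entry a single path wins. The variables are realized as
  operators because associativity is then automatic and a linear combination can be tested on a
  single vector. Leading coefficients are powers of q up to sign, so the argument is uniform in q,
  roots of unity included.\<close>

definition quantum_matrix :: "'r::ring_1 \<Rightarrow> 'r \<Rightarrow> nat \<Rightarrow> nat \<Rightarrow> (nat \<Rightarrow> nat \<Rightarrow> 'r) \<Rightarrow> bool" where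
  "quantum_matrix Q Q' m n X \<longleftrightarrow>
     (\<forall>i j l. 1 \<le> i \<and> i \<le> m \<and> 1 \<le> j \<and> j < l \<and> l \<le> n \<longrightarrow> X i j * X i l = Q * X i l * X i j) \<and>
     (\<forall>i k j. 1 \<le> i \<and> i < k \<and> k \<le> m \<and> 1 \<le> j \<and> j \<le> n \<longrightarrow> X i j * X k j = Q * X k j * X i j) \<and>
     (\<forall>i k j l. 1 \<le> i \<and> i < k \<and> k \<le> m \<and> 1 \<le> j \<and> j < l \<and> l \<le> n \<longrightarrow>
        X i l * X k j = X k j * X i l \<and>
        X i j * X k l = X k l * X i j + (Q - Q') * X i l * X k j)"

lemma quantum_matrixD:
  assumes "quantum_matrix Q Q' m n X"
  shows "1 \<le> i \<Longrightarrow> i \<le> m \<Longrightarrow> 1 \<le> j \<Longrightarrow> j < l \<Longrightarrow> l \<le> n \<Longrightarrow> X i j * X i l = Q * X i l * X i j"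
    and "1 \<le> i \<Longrightarrow> i < k \<Longrightarrow> k \<le> m \<Longrightarrow> 1 \<le> j \<Longrightarrow> j \<le> n \<Longrightarrow> X i j * X k j = Q * X k j * X i j"
    and "1 \<le> i \<Longrightarrow> i < k \<Longrightarrow> k \<le> m \<Longrightarrow> 1 \<le> j \<Longrightarrow> j < l \<Longrightarrow> l \<le> n \<Longrightarrow> X i l * X k j = X k j * X i l"
    and "1 \<le> i \<Longrightarrow> i < k \<Longrightarrow> k \<le> m \<Longrightarrow> 1 \<le> j \<Longrightarrow> j < l \<Longrightarrow> l \<le> n \<Longrightarrow>
           X i j * X k l = X k l * X i j + (Q - Q') * X i l * X k j"
  using assms unfolding quantum_matrix_def by blast+

definition matrix_prod :: "nat \<Rightarrow> (nat \<Rightarrow> nat \<Rightarrow> 'r::ring_1) \<Rightarrow> (nat \<Rightarrow> nat \<Rightarrow> 'r) \<Rightarrow> nat \<Rightarrow> nat \<Rightarrow> 'r" where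
  "matrix_prod r X Y i j = (\<Sum>k=1..r. X i k * Y k j)"

text \<open>Pairing \<open>(a, b)\<close> with \<open>(b, a)\<close> fits the shape of the
  relations: each involves only two row or column indices, so an identity between products of two
  matrix entries can be checked for one pair of summation indices at a time.\<close>

lemma double_sum_eqI:
  fixes f g :: "nat \<Rightarrow> nat \<Rightarrow> 'a::comm_monoid_add"
  assumes "\<And>a. 1 \<le> a \<Longrightarrow> a \<le> r \<Longrightarrow> f a a = g a a"
    and "\<And>a b. 1 \<le> a \<Longrightarrow> a < b \<Longrightarrow> b \<le> r \<Longrightarrow> f a b + f b a = g a b + g b a"
  shows "(\<Sum>a=1..r. \<Sum>b=1..r. f a b) = (\<Sum>a=1..r. \<Sum>b=1..r. g a b)"
  using assms
proof (induction r)
  case (Suc r)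
  have split: "(\<Sum>a=1..Suc r. \<Sum>b=1..Suc r. h a b)
      = (\<Sum>a=1..r. \<Sum>b=1..r. h a b) + (\<Sum>a=1..r. h a (Suc r) + h (Suc r) a) + h (Suc r) (Suc r)"
    for h :: "nat \<Rightarrow> nat \<Rightarrow> 'a"
    by (simp add: sum.distrib algebra_simps)
  have "(\<Sum>a=1..r. f a (Suc r) + f (Suc r) a) = (\<Sum>a=1..r. g a (Suc r) + g (Suc r) a)"
    by (intro sum.cong) (use Suc.prems in auto)
  then show ?case
    unfolding split using Suc by simp
qed simp

lemma matrix_prod_mult:
  assumes "\<And>i k k' l. X i k * Y k' l = Y k' l * X i k"
  shows "matrix_prod r X Y i j * matrix_prod r X Y k l
           = (\<Sum>a=1..r. \<Sum>b=1..r. (X i a * X k b) * (Y a j * Y b l))"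
  unfolding matrix_prod_def sum_product
  by (intro sum.cong refl) (metis (no_types, lifting) assms mult.assoc)

text \<open>This is the comultiplication of quantum matrices. Once the entries of \<open>X\<close>
  and \<open>Y\<close> are separated, each relation already holds for every unordered pair of
  summation indices alone, where the corrections with factor \<open>Q - Q'\<close> combine by means
  of \<open>Q * Q' = 1\<close>.\<close>

lemma quantum_matrix_prod:
  fixes Q Q' :: "'r::ring_1"
  assumes X: "quantum_matrix Q Q' m r X" and Y: "quantum_matrix Q Q' r n Y"
    and comm: "\<And>i k k' l. X i k * Y k' l = Y k' l * X i k"
    and Q: "\<And>x. Q * x = x * Q" "\<And>x. Q' * x = x * Q'" "Q * Q' = 1"
  shows "quantum_matrix Q Q' m n (matrix_prod r X Y)"
proof -
  note mm = matrix_prod_mult[of X Y, OF comm]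
  note qX = quantum_matrixD[OF X] and qY = quantum_matrixD[OF Y]
  have QQ: "Q * (Q' * x) = x" "Q' * (Q * x) = x" for x
    using Q by (metis mult.assoc mult_1)+
  have pull: "X i j * (Q * y) = Q * (X i j * y)" "X i j * (Q' * y) = Q' * (X i j * y)"
    "Y i j * (Q * y) = Q * (Y i j * y)" "Y i j * (Q' * y) = Q' * (Y i j * y)" for y i j
    using Q by (metis mult.assoc)+
  note nrm = mult.assoc pull algebra_simps QQ
  have row: "matrix_prod r X Y i j * matrix_prod r X Y i l = Q * matrix_prod r X Y i l * matrix_prod r X Y i j"
    if "1 \<le> i" "i \<le> m" "1 \<le> j" "j < l" "l \<le> n" for i j l
    unfolding mult.assoc[of Q] mm sum_distrib_left
  proof (rule double_sum_eqI)
    fix a assume a: "1 \<le> a" "a \<le> r"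
    show "X i a * X i a * (Y a j * Y a l) = Q * (X i a * X i a * (Y a l * Y a j))"
      using qY(1)[of a j l] a that by (simp add: nrm)
  next
    fix a b assume a: "1 \<le> a" "a < b" "b \<le> r"
    have 1: "X i a * X i b = Q * (X i b * X i a)" using qX(1)[of i a b] a that by (simp add: nrm)
    have 2: "Y a l * Y b j = Y b j * Y a l" using qY(3)[of a b j l] a that by simp
    have 3: "Y a j * Y b l = Y b l * Y a j + (Q - Q') * (Y b j * Y a l)"
      using qY(4)[of a b j l] a that 2 by (simp add: nrm)
    show "X i a * X i b * (Y a j * Y b l) + X i b * X i a * (Y b j * Y a l) =
          Q * (X i a * X i b * (Y a l * Y b j)) + Q * (X i b * X i a * (Y b l * Y a j))"
      unfolding 1 2 3 by (simp add: nrm)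
  qed
  have col: "matrix_prod r X Y i j * matrix_prod r X Y k j = Q * matrix_prod r X Y k j * matrix_prod r X Y i j"
    if "1 \<le> i" "i < k" "k \<le> m" "1 \<le> j" "j \<le> n" for i j k
    unfolding mult.assoc[of Q] mm sum_distrib_left
  proof (rule double_sum_eqI)
    fix a assume a: "1 \<le> a" "a \<le> r"
    show "X i a * X k a * (Y a j * Y a j) = Q * (X k a * X i a * (Y a j * Y a j))"
      using qX(2)[of i k a] a that by (simp add: nrm)
  next
    fix a b assume a: "1 \<le> a" "a < b" "b \<le> r"
    have 1: "Y a j * Y b j = Q * (Y b j * Y a j)" using qY(2)[of a b j] a that by (simp add: nrm)
    have 2: "X i b * X k a = X k a * X i b" using qX(3)[of i k a b] a that by simp
    have 3: "X i a * X k b = X k b * X i a + (Q - Q') * (X k a * X i b)"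
      using qX(4)[of i k a b] a that 2 by (simp add: nrm)
    show "X i a * X k b * (Y a j * Y b j) + X i b * X k a * (Y b j * Y a j) =
          Q * (X k a * X i b * (Y a j * Y b j)) + Q * (X k b * X i a * (Y b j * Y a j))"
      unfolding 1 2 3 by (simp add: nrm)
  qed
  have cross: "matrix_prod r X Y i l * matrix_prod r X Y k j = matrix_prod r X Y k j * matrix_prod r X Y i l"
     and diag: "matrix_prod r X Y i j * matrix_prod r X Y k l =
        matrix_prod r X Y k l * matrix_prod r X Y i j + (Q - Q') * matrix_prod r X Y i l * matrix_prod r X Y k j"
    if "1 \<le> i" "i < k" "k \<le> m" "1 \<le> j" "j < l" "l \<le> n" for i j k l
  proof -
    have rels:
      "X i b * X k a = X k a * X i b" "X i a * X k b = X k b * X i a + (Q - Q') * (X k a * X i b)"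
      "Y a l * Y b j = Y b j * Y a l" "Y a j * Y b l = Y b l * Y a j + (Q - Q') * (Y b j * Y a l)"
      if a: "1 \<le> a" "a < b" "b \<le> r" for a b
    proof -
      show 1: "X i b * X k a = X k a * X i b" 
        using qX(3)[of i k a b] a \<open>1 \<le> i\<close> \<open>i < k\<close> \<open>k \<le> m\<close> by simp
      show 2: "Y a l * Y b j = Y b j * Y a l" 
        using qY(3)[of a b j l] a \<open>1 \<le> j\<close> \<open>j < l\<close> \<open>l \<le> n\<close> by simp
      show "X i a * X k b = X k b * X i a + (Q - Q') * (X k a * X i b)"
        using qX(4)[of i k a b] a \<open>1 \<le> i\<close> \<open>i < k\<close> \<open>k \<le> m\<close> 1 by (simp add: nrm)
      show "Y a j * Y b l = Y b l * Y a j + (Q - Q') * (Y b j * Y a l)"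
        using qY(4)[of a b j l] a \<open>1 \<le> j\<close> \<open>j < l\<close> \<open>l \<le> n\<close> 2 by (simp add: nrm)
    qed
    have rels1: "X i a * X k a = Q * (X k a * X i a)" "Y a j * Y a l = Q * (Y a l * Y a j)"
      "Y a l * Y a j = Q' * (Y a j * Y a l)"
      if a: "1 \<le> a" "a \<le> r" for a
    proof -
      show "X i a * X k a = Q * (X k a * X i a)"
        using qX(2)[of i k a] a \<open>1 \<le> i\<close> \<open>i < k\<close> \<open>k \<le> m\<close> by (simp add: nrm)
      show y: "Y a j * Y a l = Q * (Y a l * Y a j)"
        using qY(1)[of a j l] a \<open>1 \<le> j\<close> \<open>j < l\<close> \<open>l \<le> n\<close> by (simp add: nrm)
      show "Y a l * Y a j = Q' * (Y a j * Y a l)" unfolding y by (simp add: nrm)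
    qed
    show "matrix_prod r X Y i l * matrix_prod r X Y k j = matrix_prod r X Y k j * matrix_prod r X Y i l"
      unfolding mm
    proof (rule double_sum_eqI)
      fix a assume a: "1 \<le> a" "a \<le> r"
      show "X i a * X k a * (Y a l * Y a j) = X k a * X i a * (Y a j * Y a l)"
        unfolding rels1(1,2)[OF a] by (simp add: nrm)
    next
      fix a b assume a: "1 \<le> a" "a < b" "b \<le> r"
      show "X i a * X k b * (Y a l * Y b j) + X i b * X k a * (Y b l * Y a j) =
            X k a * X i b * (Y a j * Y b l) + X k b * X i a * (Y b j * Y a l)"
        unfolding rels[OF a] by (simp add: nrm)
    qed
    show "matrix_prod r X Y i j * matrix_prod r X Y k l =
        matrix_prod r X Y k l * matrix_prod r X Y i j + (Q - Q') * matrix_prod r X Y i l * matrix_prod r X Y k j"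
      unfolding mult.assoc[of "Q - Q'"] mm sum_distrib_left sum.distrib[symmetric]
    proof (rule double_sum_eqI)
      fix a assume a: "1 \<le> a" "a \<le> r"
      show "X i a * X k a * (Y a j * Y a l) = X k a * X i a * (Y a l * Y a j)
              + (Q - Q') * (X i a * X k a * (Y a l * Y a j))"
        unfolding rels1(1,2)[OF a] by (simp add: nrm)
    next
      fix a b assume a: "1 \<le> a" "a < b" "b \<le> r"
      show "X i a * X k b * (Y a j * Y b l) + X i b * X k a * (Y b j * Y a l) =
            X k a * X i b * (Y a l * Y b j) + (Q - Q') * (X i a * X k b * (Y a l * Y b j)) +
            (X k b * X i a * (Y b l * Y a j) + (Q - Q') * (X i b * X k a * (Y b l * Y a j)))"
        unfolding rels[OF a] by (simp add: nrm)
    qed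
  qed
  show ?thesis
    unfolding quantum_matrix_def using row col cross diag by blast
qed

section \<open>Quantum determinants\<close>

primrec inversions :: "'a::linorder list \<Rightarrow> nat" where
  "inversions [] = 0"
| "inversions (x # xs) = length (filter (\<lambda>y. y < x) xs) + inversions xs"

lemma inversions_swap:
  assumes "b < a"
  shows "inversions (us @ [a, b] @ vs) = Suc (inversions (us @ [b, a] @ vs))"
  using assms by (induction us) auto

lemma not_sortedE:
  assumes "\<not> sorted xs"
  obtains us a b vs where "xs = us @ [a, b] @ vs" "b < a"
proof -
  obtain i where i: "Suc i < length xs" "xs ! Suc i < xs ! i"
    using assms unfolding sorted_iff_nth_Suc by (auto simp: not_le)
  have "xs = take i xs @ [xs ! i, xs ! Suc i] @ drop (Suc (Suc i)) xs"
    using i by (metis append.assoc append_Cons append_Nil id_take_nth_drop Cons_nth_drop_Suc Suc_lessD)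
  with i that show thesis by blast
qed

text \<open>Induction along adjacent transpositions. The number of inversions drops with every swap,
  so an argument about row lists or column orders has to treat only sorted lists and one
  neighbouring pair.\<close>

lemma bubble_induct [case_names sorted swap]:
  assumes "\<And>xs. sorted xs \<Longrightarrow> P xs"
    and "\<And>us a b vs. b < a \<Longrightarrow> P (us @ [b, a] @ vs) \<Longrightarrow> P (us @ [a, b] @ vs)"
  shows "P xs"
proof (induction "inversions xs" arbitrary: xs rule: less_induct)
  case less
  show ?case
  proof (cases "sorted xs")
    case False
    then obtain us a b vs where xs: "xs = us @ [a, b] @ vs" "b < a" by (rule not_sortedE)
    have "inversions (us @ [b, a] @ vs) < inversions xs"
      unfolding xs(1) inversions_swap[OF xs(2)] by simp
    from less[OF this] assms(2)[OF xs(2)] show ?thesis unfolding xs(1) by blast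
  qed (use assms(1) in blast)
qed

lemma inversions_sorted: "sorted xs \<Longrightarrow> inversions xs = 0"
  by (induction xs) (auto simp: filter_empty_conv)

definition swap_at :: "nat \<Rightarrow> 'a list \<Rightarrow> 'a list" where
  "swap_at p xs = take p xs @ [xs ! Suc p, xs ! p] @ drop (Suc (Suc p)) xs"

lemma swap_at_append:
  assumes "length us = p"
  shows "swap_at p (us @ [c, d] @ vs) = us @ [d, c] @ vs"
  using assms by (auto simp: swap_at_def nth_append)

lemma split_at_adjacent:
  assumes "Suc p < length xs"
  obtains us c d vs where "xs = us @ [c, d] @ vs" "length us = p" "xs ! p = c" "xs ! Suc p = d"
proof -
  have "xs = take p xs @ [xs ! p, xs ! Suc p] @ drop (Suc (Suc p)) xs"
    using assms by (metis append.assoc append_Cons append_Nil id_take_nth_drop Cons_nth_drop_Suc Suc_lessD)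
  with that assms show thesis by simp
qed

text \<open>Exchanging the entries at \<open>p\<close> and \<open>Suc p\<close> is an involution
  without fixed points on the orderings of \<open>J\<close>, and each orbit contains exactly one
  ordering that ascends there.\<close>

lemma sum_permutations_of_set_adjacent:
  fixes f :: "'a::linorder list \<Rightarrow> 'b::comm_monoid_add"
  assumes "Suc p < card J"
  shows "(\<Sum>cs\<in>permutations_of_set J. f cs)
       = (\<Sum>cs | cs \<in> permutations_of_set J \<and> cs ! p < cs ! Suc p. f cs + f (swap_at p cs))"
proof -
  have fin: "finite (permutations_of_set J)" by simp
  define A where "A = {cs \<in> permutations_of_set J. cs ! p < cs ! Suc p}"
  define B where "B = {cs \<in> permutations_of_set J. cs ! Suc p < cs ! p}"
  have len: "Suc p < length cs" if "cs \<in> permutations_of_set J" for cs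
    using that assms by (metis length_finite_permutations_of_set)
  have AB: "permutations_of_set J = A \<union> B" "A \<inter> B = {}"
    using len by (auto simp: A_def B_def permutations_of_set_def nth_eq_iff_index_eq neq_iff
        dest!: len) (metis distinct_conv_nth Suc_lessD n_not_Suc_n neq_iff)
  have sw: "cs \<in> A \<Longrightarrow> swap_at p cs \<in> B" "cs \<in> B \<Longrightarrow> swap_at p cs \<in> A" "swap_at p (swap_at p cs) = cs"
    if cs: "cs \<in> permutations_of_set J" for cs
  proof -
    obtain us c d vs where "cs = us @ [c, d] @ vs" "length us = p" "cs ! p = c" "cs ! Suc p = d"
      using split_at_adjacent[OF len[OF cs]] by blast
    then show "cs \<in> A \<Longrightarrow> swap_at p cs \<in> B" "cs \<in> B \<Longrightarrow> swap_at p cs \<in> A" "swap_at p (swap_at p cs) = cs"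
      using swap_at_append[of us p d c vs] swap_at_append[of us p c d vs]
      by (auto simp: A_def B_def permutations_of_set_def nth_append)
  qed
  have "sum f (permutations_of_set J) = sum f A + sum f B"
    unfolding AB(1) using AB fin by (intro sum.union_disjoint) (auto simp: A_def B_def)
  also have "sum f B = (\<Sum>cs\<in>A. f (swap_at p cs))"
    by (rule sum.reindex_bij_witness[of _ "swap_at p" "swap_at p"]) (use sw AB in auto)
  finally show ?thesis by (simp add: sum.distrib A_def)
qed

text \<open>The row list \<open>ks\<close> is arbitrary and may repeat rows, because expanding a
  matrix product produces all such lists. Columns are given by orderings of \<open>J\<close> instead
  of permutations, so that adjacent exchanges act directly on lists.\<close>

definition qdet :: "'r::ring_1 \<Rightarrow> (nat \<Rightarrow> nat \<Rightarrow> 'r) \<Rightarrow> nat list \<Rightarrow> nat set \<Rightarrow> 'r" where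
  "qdet Q X ks J = (\<Sum>cs\<in>permutations_of_set J. (- Q) ^ inversions cs * prod_list (map2 X ks cs))"

context
  fixes Q Q' :: "'r::ring_1"
  assumes Q: "\<And>x. Q * x = x * Q" "\<And>x. Q' * x = x * Q'" "Q * Q' = 1"
begin

lemma power_uminus_central: "x * (- Q) ^ i = (- Q) ^ i * x"
proof (induction i)
  case (Suc i)
  have "x * (- Q) ^ Suc i = (x * (- Q)) * (- Q) ^ i" by (simp add: mult.assoc)
  also have "x * (- Q) = (- Q) * x" using Q(1) by simp
  finally show ?case using Suc by (simp add: mult.assoc)
qed simp

text \<open>Pairing each ordering with its exchange at the position of \<open>a, b\<close> exposes a
  2 by 2 quantum determinant inside every pair of summands, so a proportionality of these small
  determinants passes to the whole sum. The two uses have \<open>t = 0\<close> for equal rows and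
  \<open>t = - Q\<close> for rows in the wrong order.\<close>

lemma qdet_adjacent:
  assumes "card J = length (us @ [a, b] @ vs)"
    and "\<And>c d. c \<in> J \<Longrightarrow> d \<in> J \<Longrightarrow> c < d \<Longrightarrow>
           X a c * X b d - Q * X a d * X b c = t * (X a' c * X b' d - Q * X a' d * X b' c)"
    and "\<And>x. x * t = t * x"
  shows "qdet Q X (us @ [a, b] @ vs) J = t * qdet Q X (us @ [a', b'] @ vs) J"
proof -
  define p where "p = length us"
  have p: "Suc p < card J" using assms(1) by (simp add: p_def)
  have red: "(- Q) ^ inversions cs * prod_list (map2 X (us @ [a, b] @ vs) cs) +
     (- Q) ^ inversions (swap_at p cs) * prod_list (map2 X (us @ [a, b] @ vs) (swap_at p cs))
     = (- Q) ^ inversions (take p cs @ [cs ! p, cs ! Suc p] @ drop (Suc (Suc p)) cs) *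
        (prod_list (map2 X us (take p cs)) *
         (X a (cs ! p) * X b (cs ! Suc p) - Q * X a (cs ! Suc p) * X b (cs ! p)) *
         prod_list (map2 X vs (drop (Suc (Suc p)) cs)))"
    if cs: "cs \<in> permutations_of_set J" "cs ! p < cs ! Suc p" for cs a b
  proof -
    have "length cs = card J" using cs(1) by (rule length_finite_permutations_of_set)
    with p obtain us' c d vs' where *: "cs = us' @ [c, d] @ vs'" "length us' = p" "cs ! p = c" "cs ! Suc p = d"
      by (metis split_at_adjacent)
    have cd: "c < d" using cs(2) * by simp
    have i: "inversions (us' @ [d, c] @ vs') = Suc (inversions (us' @ [c, d] @ vs'))"
      by (rule inversions_swap[OF cd])
    have ln: "length us = length us'" using * p_def by simp
    have pl: "prod_list (map2 X (us @ [a, b] @ vs) (us' @ [e, f] @ vs')) =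
       prod_list (map2 X us us') * (X a e * X b f) * prod_list (map2 X vs vs')" for e f
      using ln by (simp add: mult.assoc)
    have "(- Q) ^ inversions cs * prod_list (map2 X (us @ [a, b] @ vs) cs) +
     (- Q) ^ inversions (swap_at p cs) * prod_list (map2 X (us @ [a, b] @ vs) (swap_at p cs))
      = (- Q) ^ inversions cs * (prod_list (map2 X us us') * (X a c * X b d) * prod_list (map2 X vs vs')
          + (- Q) * (prod_list (map2 X us us') * (X a d * X b c) * prod_list (map2 X vs vs')))"
      unfolding *(1) swap_at_append[OF *(2)] i pl 
      by (simp only: power_Suc2 distrib_left mult.assoc)
    also have "(- Q) * (prod_list (map2 X us us') * (X a d * X b c) * prod_list (map2 X vs vs'))
       = - (prod_list (map2 X us us') * (Q * (X a d * X b c)) * prod_list (map2 X vs vs'))"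
      by (metis (no_types, lifting) Q(1) minus_mult_left mult.assoc)
    finally show ?thesis
      using * by (simp add: algebra_simps)
  qed
  have tc: "x * (t * y) = t * (x * y)" for x y using assms(3) by (metis mult.assoc)
  show ?thesis
    unfolding qdet_def sum_permutations_of_set_adjacent[OF p] sum_distrib_left
  proof (intro sum.cong refl)
    fix cs assume "cs \<in> {cs \<in> permutations_of_set J. cs ! p < cs ! Suc p}"
    then have cs: "cs \<in> permutations_of_set J" "cs ! p < cs ! Suc p" by auto
    have l: "length cs = card J" using cs(1) by (rule length_finite_permutations_of_set)
    have "cs ! p \<in> J" "cs ! Suc p \<in> J"
      using cs(1) p l nth_mem[of p cs] nth_mem[of "Suc p" cs] by (auto simp: permutations_of_set_def)
    note e = assms(2)[OF this cs(2)]
    show "(- Q) ^ inversions cs * prod_list (map2 X (us @ [a, b] @ vs) cs) +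
     (- Q) ^ inversions (swap_at p cs) * prod_list (map2 X (us @ [a, b] @ vs) (swap_at p cs)) =
     t * ((- Q) ^ inversions cs * prod_list (map2 X (us @ [a', b'] @ vs) cs) +
     (- Q) ^ inversions (swap_at p cs) * prod_list (map2 X (us @ [a', b'] @ vs) (swap_at p cs)))"
      unfolding red[OF cs] e by (simp only: mult.assoc tc)
  qed
qed

lemma qdet_permute_rows:
  assumes X: "quantum_matrix Q Q' m n X"
    and J: "J \<subseteq> {1..n}" "card J = length ks" "set ks \<subseteq> {1..m}"
  shows "qdet Q X ks J = (if distinct ks then (- Q) ^ inversions ks * qdet Q X (sort ks) J else 0)"
  using J(2,3)
proof (induction ks rule: bubble_induct)
  case (sorted xs)
  show ?case
  proof (cases "distinct xs")
    case True
    then show ?thesis using sorted by (simp add: inversions_sorted sorted_sort_id)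
  next
    case False
    then have "\<not> sorted_wrt (<) xs" by (simp add: strict_sorted_iff)
    then obtain i where i: "Suc i < length xs" "\<not> xs ! i < xs ! Suc i"
      by (auto simp: sorted_wrt_iff_nth_Suc_transp)
    with sorted(1) have "xs ! i = xs ! Suc i" by (simp add: sorted_iff_nth_Suc order.antisym not_less)
    with i(1) obtain us a vs where xs: "xs = us @ [a, a] @ vs"
      by (metis split_at_adjacent)
    \<comment> \<open>For two equal neighbouring rows the relation within a row makes the 2 by 2
      determinant vanish, hence the factor 0.\<close>
    have "qdet Q X (us @ [a, a] @ vs) J = 0 * qdet Q X (us @ [a, a] @ vs) J"
    proof (rule qdet_adjacent)
      fix c d assume "c \<in> J" "d \<in> J" "c < d"
      then show "X a c * X a d - Q * X a d * X a c = 0 * (X a c * X a d - Q * X a d * X a c)"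
        using quantum_matrixD(1)[OF X, of a c d] subsetD[OF J(1), of c] subsetD[OF J(1), of d] sorted(3) xs
        by auto
    qed (use sorted xs in auto)
    then show ?thesis using False xs by simp
  qed
next
  case (swap us a b vs)
  have "qdet Q X (us @ [a, b] @ vs) J = (- Q) * qdet Q X (us @ [b, a] @ vs) J"
  proof (rule qdet_adjacent)
    fix c d assume cd: "c \<in> J" "d \<in> J" "c < d"
    have r: "1 \<le> b" "a \<le> m" "1 \<le> c" "d \<le> n" using swap.prems cd J(1) by auto
    have 1: "X a c * X b d = X b d * X a c"
      using quantum_matrixD(3)[OF X r(1) swap.hyps r(2) r(3) cd(3) r(4)] by simp
    have 2: "X a d * X b c = X b c * X a d - (Q - Q') * X b d * X a c"
      using quantum_matrixD(4)[OF X r(1) swap.hyps r(2) r(3) cd(3) r(4)] by simp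
    have QQ: "Q * (Q' * x) = x" for x using Q(3) by (metis mult.assoc mult_1)
    show "X a c * X b d - Q * X a d * X b c = - Q * (X b c * X a d - Q * X b d * X a c)"
      unfolding mult.assoc 1 2 by (simp add: algebra_simps QQ)
  qed (use swap.prems Q(1) in auto)
  moreover have "sort (us @ [a, b] @ vs) = sort (us @ [b, a] @ vs)"
    by (rule properties_for_sort) auto
  ultimately show ?case
    using swap.IH swap.prems inversions_swap[OF swap.hyps, of us vs]
    by (auto simp: mult.assoc)
qed

lemma prod_list_matrix_prod:
  fixes Z Y :: "nat \<Rightarrow> nat \<Rightarrow> 'r"
  assumes comm: "\<And>i k k' l. Z i k * Y k' l = Y k' l * Z i k"
    and "length rs = length cs"
  shows "prod_list (map2 (matrix_prod r Z Y) rs cs) =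
    (\<Sum>ks | set ks \<subseteq> {1..r} \<and> length ks = length rs. prod_list (map2 Z rs ks) * prod_list (map2 Y ks cs))"
  using assms(2)
proof (induction rs cs rule: list_induct2)
  case Nil
  have "{ks. set ks \<subseteq> {1..r} \<and> length ks = length ([]::nat list)} = {[]}" by auto
  then show ?case by simp
next
  case (Cons i rs j cs)
  have pc: "Y k j * prod_list (map2 Z rs ks) = prod_list (map2 Z rs ks) * Y k j" for k ks
  proof (induction rs arbitrary: ks)
    case (Cons i rs)
    show ?case
    proof (cases ks)
      case (Cons l ks')
      then show ?thesis using Cons.IH[of ks'] comm by simp (metis mult.assoc)
    qed simp
  qed simp
  let ?K = "{ks. set ks \<subseteq> {1..r} \<and> length ks = length rs}"
  have K: "{ks. set ks \<subseteq> {1..r} \<and> length ks = length (i # rs)} = (\<lambda>(k, ks). k # ks) ` ({1..r} \<times> ?K)"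
    by (auto simp: length_Suc_conv image_iff)
  have reindex: "(\<Sum>ks | set ks \<subseteq> {1..r} \<and> length ks = length (i # rs). F ks)
      = (\<Sum>k=1..r. \<Sum>ks\<in>?K. F (k # ks))" for F :: "nat list \<Rightarrow> 'r"
    unfolding K sum.cartesian_product
    by (subst sum.reindex) (auto simp: inj_on_def case_prod_beta)
  have "prod_list (map2 (matrix_prod r Z Y) (i # rs) (j # cs)) =
      (\<Sum>k=1..r. \<Sum>ks\<in>?K. (Z i k * Y k j) * (prod_list (map2 Z rs ks) * prod_list (map2 Y ks cs)))"
    using Cons.IH by (simp add: matrix_prod_def sum_product)
  also have "\<dots> = (\<Sum>k=1..r. \<Sum>ks\<in>?K. prod_list (map2 Z (i # rs) (k # ks)) * prod_list (map2 Y (k # ks) (j # cs)))"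
    by (intro sum.cong refl) (simp, metis (no_types, lifting) pc mult.assoc)
  finally show ?case
    unfolding reindex .
qed

text \<open>A Cauchy-Binet formula with a square left factor. Row lists of \<open>Y\<close> with
  repetitions vanish, and sorting a permutation \<open>ks\<close> produces
  \<open>(- Q) ^ inversions ks\<close>, which is exactly the coefficient needed for the quantum
  determinant of \<open>Z\<close>. Hence all maximal minors of the product share the factor from
  \<open>Z\<close>.\<close>

lemma qdet_matrix_prod:
  assumes Y: "quantum_matrix Q Q' m n Y"
    and comm: "\<And>i k k' l. Z i k * Y k' l = Y k' l * Z i k"
    and J: "J \<subseteq> {1..n}" "card J = m"
  shows "qdet Q (matrix_prod m Z Y) [1..<m+1] J = qdet Q Z [1..<m+1] {1..m} * qdet Q Y [1..<m+1] J"
proof -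
  let ?rs = "[1..<m+1]"
  let ?K = "{ks. set ks \<subseteq> {1..m} \<and> length ks = m}"
  note upt_Suc [simp del]
  have len: "length cs = m" if "cs \<in> permutations_of_set J" for cs
    using that J by (metis length_finite_permutations_of_set)
  have fK: "finite ?K" by (rule finite_lists_length_eq) simp
  have perm: "permutations_of_set {1..m} = {ks \<in> ?K. distinct ks}"
  proof (intro equalityI subsetI)
    fix ks assume "ks \<in> {ks \<in> ?K. distinct ks}"
    then show "ks \<in> permutations_of_set {1..m}"
      using card_subset_eq[of "{1..m}" "set ks"] by (auto simp: permutations_of_set_def distinct_card)
  next
    fix ks assume "ks \<in> permutations_of_set {1..m}"
    then show "ks \<in> {ks \<in> ?K. distinct ks}"
      using length_finite_permutations_of_set[of ks "{1..m}"] by (auto simp: permutations_of_set_def)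
  qed
  have srt: "sort ks = ?rs" if "ks \<in> permutations_of_set {1..m}" for ks
  proof (rule sorted_distinct_set_unique)
    have "set ks = {1..m}" "distinct ks" using that by (simp_all add: permutations_of_set_def)
    then show "distinct (sort ks)" "set (sort ks) = set ?rs"
      by (simp_all add: atLeastLessThanSuc_atLeastAtMost del: upt_Suc)
  qed (simp_all del: upt_Suc)
  have "qdet Q (matrix_prod m Z Y) ?rs J =
     (\<Sum>cs\<in>permutations_of_set J. \<Sum>ks\<in>?K. prod_list (map2 Z ?rs ks) *
        ((- Q) ^ inversions cs * prod_list (map2 Y ks cs)))"
    unfolding qdet_def
  proof (intro sum.cong refl)
    fix cs assume "cs \<in> permutations_of_set J"
    then have *: "length ?rs = length cs" using len by simp
    show "(- Q) ^ inversions cs * prod_list (map2 (matrix_prod m Z Y) ?rs cs) =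
     (\<Sum>ks\<in>?K. prod_list (map2 Z ?rs ks) * ((- Q) ^ inversions cs * prod_list (map2 Y ks cs)))"
      unfolding prod_list_matrix_prod[OF comm *] sum_distrib_left
      by (intro sum.cong) (auto, metis mult.assoc power_uminus_central)
  qed
  also have "\<dots> = (\<Sum>ks\<in>?K. prod_list (map2 Z ?rs ks) * qdet Q Y ks J)"
    unfolding qdet_def sum_distrib_left by (rule sum.swap)
  also have "\<dots> = (\<Sum>ks\<in>?K. if distinct ks then prod_list (map2 Z ?rs ks) * ((- Q) ^ inversions ks * qdet Q Y (sort ks) J) else 0)"
    using J by (intro sum.cong refl, subst qdet_permute_rows[OF Y]) auto
  also have "\<dots> = (\<Sum>ks\<in>permutations_of_set {1..m}. prod_list (map2 Z ?rs ks) * ((- Q) ^ inversions ks * qdet Q Y (sort ks) J))"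
    unfolding perm using fK by (subst sum.inter_filter[symmetric]) auto
  also have "\<dots> = (\<Sum>ks\<in>permutations_of_set {1..m}. (- Q) ^ inversions ks * prod_list (map2 Z ?rs ks) * qdet Q Y ?rs J)"
    by (intro sum.cong refl) (metis mult.assoc power_uminus_central srt)
  finally show ?thesis by (simp add: qdet_def sum_distrib_right)
qed

end

section \<open>Linear operators and leading exponents\<close>

typedef (overloaded) ('i, 'k::field) linop =
  "{T :: ('i \<Rightarrow> 'k) \<Rightarrow> 'i \<Rightarrow> 'k. \<forall>a b f g. T (\<lambda>x. a * f x + b * g x) = (\<lambda>x. a * T f x + b * T g x)}"
  morphisms apply_op Linop
  by (rule exI[of _ "\<lambda>f. f"]) simp

setup_lifting type_definition_linop

instantiation linop :: (type, field) ring_1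
begin

lift_definition zero_linop :: "('a, 'b) linop" is "\<lambda>f x. 0" by simp
lift_definition one_linop :: "('a, 'b) linop" is "\<lambda>f. f" by simp
lift_definition plus_linop :: "('a, 'b) linop \<Rightarrow> ('a, 'b) linop \<Rightarrow> ('a, 'b) linop"
  is "\<lambda>S T f x. S f x + T f x" by (simp add: algebra_simps)
lift_definition minus_linop :: "('a, 'b) linop \<Rightarrow> ('a, 'b) linop \<Rightarrow> ('a, 'b) linop"
  is "\<lambda>S T f x. S f x - T f x" by (simp add: algebra_simps)
lift_definition uminus_linop :: "('a, 'b) linop \<Rightarrow> ('a, 'b) linop"
  is "\<lambda>S f x. - S f x" by (simp add: algebra_simps)
lift_definition times_linop :: "('a, 'b) linop \<Rightarrow> ('a, 'b) linop \<Rightarrow> ('a, 'b) linop"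
  is "\<lambda>S T f. S (T f)" by simp

instance
proof
  fix a b c :: "('a, 'b) linop"
  show "a * b * c = a * (b * c)" by transfer simp
  show "a + b + c = a + (b + c)" by transfer (simp add: algebra_simps)
  show "a + b = b + a" by transfer (simp add: algebra_simps)
  show "0 + a = a" by transfer simp
  show "- a + a = 0" by transfer simp
  show "a - b = a + - b" by transfer simp
  show "1 * a = a" by transfer simp
  show "a * 1 = a" by transfer simp
  show "(a + b) * c = a * c + b * c" by transfer simp
  show "a * (b + c) = a * b + a * c"
  proof transfer
    fix A B C :: "('a \<Rightarrow> 'b) \<Rightarrow> 'a \<Rightarrow> 'b"
    assume "\<forall>a b f g. A (\<lambda>x. a * f x + b * g x) = (\<lambda>x. a * A f x + b * A g x)"
    from spec[OF spec[OF this, of 1], of 1] 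
    show "(\<lambda>f. A (\<lambda>x. B f x + C f x)) = (\<lambda>f x. A (B f) x + A (C f) x)" by simp
  qed
  show "(0 :: ('a, 'b) linop) \<noteq> 1"
    by transfer (auto simp: fun_eq_iff intro!: exI[of _ "\<lambda>_. 1"])
qed

end

lift_definition scalar_op :: "'k::field \<Rightarrow> ('i, 'k) linop" is "\<lambda>c f x. c * f x"
  by (simp add: algebra_simps)

lemma scalar_op_simps [simp]: "scalar_op 0 = 0" "scalar_op 1 = 1"
  by (transfer, simp)+

lemma scalar_op_add: "scalar_op (a + b) = scalar_op a + scalar_op b"
  by transfer (simp add: algebra_simps)

lemma scalar_op_minus: "scalar_op (- a) = - scalar_op a"
  by transfer simp

lemma scalar_op_diff: "scalar_op (a - b) = scalar_op a - scalar_op b"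
  by transfer (simp add: algebra_simps)

lemma scalar_op_mult: "scalar_op (a * b) = scalar_op a * scalar_op b"
  by transfer (simp add: algebra_simps)

lemma scalar_op_power: "scalar_op (a ^ n) = scalar_op a ^ n"
  by (induction n) (simp_all add: scalar_op_mult)

lemma scalar_op_central: "T * scalar_op c = scalar_op c * T"
proof transfer
  fix T :: "('a \<Rightarrow> 'b) \<Rightarrow> 'a \<Rightarrow> 'b" and c :: 'b
  assume "\<forall>a b f g. T (\<lambda>x. a * f x + b * g x) = (\<lambda>x. a * T f x + b * T g x)"
  from spec[OF spec[OF this, of c], of 0] 
  show "(\<lambda>f. T (\<lambda>x. c * f x)) = (\<lambda>f x. c * T f x)" by simp
qed

lemma scalar_op_left_commute: "T * (scalar_op c * S) = scalar_op c * (T * S)"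
  by (metis mult.assoc scalar_op_central)

global_interpretation linop: vector_space "\<lambda>c (T :: ('i, 'k::field) linop). scalar_op c * T"
  by unfold_locales (simp_all add: algebra_simps scalar_op_add scalar_op_mult)

section \<open>Leading exponents with respect to a weight\<close>

definition leads :: "('e \<Rightarrow> int) \<Rightarrow> ('e \<Rightarrow> 'k::field) \<Rightarrow> 'e \<Rightarrow> bool" where
  "leads w f v \<longleftrightarrow> f v \<noteq> 0 \<and> (\<forall>u. f u \<noteq> 0 \<longrightarrow> u = v \<or> w u < w v)"

definition op_bound :: "('e \<Rightarrow> int) \<Rightarrow> ('e, 'k::field) linop \<Rightarrow> int \<Rightarrow> bool" where
  "op_bound w T e \<longleftrightarrow> (\<forall>f b. (\<forall>u. f u \<noteq> 0 \<longrightarrow> w u \<le> b) \<longrightarrow> (\<forall>u. apply_op T f u \<noteq> 0 \<longrightarrow> w u \<le> b + e))"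

text \<open>Such an operator acts like multiplication by a monomial of exponent \<open>v\<close>, up
  to terms of lower weight. The bound is kept beside the action on leaders so that products with
  merely bounded operators can be estimated.\<close>

definition op_leads :: "('e \<Rightarrow> int) \<Rightarrow> ('e::plus, 'k::field) linop \<Rightarrow> 'e \<Rightarrow> bool" where
  "op_leads w T v \<longleftrightarrow> op_bound w T (w v) \<and> (\<forall>f z. leads w f z \<longrightarrow> leads w (apply_op T f) (z + v))"

lemma op_bound_0: "op_bound w 0 e"
  by (simp add: op_bound_def zero_linop.rep_eq)

lemma op_bound_mono: "op_bound w T e \<Longrightarrow> e \<le> e' \<Longrightarrow> op_bound w T e'"
  unfolding op_bound_def by (meson add_left_mono order_trans)

lemma op_bound_add: "op_bound w S e \<Longrightarrow> op_bound w T e \<Longrightarrow> op_bound w (S + T) e"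
  unfolding op_bound_def plus_linop.rep_eq by (metis add_0)

lemma op_bound_sum: "(\<And>i. i \<in> A \<Longrightarrow> op_bound w (T i) e) \<Longrightarrow> op_bound w (sum T A) e"
  by (induction A rule: infinite_finite_induct) (auto simp: op_bound_0 intro: op_bound_add)

lemma op_bound_mult: "op_bound w S e \<Longrightarrow> op_bound w T e' \<Longrightarrow> op_bound w (S * T) (e + e')"
  unfolding op_bound_def times_linop.rep_eq
proof (intro allI impI)
  fix f b u
  assume S: "\<forall>f b. (\<forall>u. f u \<noteq> 0 \<longrightarrow> w u \<le> b) \<longrightarrow> (\<forall>u. apply_op S f u \<noteq> 0 \<longrightarrow> w u \<le> b + e)"
    and T: "\<forall>f b. (\<forall>u. f u \<noteq> 0 \<longrightarrow> w u \<le> b) \<longrightarrow> (\<forall>u. apply_op T f u \<noteq> 0 \<longrightarrow> w u \<le> b + e')"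
    and f: "\<forall>u. f u \<noteq> 0 \<longrightarrow> w u \<le> b" and u: "apply_op S (apply_op T f) u \<noteq> 0"
  have "\<forall>u. apply_op T f u \<noteq> 0 \<longrightarrow> w u \<le> b + e'" using T f by blast
  then have "w u \<le> b + e' + e" using S u by blast
  then show "w u \<le> b + (e + e')" by simp
qed

lemma op_bound_scalar: "op_bound w (scalar_op c) 0"
  by (simp add: op_bound_def scalar_op.rep_eq)

lemma op_leads_bound: "op_leads w T v \<Longrightarrow> op_bound w T (w v)"
  by (simp add: op_leads_def)

context
  fixes w :: "('e::monoid_add) \<Rightarrow> int"
  assumes w: "\<And>u v. w (u + v) = w u + w v"
begin

text \<open>The right factor acts first, hence the order \<open>v + u\<close> of the exponents in a
  monoid whose addition need not commute.\<close>

lemma op_leads_mult: "op_leads w S u \<Longrightarrow> op_leads w T v \<Longrightarrow> op_leads w (S * T) (v + u)"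
  using op_bound_mult[of w S "w u" T "w v"]
  unfolding op_leads_def times_linop.rep_eq w add.assoc[symmetric] by (simp only: add.commute) blast

lemma op_leads_scalar:
  assumes "c \<noteq> 0"
  shows "op_leads w (scalar_op c) 0"
proof -
  have "w 0 = 0" using w[of 0 0] by simp
  with assms show ?thesis
    by (auto simp: op_leads_def leads_def scalar_op.rep_eq op_bound_scalar)
qed

lemma op_leads_add:
  fixes S T :: "('e, 'k::field) linop"
  assumes "op_leads w T v" "op_bound w S e" "e < w v"
  shows "op_leads w (T + S) v"
  unfolding op_leads_def
proof (intro conjI allI impI)
  show "op_bound w (T + S) (w v)"
    using op_bound_mono[OF assms(2), of "w v"] assms(3)
    by (intro op_bound_add op_leads_bound[OF assms(1)]) auto
  fix f :: "'e \<Rightarrow> 'k" and z assume f: "leads w f z"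
  then have "\<forall>u. f u \<noteq> 0 \<longrightarrow> w u \<le> w z" by (auto simp: leads_def)
  with assms(2) have S: "w u < w z + w v" if "apply_op S f u \<noteq> 0" for u
  proof -
    have "w u \<le> w z + e"
      using assms(2) \<open>\<forall>u. f u \<noteq> 0 \<longrightarrow> w u \<le> w z\<close> that unfolding op_bound_def by blast
    with assms(3) show ?thesis by simp
  qed
  have T: "leads w (apply_op T f) (z + v)" using assms(1) f by (simp add: op_leads_def)
  have "apply_op S f (z + v) = 0" using S[of "z + v"] w by auto
  then have "apply_op (T + S) f (z + v) \<noteq> 0"
    using T by (simp add: leads_def plus_linop.rep_eq)
  moreover have "u = z + v \<or> w u < w (z + v)" if "apply_op (T + S) f u \<noteq> 0" for u
  proof (cases "apply_op S f u = 0")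
    case True
    then show ?thesis using that T by (simp add: leads_def plus_linop.rep_eq)
  qed (use S w in simp)
  ultimately show "leads w (apply_op (T + S) f) (z + v)"
    unfolding leads_def by blast
qed

lemma op_leads_sum:
  assumes "finite A" "a \<in> A" "op_leads w (T a) v"
    and "\<And>b. b \<in> A \<Longrightarrow> b \<noteq> a \<Longrightarrow> op_bound w (T b) (w v - 1)"
  shows "op_leads w (sum T A) v"
  unfolding sum.remove[OF assms(1,2)]
  by (rule op_leads_add[OF assms(3)]) (use assms(4) in \<open>auto intro!: op_bound_sum\<close>)

lemma op_leads_one: "op_leads w 1 0"
  using op_leads_scalar[of 1] by simp

lemma op_leads_prod_list:
  "(\<And>x. x \<in> set xs \<Longrightarrow> op_leads w (T x) (v x)) \<Longrightarrow>
     op_leads w (prod_list (map T xs)) (sum_list (rev (map v xs)))"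
  by (induction xs) (auto intro: op_leads_one op_leads_mult)

text \<open>Applied to the function concentrated at 0, each \<open>T a\<close> gives a function with
  leader \<open>v a\<close>. Among the terms with nonzero coefficient one of greatest weight
  survives at its own leader: another term of the same weight has a different leader and is strictly
  lighter elsewhere, so ties of weight are harmless.\<close>

lemma op_leads_independent:
  fixes T :: "'a \<Rightarrow> ('e, 'k::field) linop"
  assumes "finite A" "inj_on v A" and T: "\<And>a. a \<in> A \<Longrightarrow> op_leads w (T a) (v a)"
    and sum: "(\<Sum>a\<in>A. scalar_op (c a) * T a) = 0" and "a \<in> A"
  shows "c a = 0"
proof (rule ccontr)
  assume "c a \<noteq> 0"
  define B where "B = {b \<in> A. c b \<noteq> 0}"
  have B: "finite B" "B \<noteq> {}" using assms(1,5) \<open>c a \<noteq> 0\<close> by (auto simp: B_def)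
  then have "Max ((\<lambda>b. w (v b)) ` B) \<in> (\<lambda>b. w (v b)) ` B" by (intro Max_in) auto
  then obtain b where b: "b \<in> B" and "Max ((\<lambda>b. w (v b)) ` B) = w (v b)" by auto
  then have b_max: "w (v b') \<le> w (v b)" if "b' \<in> B" for b'
    using Max_ge[of "(\<lambda>b. w (v b)) ` B" "w (v b')"] B(1) that by simp
  define f :: "'e \<Rightarrow> 'k" where "f = (\<lambda>u. if u = 0 then 1 else 0)"
  have f: "leads w f 0" by (simp add: leads_def f_def)
  have l: "leads w (apply_op (T b') f) (v b')" if "b' \<in> A" for b'
  proof -
    have "leads w (apply_op (T b') f) (0 + v b')"
      using T[OF that] f unfolding op_leads_def by blast
    then show ?thesis by simp
  qed
  have ap: "apply_op (\<Sum>a\<in>C. scalar_op (c a) * T a) f u = (\<Sum>a\<in>C. c a * apply_op (T a) f u)" for C u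
    by (induction C rule: infinite_finite_induct)
      (simp_all add: zero_linop.rep_eq plus_linop.rep_eq times_linop.rep_eq scalar_op.rep_eq)
  have "0 = (\<Sum>a\<in>A. c a * apply_op (T a) f (v b))"
    unfolding ap[symmetric] sum by (simp add: zero_linop.rep_eq)
  also have "\<dots> = (\<Sum>a\<in>{b}. c a * apply_op (T a) f (v b))"
  proof (rule sum.mono_neutral_right[OF assms(1)])
    show "\<forall>i\<in>A - {b}. c i * apply_op (T i) f (v b) = 0"
    proof
      fix i assume i: "i \<in> A - {b}"
      show "c i * apply_op (T i) f (v b) = 0"
      proof (cases "i \<in> B")
        case True
        have "v i \<noteq> v b" using i b assms(2) by (auto simp: B_def inj_on_def)
        moreover have "\<not> w (v b) < w (v i)" using b_max[OF True] by simp
        ultimately show ?thesis using l[of i] i by (auto simp: leads_def)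
      qed (use i in \<open>auto simp: B_def\<close>)
    qed
  qed (use b in \<open>auto simp: B_def\<close>)
  finally have "c b * apply_op (T b) f (v b) = 0" by simp
  then show False using l[of b] b by (auto simp: B_def leads_def)
qed

end

section \<open>Products of bidiagonal quantum matrices\<close>

definition unit_vec :: "'a \<Rightarrow> 'a \<Rightarrow> nat" where
  "unit_vec I = (\<lambda>J. if J = I then 1 else 0)"

text \<open>Left multiplication by a variable of a skew polynomial ring, on coefficient functions.
  If monomials are written with later variables to the left, the new variable has to pass all copies
  of its successor in the same step, and each passage costs a factor \<open>q\<close>.\<close>

lift_definition var_op :: "'k::field \<Rightarrow> nat \<times> nat \<Rightarrow> (nat \<times> nat \<Rightarrow> nat, 'k) linop" is
  "\<lambda>q I f u. if u I = 0 then 0 else q ^ u (fst I, Suc (snd I)) * f (u(I := u I - 1))"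
  by (auto simp: algebra_simps)

lemma var_op_q_commute:
  "var_op q (t, c) * var_op q (t, Suc c) = scalar_op q * var_op q (t, Suc c) * var_op q (t, c)"
  by transfer (auto simp: fun_eq_iff fun_upd_twist gr0_conv_Suc)

lemma var_op_commute:
  assumes "J \<noteq> (fst I, Suc (snd I))" "I \<noteq> (fst J, Suc (snd J))"
  shows "var_op q I * var_op q J = var_op q J * var_op q I"
  using assms by transfer (auto simp: fun_eq_iff fun_upd_twist)

definition weight :: "(nat \<times> nat) set \<Rightarrow> (nat \<times> nat \<Rightarrow> int) \<Rightarrow> (nat \<times> nat \<Rightarrow> nat) \<Rightarrow> int" where
  "weight F \<omega> u = (\<Sum>I\<in>F. \<omega> I * int (u I))"

lemma weight_add: "weight F \<omega> (u + v) = weight F \<omega> u + weight F \<omega> v"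
  by (simp add: weight_def sum.distrib algebra_simps)

lemma weight_unit_vec:
  assumes "finite F" "I \<in> F"
  shows "weight F \<omega> (unit_vec I) = \<omega> I"
proof -
  have "weight F \<omega> (unit_vec I) = (\<Sum>J\<in>F. if J = I then \<omega> I else 0)"
    by (auto simp: weight_def unit_vec_def intro!: sum.cong)
  then show ?thesis using assms by simp
qed

lemma op_leads_var_op:
  assumes "q \<noteq> 0"
  shows "op_leads (weight F \<omega>) (var_op q I) (unit_vec I)"
proof -
  let ?w = "weight F \<omega>"
  have dec: "u(I := u I - 1) + unit_vec I = u" if "u I \<noteq> 0" for u :: "nat \<times> nat \<Rightarrow> nat"
    using that by (auto simp: unit_vec_def fun_eq_iff)
  have w_dec: "?w u = ?w (u(I := u I - 1)) + ?w (unit_vec I)" if "u I \<noteq> 0" for u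
    using weight_add[of F \<omega> "u(I := u I - 1)" "unit_vec I"] dec[of u] that by simp
  have inc: "(z + unit_vec I)(I := (z + unit_vec I) I - 1) = z" for z
    by (auto simp: unit_vec_def fun_eq_iff)
  show ?thesis
    unfolding op_leads_def op_bound_def leads_def
  proof (intro conjI allI impI)
    fix f :: "(nat \<times> nat \<Rightarrow> nat) \<Rightarrow> 'a" and b u
    assume f: "\<forall>u. f u \<noteq> 0 \<longrightarrow> ?w u \<le> b" and "apply_op (var_op q I) f u \<noteq> 0"
    then have u: "u I \<noteq> 0" "f (u(I := u I - 1)) \<noteq> 0"
      by (auto simp: var_op.rep_eq split: if_splits)
    then show "?w u \<le> b + ?w (unit_vec I)" using w_dec[of u] f by fastforce
  next
    fix f :: "(nat \<times> nat \<Rightarrow> nat) \<Rightarrow> 'a" and z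
    assume f: "f z \<noteq> 0 \<and> (\<forall>u. f u \<noteq> 0 \<longrightarrow> u = z \<or> ?w u < ?w z)"
    have "(z + unit_vec I) I \<noteq> 0" by (simp add: unit_vec_def)
    then show "apply_op (var_op q I) f (z + unit_vec I) \<noteq> 0"
      using f assms unfolding var_op.rep_eq inc by simp
    fix u assume "apply_op (var_op q I) f u \<noteq> 0"
    then have u: "u I \<noteq> 0" "f (u(I := u I - 1)) \<noteq> 0"
      by (auto simp: var_op.rep_eq split: if_splits)
    with f have "u(I := u I - 1) = z \<or> ?w (u(I := u I - 1)) < ?w z" by blast
    then show "u = z + unit_vec I \<or> ?w u < ?w (z + unit_vec I)"
      using dec[of u] w_dec[of u] u(1) by (auto simp: weight_add)
  qed
qed

text \<open>The entry from row \<open>i\<close> to column \<open>j\<close> of step \<open>t\<close> is the variable \<open>(t, i + j)\<close>. This lists the nonzero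
  entries along the bidiagonal staircase, so that exactly the consecutive ones \<open>q\<close>-commute.\<close>

definition lower_step :: "'k::field \<Rightarrow> nat \<Rightarrow> nat \<Rightarrow> nat \<Rightarrow> (nat \<times> nat \<Rightarrow> nat, 'k) linop" where
  "lower_step q t i j = (if i = j \<or> i = Suc j then var_op q (t, i + j) else 0)"

definition upper_step :: "'k::field \<Rightarrow> nat \<Rightarrow> nat \<Rightarrow> nat \<Rightarrow> (nat \<times> nat \<Rightarrow> nat, 'k) linop" where
  "upper_step q t i j = (if j = i \<or> j = Suc i then var_op q (t, i + j) else 0)"

text \<open>For \<open>i < k\<close> and \<open>j < l\<close> the entries \<open>(i, l)\<close> and
  \<open>(k, j)\<close> are never both nonzero, so the correction term vanishes whatever
  \<open>Q'\<close> is. The indices of \<open>(i, j)\<close> and \<open>(k, l)\<close> differ by at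
  least 2, so these entries commute; two nonzero entries in one row or column are consecutive
  variables.\<close>

lemma quantum_matrix_lower_step:
  "quantum_matrix (scalar_op q) Q' m n (lower_step q t)"
  unfolding quantum_matrix_def lower_step_def
  by (auto intro!: var_op_commute simp: var_op_q_commute mult.assoc[symmetric])

lemma quantum_matrix_upper_step:
  "quantum_matrix (scalar_op q) Q' m n (upper_step q t)"
  unfolding quantum_matrix_def upper_step_def
  by (auto intro!: var_op_commute simp: var_op_q_commute mult.assoc[symmetric])

section \<open>The network and its band factor\<close>

definition id_matrix :: "nat \<Rightarrow> nat \<Rightarrow> 'r::ring_1" where
  "id_matrix i j = (if i = j then 1 else 0)"

lemma quantum_matrix_id: "quantum_matrix Q Q' m n id_matrix"
  unfolding quantum_matrix_def id_matrix_def by auto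

definition net_width :: "nat \<Rightarrow> nat \<Rightarrow> nat" where
  "net_width m t = max m (t - m)"

text \<open>The first \<open>m\<close> steps are square lower, the next \<open>m\<close> square upper bidiagonal; after that every upper
  step adds a column.\<close>

primrec net :: "'k::field \<Rightarrow> nat \<Rightarrow> nat \<Rightarrow> nat \<Rightarrow> nat \<Rightarrow> (nat \<times> nat \<Rightarrow> nat, 'k) linop" where
  "net q m 0 = id_matrix"
| "net q m (Suc t) = matrix_prod (net_width m t) (net q m t)
     (if t < m then lower_step q t else upper_step q t)"

primrec band :: "'k::field \<Rightarrow> nat \<Rightarrow> nat \<Rightarrow> nat \<Rightarrow> nat \<Rightarrow> (nat \<times> nat \<Rightarrow> nat, 'k) linop" where
  "band q m 0 = id_matrix"
| "band q m (Suc r) = matrix_prod (m + r) (band q m r) (upper_step q (2 * m + r))"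

lemma matrix_prod_commute:
  assumes "\<And>k. T * X i k = X i k * T" "\<And>k. T * Y k j = Y k j * T"
  shows "T * matrix_prod r X Y i j = matrix_prod r X Y i j * T"
  unfolding matrix_prod_def sum_distrib_left sum_distrib_right
  by (intro sum.cong refl) (metis assms mult.assoc)

lemma step_commute:
  assumes "\<And>c. T * var_op q (t, c) = var_op q (t, c) * T"
  shows "T * lower_step q t i j = lower_step q t i j * T"
    and "T * upper_step q t i j = upper_step q t i j * T"
  using assms by (auto simp: lower_step_def upper_step_def)

text \<open>The first \<open>t\<close> steps only involve variables with first index below
  \<open>t\<close>, and variables with different first indices commute.\<close>

lemma net_var_op_commute: "t \<le> t' \<Longrightarrow> var_op q (t', c) * net q m t i j = net q m t i j * var_op q (t', c)"
proof (induction t arbitrary: i j)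
  case 0
  then show ?case by (simp add: id_matrix_def)
next
  case (Suc t)
  have "var_op q (t', c) * var_op q (t, c') = var_op q (t, c') * var_op q (t', c)" for c'
    by (rule var_op_commute) (use Suc.prems in auto)
  then show ?case
    using Suc by (auto intro!: matrix_prod_commute step_commute)
qed

lemma net_step_commute:
  assumes "t \<le> t'"
  shows "net q m t i j * lower_step q t' k l = lower_step q t' k l * net q m t i j"
    and "net q m t i j * upper_step q t' k l = upper_step q t' k l * net q m t i j"
  by (rule step_commute; simp add: net_var_op_commute[OF assms])+

lemma net_band_commute: "net q m (2 * m) i j * band q m r k l = band q m r k l * net q m (2 * m) i j"
proof (induction r arbitrary: k l)
  case 0
  then show ?case by (simp add: id_matrix_def)
next
  case (Suc r)
  then show ?case
    by (simp only: band.simps) (intro matrix_prod_commute net_step_commute; simp)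
qed

lemma scalar_op_inverse:
  assumes "q \<noteq> 0"
  shows "scalar_op q * scalar_op (inverse q) = 1"
  using assms by (simp add: scalar_op_mult[symmetric])

lemma quantum_matrix_net:
  assumes "q \<noteq> 0"
  shows "quantum_matrix (scalar_op q) (scalar_op (inverse q)) m (net_width m t) (net q m t)"
proof (induction t)
  case 0
  then show ?case by (simp add: quantum_matrix_id)
next
  case (Suc t)
  show ?case
    unfolding net.simps
    by (rule quantum_matrix_prod[OF Suc _ _ scalar_op_central[symmetric] scalar_op_central[symmetric]
          scalar_op_inverse[OF assms]])
      (simp_all add: quantum_matrix_lower_step quantum_matrix_upper_step net_step_commute)
qed

lemma band_var_op_commute: "2 * m + r \<le> t' \<Longrightarrow> var_op q (t', c) * band q m r i j = band q m r i j * var_op q (t', c)"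
proof (induction r arbitrary: i j)
  case 0
  then show ?case by (simp add: id_matrix_def)
next
  case (Suc r)
  have "var_op q (t', c) * var_op q (2 * m + r, c') = var_op q (2 * m + r, c') * var_op q (t', c)" for c'
    by (rule var_op_commute) (use Suc.prems in auto)
  then show ?case
    using Suc by (auto intro!: matrix_prod_commute step_commute)
qed

lemma quantum_matrix_band:
  assumes "q \<noteq> 0"
  shows "quantum_matrix (scalar_op q) (scalar_op (inverse q)) m (m + r) (band q m r)"
proof (induction r)
  case 0
  then show ?case by (simp add: quantum_matrix_id)
next
  case (Suc r)
  have "band q m r i k * upper_step q (2 * m + r) k' l = upper_step q (2 * m + r) k' l * band q m r i k" for i k k' l
    by (rule step_commute) (simp add: band_var_op_commute)
  then show ?case
    unfolding band.simps add_Suc_right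
    by (intro quantum_matrix_prod[OF Suc _ _ scalar_op_central[symmetric] scalar_op_central[symmetric]
          scalar_op_inverse[OF assms]] quantum_matrix_upper_step)
qed

lemma band_eq_0: "\<not> (i \<le> j \<and> j \<le> i + r) \<Longrightarrow> band q m r i j = 0"
proof (induction r arbitrary: j)
  case 0
  then show ?case by (auto simp: id_matrix_def)
next
  case (Suc r)
  have "band q m r i k * upper_step q (2 * m + r) k j = 0" for k
    using Suc.IH[of k] Suc.prems by (cases "i \<le> k \<and> k \<le> i + r") (auto simp: upper_step_def)
  then show ?case by (simp add: matrix_prod_def)
qed

text \<open>Associativity of the matrix product. From step \<open>2 * m\<close> on, the width
  \<open>net_width m (2 * m + r)\<close> equals \<open>m + r\<close>, so the summation ranges of the
  net and of the band agree.\<close>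

lemma net_eq_net_band:
  assumes "1 \<le> j" "j \<le> m + r"
  shows "net q m (2 * m + r) i j = matrix_prod m (net q m (2 * m)) (band q m r) i j"
  using assms
proof (induction r arbitrary: j)
  case 0
  then show ?case by (simp add: matrix_prod_def id_matrix_def if_distrib[of "\<lambda>x. _ * x"] cong: if_cong)
next
  case (Suc r)
  have "net q m (2 * m + Suc r) i j
      = (\<Sum>k=1..m+r. net q m (2 * m + r) i k * upper_step q (2 * m + r) k j)"
    by (simp add: matrix_prod_def net_width_def)
  also have "\<dots> = (\<Sum>k=1..m+r. \<Sum>l=1..m. net q m (2 * m) i l * (band q m r l k * upper_step q (2 * m + r) k j))"
    by (intro sum.cong refl) (simp add: Suc.IH matrix_prod_def sum_distrib_right mult.assoc)
  also have "\<dots> = matrix_prod m (net q m (2 * m)) (band q m (Suc r)) i j"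
    by (subst sum.swap) (simp add: matrix_prod_def sum_distrib_left)
  finally show ?case .
qed

section \<open>Leading paths\<close>

text \<open>Position, after \<open>\<tau>\<close> of \<open>t\<close> steps, of the leading path from row \<open>i\<close> to column \<open>j\<close>:
  it descends as early as possible and ascends as late as possible.\<close>

definition path_pos :: "nat \<Rightarrow> nat \<Rightarrow> nat \<Rightarrow> nat \<Rightarrow> nat \<Rightarrow> nat" where
  "path_pos m t i j \<tau> = (if \<tau> \<le> m then max (i - \<tau>) (min i j) else max (min i j) (j - (t - \<tau>)))"

definition path_vec :: "nat \<Rightarrow> nat \<Rightarrow> nat \<Rightarrow> nat \<Rightarrow> nat \<times> nat \<Rightarrow> nat" where
  "path_vec m t i j = (\<lambda>(\<tau>, c). if \<tau> < t \<and> c = path_pos m t i j \<tau> + path_pos m t i j (Suc \<tau>) then 1 else 0)"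

text \<open>Later ascents gain more and earlier descents cost less, and a descent costs more than any
  ascent gains. The total weight of the leading path is then a strictly concave function of \<open>j - i\<close>.\<close>

definition step_weight :: "nat \<Rightarrow> nat \<Rightarrow> nat \<times> nat \<Rightarrow> int" where
  "step_weight m n = (\<lambda>(t, c). if even c then 0 else if t < m then - 2 * (int n + int t + 1)
      else 2 * (int t - int m + 1))"

definition net_weight :: "nat \<Rightarrow> nat \<Rightarrow> (nat \<times> nat \<Rightarrow> nat) \<Rightarrow> int" where
  "net_weight m n = weight ({..<m+n} \<times> {..2*n}) (step_weight m n)"

text \<open>The last \<open>e\<close> ascents gain \<open>2 * (t - m)\<close>,
  \<open>2 * (t - m - 1)\<close> and so on; the first \<open>- e\<close> descents cost
  \<open>2 * (n + 1)\<close>, \<open>2 * (n + 2)\<close> and so on. At \<open>t = m + n\<close> both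
  branches become \<open>2 * n * e - e * (e - 1)\<close>, one concave function across
  \<open>e = 0\<close>; this is why the cost of descents starts just above
  \<open>2 * n\<close>.\<close>

definition path_weight :: "nat \<Rightarrow> nat \<Rightarrow> nat \<Rightarrow> nat \<Rightarrow> nat \<Rightarrow> int" where
  "path_weight m n t i j = 
     (let e = int j - int i in 2 * (if e \<ge> 0 then int t - int m else int n) * e - e * (e - 1))"

text \<open>Beyond step \<open>m\<close> there is no lower bound on \<open>j\<close>, since the
  lower steps suffice to descend from any row up to \<open>m\<close> to any smaller
  position.\<close>

definition reachable :: "nat \<Rightarrow> nat \<Rightarrow> nat \<Rightarrow> nat \<Rightarrow> bool" where
  "reachable m t i j \<longleftrightarrow> (if t \<le> m then j \<le> i \<and> i \<le> j + t else j \<le> i + (t - m))"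

lemma path_vec_Suc:
  assumes "path_pos m (Suc t) i j (Suc t) = j" "path_pos m (Suc t) i j t = k"
    and "\<And>\<tau>. \<tau> \<le> t \<Longrightarrow> path_pos m (Suc t) i j \<tau> = path_pos m t i k \<tau>"
  shows "path_vec m (Suc t) i j = unit_vec (t, k + j) + path_vec m t i k"
  using assms by (auto simp: path_vec_def unit_vec_def fun_eq_iff less_Suc_eq)

lemma net_leads:
  assumes q: "q \<noteq> 0" and mn: "m \<le> n" and "t \<le> m + n" "1 \<le> i" "i \<le> m" "1 \<le> j" "j \<le> net_width m t"
  shows "(reachable m t i j \<longrightarrow> op_leads (net_weight m n) (net q m t i j) (path_vec m t i j)
            \<and> net_weight m n (path_vec m t i j) = path_weight m n t i j)
       \<and> (\<not> reachable m t i j \<longrightarrow> net q m t i j = 0)"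
  using assms(3-)
proof (induction t arbitrary: j)
  case 0
  have "path_vec m 0 i j = 0" by (auto simp: path_vec_def)
  moreover have "net_weight m n 0 = 0" by (simp add: net_weight_def weight_def)
  moreover have "reachable m 0 i j \<longleftrightarrow> i = j" by (auto simp: reachable_def)
  ultimately show ?case
    using op_leads_one[of "net_weight m n"]
    by (auto simp: id_matrix_def path_weight_def net_weight_def weight_add)
next
  case (Suc t)
  define r where "r = net_width m t"
  define S where "S = (if t < m then lower_step q t else upper_step q t)"
  have net: "net q m (Suc t) i j = (\<Sum>k=1..r. net q m t i k * S k j)"
    by (simp add: matrix_prod_def S_def r_def)
  have IH: "reachable m t i k \<Longrightarrow> op_leads (net_weight m n) (net q m t i k) (path_vec m t i k)"
    "reachable m t i k \<Longrightarrow> net_weight m n (path_vec m t i k) = path_weight m n t i k"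
    "\<not> reachable m t i k \<Longrightarrow> net q m t i k = 0" if "1 \<le> k" "k \<le> r" for k
    using Suc.IH[of k] Suc.prems that by (auto simp: r_def)
  have r: "r \<le> n" using Suc.prems mn by (auto simp: r_def net_width_def)
  have j: "j \<le> Suc r" "j \<le> n" using Suc.prems mn by (auto simp: r_def net_width_def)
  have S_leads: "op_leads (net_weight m n) (var_op q (t, k + j)) (unit_vec (t, k + j))"
    "net_weight m n (unit_vec (t, k + j)) = step_weight m n (t, k + j)"
    if "1 \<le> k" "k \<le> r" for k
    using op_leads_var_op[OF q] that r j Suc.prems weight_unit_vec[of "{..<m+n} \<times> {..2*n}" "(t, k+j)"]
    by (auto simp: net_weight_def)
  have prod_bound: "op_bound (net_weight m n) (net q m t i k * S k j) (path_weight m n t i k + step_weight m n (t, k + j))"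
    if "1 \<le> k" "k \<le> r" for k
  proof (cases "reachable m t i k \<and> S k j \<noteq> 0")
    case True
    then have "S k j = var_op q (t, k + j)" by (auto simp: S_def lower_step_def upper_step_def split: if_splits)
    with True IH[OF that] S_leads[OF that] show ?thesis 
      by (metis op_bound_mult op_leads_bound)
  next
    case False
    then have "net q m t i k * S k j = 0" using IH(3)[OF that] by auto
    then show ?thesis by (simp add: op_bound_0)
  qed
  show ?case
  proof (intro conjI impI)
    assume nr: "\<not> reachable m (Suc t) i j"
    have "net q m t i k * S k j = 0" if "1 \<le> k" "k \<le> r" for k
    proof (cases "reachable m t i k")
      case True
      with nr have "S k j = 0"
        by (auto simp: reachable_def S_def lower_step_def upper_step_def split: if_splits)
      then show ?thesis by simp
    qed (use IH(3)[OF that] in simp)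
    then show "net q m (Suc t) i j = 0" unfolding net by (intro sum.neutral) auto
  next
    assume reach: "reachable m (Suc t) i j"
    \<comment> \<open>\<open>k\<close> is the position before the last step of the leading path.
      Among the lower steps the last one is a descent only if all steps so far were; among the upper
      steps it is an ascent whenever \<open>i < j\<close>.\<close>
    define k where "k = (if t < m then (if i \<le> j + t then j else Suc j) else (if j \<le> i then j else j - 1))"
    have k: "1 \<le> k" "k \<le> r" "reachable m t i k" 
      using Suc.prems reach by (auto simp: k_def reachable_def r_def net_width_def split: if_splits)
    have Sk: "S k j = var_op q (t, k + j)"
      using Suc.prems by (auto simp: S_def lower_step_def upper_step_def k_def)
    have vec: "path_vec m (Suc t) i j = unit_vec (t, k + j) + path_vec m t i k"
    proof (rule path_vec_Suc)
      show "path_pos m (Suc t) i j (Suc t) = j" "path_pos m (Suc t) i j t = k"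
        using Suc.prems reach by (auto simp: path_pos_def k_def reachable_def max_def min_def split: if_splits)
      show "path_pos m (Suc t) i j \<tau> = path_pos m t i k \<tau>" if "\<tau> \<le> t" for \<tau>
        using Suc.prems reach that by (auto simp: path_pos_def k_def reachable_def max_def min_def split: if_splits)
    qed
    have wt: "path_weight m n t i k + step_weight m n (t, k + j) = path_weight m n (Suc t) i j"
    proof (cases "k = j")
      case True
      \<comment> \<open>For \<open>j \<le> i\<close> the path weight does not depend on
        \<open>t\<close>, in agreement with the weight 0 of a level step.\<close>
      then have "j \<le> i" using Suc.prems reach by (auto simp: k_def reachable_def split: if_splits)
      with True show ?thesis by (auto simp: path_weight_def step_weight_def Let_def)
    next
      case False
      show ?thesis
      proof (cases "t < m")
        case True
        then have "k = Suc j" "i = Suc (j + t)" using False reach by (auto simp: k_def reachable_def split: if_splits)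
        with True show ?thesis by (simp add: path_weight_def step_weight_def Let_def algebra_simps)
      next
        case f: False
        then have "i < j" and k: "k = j - 1" using False by (auto simp: k_def split: if_splits)
        then obtain e where "j = Suc (i + e)" using less_imp_Suc_add by blast
        with f k show ?thesis by (simp add: path_weight_def step_weight_def Let_def algebra_simps)
      qed
    qed
    then have wv: "net_weight m n (path_vec m (Suc t) i j) = path_weight m n (Suc t) i j"
      unfolding vec using IH(2)[OF k] S_leads(2)[OF k(1,2)] by (simp add: net_weight_def weight_add)
    moreover have "op_leads (net_weight m n) (net q m (Suc t) i j) (path_vec m (Suc t) i j)"
      unfolding net
    proof (rule op_leads_sum[where a = k])
      show w: "net_weight m n (u + v) = net_weight m n u + net_weight m n v" for u v
        by (simp add: net_weight_def weight_add)
      show "op_leads (net_weight m n) (net q m t i k * S k j) (path_vec m (Suc t) i j)"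
        unfolding vec Sk by (rule op_leads_mult[OF w IH(1)[OF k] S_leads(1)[OF k(1,2)]])
      fix b assume b: "b \<in> {1..r}" "b \<noteq> k"
      show "op_bound (net_weight m n) (net q m t i b * S b j) (net_weight m n (path_vec m (Suc t) i j) - 1)"
      proof (cases "reachable m t i b \<and> S b j \<noteq> 0")
        case True
        have "path_weight m n t i b + step_weight m n (t, b + j) < path_weight m n (Suc t) i j"
        proof (cases "t < m")
          case t: True
          with True b have "b = Suc j" "i \<le> j + t" "j < i"
            by (auto simp: k_def reachable_def S_def lower_step_def split: if_splits)
          with t show ?thesis 
            by (auto simp: path_weight_def step_weight_def Let_def algebra_simps dest!: less_imp_Suc_add)
        next
          case t: False
          with True b consider "b = j" "i < j" | "j = Suc b" "j \<le> i"
            by (auto simp: k_def S_def upper_step_def split: if_splits)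
          then show ?thesis
          proof cases
            case 1
            then show ?thesis using t
              by (auto simp: path_weight_def step_weight_def Let_def algebra_simps dest!: less_imp_Suc_add)
          next
            case 2
            then show ?thesis using t Suc.prems
              by (cases "i = Suc b") (auto simp: path_weight_def step_weight_def Let_def algebra_simps)
          qed
        qed
        with prod_bound[of b] b show ?thesis unfolding wv by (auto intro: op_bound_mono)
      next
        case False
        then have "net q m t i b * S b j = 0" using IH(3)[of b] b by auto
        then show ?thesis by (simp add: op_bound_0)
      qed
    qed (use k in auto)
    ultimately show "op_leads (net_weight m n) (net q m (Suc t) i j) (path_vec m (Suc t) i j)"
      and "net_weight m n (path_vec m (Suc t) i j) = path_weight m n (Suc t) i j" by auto
  qed
qed

text \<open>Two consecutive positions of a path with floor \<open>b\<close> are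
  \<open>max a b\<close> and \<open>max (a - 1) b\<close>. Their sum names the variable in use: an
  odd sum is a move between \<open>Suc l\<close> and \<open>l\<close>, an even one means that the
  path rests on the floor.\<close>

lemma max_pred_add_max:
  fixes a b l :: nat
  shows "2 * l + 1 = max a b + max (a - 1) b \<longleftrightarrow> a = Suc l \<and> b \<le> l"
    and "2 * l = max a b + max (a - 1) b \<longleftrightarrow> a \<le> b \<and> b = l"
proof -
  consider "a \<le> b" | "b < a" by linarith
  then have "(2 * l + 1 = max a b + max (a - 1) b \<longleftrightarrow> a = Suc l \<and> b \<le> l) \<and>
      (2 * l = max a b + max (a - 1) b \<longleftrightarrow> a \<le> b \<and> b = l)"
  proof cases
    case 1
    then have "max a b = b" "max (a - 1) b = b" by auto
    with 1 show ?thesis by simp presburger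
  next
    case 2
    then have "max a b = a" "max (a - 1) b = a - 1" by auto
    with 2 show ?thesis by simp presburger
  qed
  then show "2 * l + 1 = max a b + max (a - 1) b \<longleftrightarrow> a = Suc l \<and> b \<le> l"
    and "2 * l = max a b + max (a - 1) b \<longleftrightarrow> a \<le> b \<and> b = l" by blast+
qed

text \<open>Descents start at once, so the time of a move from \<open>Suc l\<close> to
  \<open>l\<close> reveals the starting row, and the move takes place exactly if the path ends at
  \<open>l\<close> or below.\<close>

lemma path_vec_down:
  assumes "1 \<le> l" "l < i" "i \<le> m" "1 \<le> i'" "i' \<le> m" "1 \<le> j'" "j' \<le> n"
  shows "path_vec m (m + n) i' j' (i - l - 1, 2 * l + 1) = (if i' = i \<and> j' \<le> l then 1 else 0)"
proof -
  define x where "x = i - l - 1"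
  have x: "x \<le> m" "Suc x \<le> m" "x < m + n" using assms by (auto simp: x_def)
  have "i' - x = Suc l \<longleftrightarrow> i' = i" using assms by (auto simp: x_def)
  moreover have "min i j' \<le> l \<longleftrightarrow> j' \<le> l" using assms by auto
  ultimately have "2 * l + 1 = max (i' - x) (min i' j') + max (i' - Suc x) (min i' j') \<longleftrightarrow> i' = i \<and> j' \<le> l"
    using max_pred_add_max(1)[of l "i' - x" "min i' j'"] by auto
  with x show ?thesis unfolding x_def[symmetric] path_vec_def path_pos_def by simp
qed

text \<open>Ascents are postponed to the very end, so the time of a move from \<open>l\<close> to
  \<open>Suc l\<close> reveals the final column, and the move takes place exactly if the path starts
  at \<open>l\<close> or below.\<close>

lemma path_vec_up:
  assumes "1 \<le> l" "l < j" "j \<le> n" "1 \<le> i'" "i' \<le> m" "1 \<le> j'" "j' \<le> n"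
  shows "path_vec m (m + n) i' j' (m + n - j + l, 2 * l + 1) = (if j' = j \<and> i' \<le> l then 1 else 0)"
proof -
  define x where "x = m + n - j + l"
  have x: "\<not> x \<le> m" "\<not> Suc x \<le> m" "x < m + n" "m + n - x = j - l" "m + n - Suc x = j - l - 1"
    using assms by (auto simp: x_def)
  have "j' - (j - l - 1) = Suc l \<longleftrightarrow> j' = j" using assms by auto
  moreover have "min i' j \<le> l \<longleftrightarrow> i' \<le> l" using assms by auto
  moreover have "j' - (j - l) = j' - (j - l - 1) - 1" using assms by auto
  ultimately have "2 * l + 1 = max (min i' j') (j' - (j - l)) + max (min i' j') (j' - (j - l - 1)) \<longleftrightarrow> j' = j \<and> i' \<le> l"
    using max_pred_add_max(1)[of l "j' - (j - l - 1)" "min i' j'"] by (auto simp: max.commute add.commute)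
  with x show ?thesis unfolding x_def[symmetric] path_vec_def path_pos_def by simp
qed

lemma path_vec_start:
  assumes "1 \<le> i" "i \<le> m" "1 \<le> i'" "i' \<le> m" "1 \<le> j'" "j' \<le> n"
  shows "path_vec m (m + n) i' j' (0, 2 * i) = (if i' = i \<and> i \<le> j' then 1 else 0)"
proof -
  have "2 * i = max i' (min i' j') + max (i' - 1) (min i' j') \<longleftrightarrow> i' = i \<and> i \<le> j'"
    using max_pred_add_max(2)[of i i' "min i' j'"] by auto
  then show ?thesis using assms unfolding path_vec_def path_pos_def by simp
qed

text \<open>The descent coordinates give partial sums of \<open>d\<close> along a row, whose
  differences are the entries below the diagonal. The ascent coordinates do the same along columns
  for the entries above it. The level coordinates of step 0 then isolate the diagonal
  entries.\<close>

lemma path_vec_independent: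
  fixes d :: "nat \<Rightarrow> nat \<Rightarrow> int"
  assumes d: "\<And>I. (\<Sum>i=1..m. \<Sum>j=1..n. d i j * int (path_vec m (m + n) i j I)) = 0"
    and ij: "1 \<le> i" "i \<le> m" "1 \<le> j" "j \<le> n" and mn: "m \<le> n"
  shows "d i j = 0"
proof -
  have down: "(\<Sum>j=1..l. d i j) = 0" if "1 \<le> l" "l < i" "i \<le> m" for i l
  proof -
    have "0 = (\<Sum>i'=1..m. \<Sum>j'=1..n. d i' j' * int (path_vec m (m + n) i' j' (i - l - 1, 2 * l + 1)))"
      using d by simp
    also have "\<dots> = (\<Sum>i'=1..m. \<Sum>j'=1..n. if i' = i then if j' \<le> l then d i' j' else 0 else 0)"
      by (intro sum.cong refl) (subst path_vec_down, use that in auto)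
    also have "\<dots> = (\<Sum>i'=1..m. if i' = i then \<Sum>j'=1..n. if j' \<le> l then d i j' else 0 else 0)"
      by (intro sum.cong refl) auto
    also have "\<dots> = (\<Sum>j'=1..n. if j' \<le> l then d i j' else 0)" using that by simp
    also have "\<dots> = (\<Sum>j'=1..l. d i j')"
      using that mn by (intro sum.mono_neutral_cong_right) auto
    finally show ?thesis by simp
  qed
  have up: "(\<Sum>i | i \<in> {1..m} \<and> i \<le> l. d i j) = 0" if "1 \<le> l" "l < j" "j \<le> n" for j l
  proof -
    have "0 = (\<Sum>i'=1..m. \<Sum>j'=1..n. d i' j' * int (path_vec m (m + n) i' j' (m + n - j + l, 2 * l + 1)))"
      using d by simp
    also have "\<dots> = (\<Sum>i'=1..m. \<Sum>j'=1..n. if j' = j then if i' \<le> l then d i' j' else 0 else 0)"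
      by (intro sum.cong refl) (subst path_vec_up, use that in auto)
    also have "\<dots> = (\<Sum>i'=1..m. if i' \<le> l then d i' j else 0)"
      using that by (intro sum.cong refl) simp
    also have "\<dots> = (\<Sum>i | i \<in> {1..m} \<and> i \<le> l. d i j)"
      by (intro sum.mono_neutral_cong_right) auto
    finally show ?thesis by simp
  qed
  have start: "(\<Sum>j=i..n. d i j) = 0" if "1 \<le> i" "i \<le> m" for i
  proof -
    have "0 = (\<Sum>i'=1..m. \<Sum>j'=1..n. d i' j' * int (path_vec m (m + n) i' j' (0, 2 * i)))"
      using d by simp
    also have "\<dots> = (\<Sum>i'=1..m. \<Sum>j'=1..n. if i' = i then if i \<le> j' then d i' j' else 0 else 0)"
      by (intro sum.cong refl) (subst path_vec_start, use that in auto)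
    also have "\<dots> = (\<Sum>i'=1..m. if i' = i then \<Sum>j'=1..n. if i \<le> j' then d i j' else 0 else 0)"
      by (intro sum.cong refl) auto
    also have "\<dots> = (\<Sum>j'=1..n. if i \<le> j' then d i j' else 0)" using that by simp
    also have "\<dots> = (\<Sum>j'=i..n. d i j')"
      using that by (intro sum.mono_neutral_cong_right) auto
    finally show ?thesis by simp
  qed
  have lower: "d i j = 0" if "1 \<le> j" "j < i" "i \<le> m" for i j
  proof (cases "j = 1")
    case False
    with that obtain l where l: "j = Suc l" "1 \<le> l" by (cases j) auto
    then show ?thesis using down[of l i] down[of j i] that by simp
  qed (use down[of 1 i] that in simp)
  have upper: "d i j = 0" if "1 \<le> i" "i < j" "i \<le> m" "j \<le> n" for i j
  proof (cases "i = 1")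
    case True
    have "{i \<in> {1..m}. i \<le> 1} = {1}" using that by auto
    then show ?thesis using up[of 1 j] True that by simp
  next
    case False
    with that obtain l where l: "i = Suc l" "1 \<le> l" by (cases i) auto
    have "{i' \<in> {1..m}. i' \<le> i} = insert i {i' \<in> {1..m}. i' \<le> l}" using l that by auto
    then show ?thesis using up[of l j] up[of i j] that l by simp
  qed
  have "d i i = 0" if "1 \<le> i" "i \<le> m" for i
  proof -
    have "(\<Sum>j=i..n. d i j) = d i i + (\<Sum>j=Suc i..n. d i j)"
      using that mn by (intro sum.atLeast_Suc_atMost) simp
    also have "(\<Sum>j=Suc i..n. d i j) = 0" using upper that by (intro sum.neutral) auto
    finally show ?thesis using start[OF that] by simp
  qed
  with lower upper ij show ?thesis by (metis linorder_neqE_nat)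
qed

section \<open>Evaluation and straightening in the free algebra\<close>

lemma poly_mapping_eq_sum_single:
  "p = (\<Sum>w\<in>Poly_Mapping.keys p. Poly_Mapping.single w (Poly_Mapping.lookup p w))"
proof (rule poly_mapping_eqI)
  fix v
  have "(\<Sum>w\<in>Poly_Mapping.keys p. Poly_Mapping.lookup p w when w = v) = Poly_Mapping.lookup p v"
    by (simp add: when_def in_keys_iff)
  then show "Poly_Mapping.lookup p v =
      Poly_Mapping.lookup (\<Sum>w\<in>Poly_Mapping.keys p. Poly_Mapping.single w (Poly_Mapping.lookup p w)) v"
    by (simp add: lookup_sum lookup_single)
qed

definition eval_word :: "('a \<Rightarrow> 'r::monoid_mult) \<Rightarrow> 'a fword \<Rightarrow> 'r" where
  "eval_word X w = prod_list (map X (letters w))"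

lemma eval_word_plus: "eval_word X (v + w) = eval_word X v * eval_word X w"
  by (simp add: eval_word_def plus_fword_def)

definition fa_eval :: "('a \<Rightarrow> ('i, 'k::field) linop) \<Rightarrow> ('a fword \<Rightarrow>\<^sub>0 'k) \<Rightarrow> ('i, 'k) linop" where
  "fa_eval X p = (\<Sum>w\<in>Poly_Mapping.keys p. scalar_op (Poly_Mapping.lookup p w) * eval_word X w)"

lemma fa_eval_superset:
  assumes "finite A" "Poly_Mapping.keys p \<subseteq> A"
  shows "fa_eval X p = (\<Sum>w\<in>A. scalar_op (Poly_Mapping.lookup p w) * eval_word X w)"
  unfolding fa_eval_def using assms
  by (intro sum.mono_neutral_left) (auto simp: in_keys_iff)

lemma fa_eval_add: "fa_eval X (p + r) = fa_eval X p + fa_eval X r"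
proof -
  let ?A = "Poly_Mapping.keys p \<union> Poly_Mapping.keys r"
  have A: "finite ?A" by simp
  show ?thesis
    using keys_add[of p r] fa_eval_superset[OF A, of p X] fa_eval_superset[OF A, of r X]
      fa_eval_superset[OF A, of "p + r" X]
    by (simp add: lookup_add scalar_op_add distrib_right sum.distrib)
qed

lemma fa_eval_0 [simp]: "fa_eval X 0 = 0"
  by (simp add: fa_eval_def)

lemma fa_eval_uminus: "fa_eval X (- p) = - fa_eval X p"
  using fa_eval_add[of X p "- p"] by (simp add: eq_neg_iff_add_eq_0 add.commute)

lemma fa_eval_diff: "fa_eval X (p - r) = fa_eval X p - fa_eval X r"
  using fa_eval_add[of X p "- r"] by (simp add: fa_eval_uminus)

lemma fa_eval_sum: "fa_eval X (sum f A) = (\<Sum>a\<in>A. fa_eval X (f a))"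
  by (induction A rule: infinite_finite_induct) (simp_all add: fa_eval_add)

lemma fa_eval_single: "fa_eval X (Poly_Mapping.single w c) = scalar_op c * eval_word X w"
  by (cases "c = 0") (simp_all add: fa_eval_def)

lemma scalar_op_mult_mult: "(scalar_op a * S) * (scalar_op b * T) = scalar_op (a * b) * (S * T)"
  unfolding scalar_op_mult by (metis mult.assoc scalar_op_central)

lemma fa_eval_mult: "fa_eval X (p * r) = fa_eval X p * fa_eval X r"
proof -
  let ?s = "\<lambda>p w. Poly_Mapping.single w (Poly_Mapping.lookup p w)"
  have "p * r = (\<Sum>v\<in>Poly_Mapping.keys p. \<Sum>w\<in>Poly_Mapping.keys r. ?s p v * ?s r w)"
    unfolding sum_product[symmetric] by (simp only: poly_mapping_eq_sum_single[symmetric])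
  moreover have "fa_eval X (?s p v * ?s r w) = (scalar_op (Poly_Mapping.lookup p v) * eval_word X v)
      * (scalar_op (Poly_Mapping.lookup r w) * eval_word X w)" for v w
    unfolding mult_single fa_eval_single eval_word_plus by (simp only: scalar_op_mult_mult)
  ultimately have "fa_eval X (p * r) = (\<Sum>v\<in>Poly_Mapping.keys p. \<Sum>w\<in>Poly_Mapping.keys r.
      (scalar_op (Poly_Mapping.lookup p v) * eval_word X v) * (scalar_op (Poly_Mapping.lookup r w) * eval_word X w))"
    by (simp only: fa_eval_sum)
  then show ?thesis unfolding fa_eval_def sum_product .
qed

lemma fa_eval_const [simp]: "fa_eval X (fa_const c) = scalar_op c"
  by (simp add: fa_const_def fa_eval_single eval_word_def zero_fword_def)

lemma fa_eval_gen [simp]: "fa_eval X (fa_gen a) = X a"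
  by (simp add: fa_gen_def fa_eval_single eval_word_def)

lemma fa_const_1: "fa_const 1 = 1"
  by (simp add: fa_const_def)

lemma fa_const_0: "fa_const 0 = 0"
  by (simp add: fa_const_def)

lemma fa_const_add: "fa_const (a + b) = fa_const a + fa_const b"
  by (simp add: fa_const_def single_add)

lemma fa_const_mult: "fa_const (a * b) = fa_const a * fa_const b"
  by (simp add: fa_const_def mult_single)

lemma fa_const_diff: "fa_const (a - b) = fa_const a - fa_const b"
  by (simp add: fa_const_def single_diff)

lemma fa_const_single: "fa_const a * Poly_Mapping.single w b = Poly_Mapping.single w (a * b)"
  by (simp add: fa_const_def mult_single)

lemma fa_const_central: "p * fa_const a = fa_const a * (p :: 'a fword \<Rightarrow>\<^sub>0 'k::field)"
proof -
  let ?s = "\<lambda>w. Poly_Mapping.single w (Poly_Mapping.lookup p w)"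
  have "(\<Sum>w\<in>Poly_Mapping.keys p. ?s w) * fa_const a = fa_const a * (\<Sum>w\<in>Poly_Mapping.keys p. ?s w)"
    unfolding sum_distrib_left sum_distrib_right
    by (intro sum.cong refl) (simp add: fa_const_def mult_single mult.commute)
  then show ?thesis by (simp only: poly_mapping_eq_sum_single[symmetric])
qed

lemma free_algebra_simps [simp]:
  "mult (free_algebra S) = (*)" "add (free_algebra S) = (+)" "one (free_algebra S) = 1" "zero (free_algebra S) = 0"
  by (simp_all add: free_algebra_def)

lemma in_free_algebra_iff: "p \<in> carrier (free_algebra S) \<longleftrightarrow> (\<forall>w\<in>Poly_Mapping.keys p. set (letters w) \<subseteq> S)"
  by (simp add: free_algebra_def)

lemma free_algebra_closed:
  shows "p \<in> carrier (free_algebra S) \<Longrightarrow> r \<in> carrier (free_algebra S) \<Longrightarrow> p + r \<in> carrier (free_algebra S)"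
    and "p \<in> carrier (free_algebra S) \<Longrightarrow> r \<in> carrier (free_algebra S) \<Longrightarrow> p * r \<in> carrier (free_algebra S)"
    and "p \<in> carrier (free_algebra S) \<Longrightarrow> - p \<in> carrier (free_algebra S)"
    and "p \<in> carrier (free_algebra S) \<Longrightarrow> r \<in> carrier (free_algebra S) \<Longrightarrow> p - r \<in> carrier (free_algebra S)"
    and "fa_const c \<in> carrier (free_algebra S)"
    and "0 \<in> carrier (free_algebra S)" "1 \<in> carrier (free_algebra S)"
    and "a \<in> S \<Longrightarrow> fa_gen a \<in> carrier (free_algebra S)"
proof -
  show add: "p \<in> carrier (free_algebra S) \<Longrightarrow> r \<in> carrier (free_algebra S) \<Longrightarrow> p + r \<in> carrier (free_algebra S)" for p r
    using keys_add[of p r] unfolding in_free_algebra_iff by blast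
  show "p \<in> carrier (free_algebra S) \<Longrightarrow> r \<in> carrier (free_algebra S) \<Longrightarrow> p * r \<in> carrier (free_algebra S)"
    using keys_mult[of p r] unfolding in_free_algebra_iff by (fastforce simp: plus_fword_def)
  have "Poly_Mapping.keys (- p) = Poly_Mapping.keys p" for p :: "'a fword \<Rightarrow>\<^sub>0 'b"
    by (auto simp: in_keys_iff)
  then show um: "p \<in> carrier (free_algebra S) \<Longrightarrow> - p \<in> carrier (free_algebra S)" for p
    unfolding in_free_algebra_iff by simp
  show "p \<in> carrier (free_algebra S) \<Longrightarrow> r \<in> carrier (free_algebra S) \<Longrightarrow> p - r \<in> carrier (free_algebra S)"
    using add[OF _ um, of p r] by simp
qed (auto simp: in_free_algebra_iff fa_const_def fa_gen_def zero_fword_def split: if_splits)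

lemma ring_free_algebra: "ring (free_algebra S)"
proof (rule ringI)
  show "abelian_group (free_algebra S)"
  proof (rule abelian_groupI)
    fix x assume "x \<in> carrier (free_algebra S)"
    then show "\<exists>y\<in>carrier (free_algebra S). y \<oplus>\<^bsub>free_algebra S\<^esub> x = \<zero>\<^bsub>free_algebra S\<^esub>"
      by (intro bexI[of _ "- x"]) (auto simp: free_algebra_closed)
  qed (auto simp: free_algebra_closed algebra_simps)
  show "monoid (free_algebra S)"
    by (rule monoidI) (auto simp: free_algebra_closed algebra_simps)
qed (auto simp: algebra_simps)

lemma qmat_relations_subset: "qmat_relations q m n \<subseteq> carrier (qmat_free m n)"
  unfolding qmat_relations_def
  by (auto intro!: free_algebra_closed(8,2,4,5))

lemma qmat_ideal: "ideal (qmat_ideal q m n) (qmat_free m n)"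
  unfolding qmat_ideal_def
  by (rule ring.genideal_ideal[OF ring_free_algebra qmat_relations_subset])

lemma qmat_relations_in_ideal: "qmat_relations q m n \<subseteq> qmat_ideal q m n"
  unfolding qmat_ideal_def
  by (rule ring.genideal_self[OF ring_free_algebra qmat_relations_subset])

lemma qmat_ideal_closed:
  fixes q :: "'k::field"
  shows "a \<in> qmat_ideal q m n \<Longrightarrow> b \<in> qmat_ideal q m n \<Longrightarrow> a + b \<in> qmat_ideal q m n"
    and "a \<in> qmat_ideal q m n \<Longrightarrow> p \<in> carrier (qmat_free m n) \<Longrightarrow> p * a \<in> qmat_ideal q m n"
    and "a \<in> qmat_ideal q m n \<Longrightarrow> p \<in> carrier (qmat_free m n) \<Longrightarrow> a * p \<in> qmat_ideal q m n"
    and "a \<in> qmat_ideal q m n \<Longrightarrow> - a \<in> qmat_ideal q m n"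
    and "a \<in> qmat_ideal q m n \<Longrightarrow> b \<in> qmat_ideal q m n \<Longrightarrow> a - b \<in> qmat_ideal q m n"
    and "0 \<in> qmat_ideal q m n"
    and "a \<in> qmat_ideal q m n \<Longrightarrow> a \<in> carrier (qmat_free m n)"
proof -
  interpret ideal "qmat_ideal q m n" "qmat_free m n :: ((nat \<times> nat) fword \<Rightarrow>\<^sub>0 'k) ring" by (rule qmat_ideal)
  show add: "a \<in> qmat_ideal q m n \<Longrightarrow> b \<in> qmat_ideal q m n \<Longrightarrow> a + b \<in> qmat_ideal q m n" for a b
    using additive_subgroup.a_closed[OF ideal.axioms(1)[OF qmat_ideal]] by fastforce
  show mult: "a \<in> qmat_ideal q m n \<Longrightarrow> p \<in> carrier (qmat_free m n) \<Longrightarrow> p * a \<in> qmat_ideal q m n" for a p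
    using I_l_closed[of a p] by simp
  show "a \<in> qmat_ideal q m n \<Longrightarrow> p \<in> carrier (qmat_free m n) \<Longrightarrow> a * p \<in> qmat_ideal q m n"
    using I_r_closed[of a p] by simp
  show um: "- a \<in> qmat_ideal q m n" if "a \<in> qmat_ideal q m n" for a
  proof -
    have "- 1 * a \<in> qmat_ideal q m n" by (intro mult that free_algebra_closed)
    then show ?thesis by simp
  qed
  show "a \<in> qmat_ideal q m n \<Longrightarrow> b \<in> qmat_ideal q m n \<Longrightarrow> a - b \<in> qmat_ideal q m n"
    using add[OF _ um, of a b] by simp
  show "0 \<in> qmat_ideal q m n"
    using additive_subgroup.zero_closed[OF ideal.axioms(1)[OF qmat_ideal[of q m n]]] by simp
  show "a \<in> qmat_ideal q m n \<Longrightarrow> a \<in> carrier (qmat_free m n)" by (rule Icarr)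
qed

text \<open>The kernel of the evaluation is an ideal, and it contains the defining relations because
  \<open>X\<close> satisfies them.\<close>

lemma fa_eval_qmat_ideal:
  fixes q :: "'k::field"
  assumes X: "quantum_matrix (scalar_op q) (scalar_op (inverse q)) m n X"
    and p: "p \<in> qmat_ideal q m n"
  shows "fa_eval (case_prod X) p = 0"
proof -
  let ?J = "{p \<in> carrier (qmat_free m n). fa_eval (case_prod X) p = 0}"
  interpret ring "qmat_free m n :: ((nat \<times> nat) fword \<Rightarrow>\<^sub>0 'k) ring" by (rule ring_free_algebra)
  have "ideal ?J (qmat_free m n)"
  proof (rule idealI[OF ring_free_algebra])
    have inv: "\<ominus>\<^bsub>qmat_free m n\<^esub> a = - a" if "a \<in> carrier (qmat_free m n)" for a :: "(nat \<times> nat) fword \<Rightarrow>\<^sub>0 'k"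
      by (rule add.inv_equality) (use that in \<open>simp_all add: free_algebra_closed\<close>)
    show "subgroup ?J (add_monoid (qmat_free m n))"
      by (rule add.subgroupI)
        (auto simp: free_algebra_closed fa_eval_add fa_eval_uminus inv[simplified] intro!: exI[of _ 0])
  qed (auto simp: free_algebra_closed fa_eval_mult)
  moreover have "qmat_relations q m n \<subseteq> ?J"
  proof
    fix r assume r: "r \<in> qmat_relations q m n"
    then have "fa_eval (case_prod X) r = 0"
      unfolding qmat_relations_def using quantum_matrixD[OF X]
      by (auto simp: fa_eval_diff fa_eval_mult scalar_op_diff)
    with r qmat_relations_subset show "r \<in> ?J" by auto
  qed
  ultimately show ?thesis
    using p genideal_minimal[of ?J "qmat_relations q m n"] unfolding qmat_ideal_def by auto
qed

section \<open>Straightening into sorted words\<close>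

lemma single_FWord_append:
  "Poly_Mapping.single (FWord (u @ v)) 1
     = Poly_Mapping.single (FWord u) 1 * (Poly_Mapping.single (FWord v) 1 :: _ \<Rightarrow>\<^sub>0 'k::field)"
  by (simp add: mult_single plus_fword_def)

lemma fa_gen_mult_gen: "fa_gen a * fa_gen b = Poly_Mapping.single (FWord [a, b]) 1"
  by (simp add: fa_gen_def mult_single plus_fword_def)

text \<open>Letters are ordered by row and then by column. For equal rows the correction has to
  disappear: \<open>(i, l)\<close> followed by \<open>(k, j)\<close> would then be the very pair
  that is being rewritten.\<close>

lemma qmat_straighten_pair:
  fixes q :: "'k::field"
  assumes q: "q \<noteq> 0" and ij: "(i, j) < (k, l)" "1 \<le> i" "k \<le> m" "1 \<le> j" "j \<le> n" "1 \<le> l" "l \<le> n"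
  obtains c d where "i = k \<Longrightarrow> d = 0"
    "fa_gen (k, l) * fa_gen (i, j) - (fa_const c * (fa_gen (i, j) * fa_gen (k, l))
        + fa_const d * (fa_gen (i, l) * fa_gen (k, j))) \<in> qmat_ideal q m n"
proof -
  note rel = subsetD[OF qmat_relations_in_ideal]
  have q_cancel: "fa_const (inverse q) * (fa_const q * p) = (p :: (nat \<times> nat) fword \<Rightarrow>\<^sub>0 'k)" for p
    unfolding mult.assoc[symmetric] fa_const_mult[symmetric] using q by (simp add: fa_const_1)
  have swap: "x * y - (fa_const (inverse q) * (y * x) + fa_const 0 * z) \<in> qmat_ideal q m n"
    if "y * x - fa_const q * x * y \<in> qmat_ideal q m n" for x y z
  proof -
    have "- (fa_const (inverse q) * (y * x - fa_const q * x * y)) \<in> qmat_ideal q m n"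
      by (intro qmat_ideal_closed(2,4) free_algebra_closed that)
    then show ?thesis by (simp add: right_diff_distrib mult.assoc q_cancel fa_const_0)
  qed
  consider "i = k" "j < l" | "i < k" "j = l" | "i < k" "l < j" | "i < k" "j < l"
    using ij(1) linorder_neqE_nat[of j l] by (simp add: less_prod_def') blast
  then show thesis
  proof cases
    case 1
    have "fa_gen (i, j) * fa_gen (i, l) - fa_const q * fa_gen (i, l) * fa_gen (i, j) \<in> qmat_ideal q m n"
      by (rule rel) (use 1 ij in \<open>auto simp: qmat_relations_def\<close>)
    from swap[OF this] 1 show ?thesis by (intro that[of 0 "inverse q"]) (simp_all add: fa_const_0)
  next
    case 2
    have "fa_gen (i, j) * fa_gen (k, j) - fa_const q * fa_gen (k, j) * fa_gen (i, j) \<in> qmat_ideal q m n"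
      by (rule rel) (use 2 ij in \<open>auto simp: qmat_relations_def\<close>)
    from swap[OF this] 2 show ?thesis by (intro that[of 0 "inverse q"]) (simp_all add: fa_const_0)
  next
    case 3
    have "fa_gen (i, j) * fa_gen (k, l) - fa_gen (k, l) * fa_gen (i, j) \<in> qmat_ideal q m n"
      by (rule rel) (use 3 ij in \<open>auto simp: qmat_relations_def\<close>)
    from qmat_ideal_closed(4)[OF this] that[of 0 1] 3 show ?thesis
      by (simp add: fa_const_0 fa_const_1)
  next
    case 4
    have "fa_gen (i, j) * fa_gen (k, l) - fa_gen (k, l) * fa_gen (i, j)
        - fa_const (q - inverse q) * fa_gen (i, l) * fa_gen (k, j) \<in> qmat_ideal q m n"
      by (rule rel) (use 4 ij in \<open>auto simp: qmat_relations_def\<close>)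
    from qmat_ideal_closed(4)[OF this] that[of "inverse q - q" 1] 4 show ?thesis
      by (simp add: fa_const_0 fa_const_1 fa_const_diff algebra_simps)
  qed
qed

text \<open>The relations preserve the multiset of rows of a word. Recording it in \<open>M\<close>
  is what later allows the degree in every row to be fixed when basis words are counted.\<close>

definition normal_forms :: "nat \<Rightarrow> nat \<Rightarrow> nat multiset set \<Rightarrow> ((nat \<times> nat) fword \<Rightarrow>\<^sub>0 'k::field) set" where
  "normal_forms m n M = {f. \<forall>w\<in>Poly_Mapping.keys f. sorted (letters w) \<and>
     set (letters w) \<subseteq> {1..m} \<times> {1..n} \<and> mset (map fst (letters w)) \<in> M}"

lemma normal_forms_add: "f \<in> normal_forms m n M \<Longrightarrow> g \<in> normal_forms m n M \<Longrightarrow> f + g \<in> normal_forms m n M"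
  using keys_add[of f g] unfolding normal_forms_def by blast

lemma keys_fa_const_mult: "Poly_Mapping.keys (fa_const c * f) \<subseteq> Poly_Mapping.keys f"
  using keys_mult[of "fa_const c" f] by (auto simp: fa_const_def split: if_splits)

lemma normal_forms_scale: "f \<in> normal_forms m n M \<Longrightarrow> fa_const c * f \<in> normal_forms m n M"
  using keys_fa_const_mult[of c f] unfolding normal_forms_def by blast

text \<open>Straightening two letters from different rows may create inversions inside a row, but it always
  removes an inversion of rows; hence the lexicographic measure.\<close>

lemma word_normal_form:
  fixes q :: "'k::field"
  assumes q: "q \<noteq> 0" and "set u \<subseteq> {1..m} \<times> {1..n}"
  shows "\<exists>f \<in> normal_forms m n {mset (map fst u)}. Poly_Mapping.single (FWord u) 1 - f \<in> qmat_ideal q m n"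
  using assms(2)
proof (induction "(inversions (map fst u), inversions u)" arbitrary: u 
    rule: wf_induct_rule[OF wf_lex_prod[OF wf_less wf_less]])
  case (1 u)
  show ?case
  proof (cases "sorted u")
    case True
    with 1 show ?thesis
      by (intro bexI[of _ "Poly_Mapping.single (FWord u) 1"])
        (auto simp: normal_forms_def qmat_ideal_closed)
  next
    case False
    then obtain x a b y where u: "u = x @ [a, b] @ y" "b < a" by (rule not_sortedE)
    obtain k l i j where ab: "a = (k, l)" "b = (i, j)" by (cases a, cases b) auto
    have grid: "1 \<le> i" "k \<le> m" "1 \<le> j" "j \<le> n" "1 \<le> l" "l \<le> n" "i \<le> k" "i \<le> m" "1 \<le> k"
      using 1 u ab by (auto simp: less_prod_def')
    obtain c d where cd: "i = k \<Longrightarrow> d = 0"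
      "fa_gen (k, l) * fa_gen (i, j) - (fa_const c * (fa_gen (i, j) * fa_gen (k, l))
        + fa_const d * (fa_gen (i, l) * fa_gen (k, j))) \<in> qmat_ideal q m n"
      using qmat_straighten_pair[OF q, of i j k l m n] u(2) grid unfolding ab by blast
    let ?s = "\<lambda>w. Poly_Mapping.single (FWord w) 1 :: (nat \<times> nat) fword \<Rightarrow>\<^sub>0 'k"
    have sc: "?s w \<in> carrier (qmat_free m n)" if "set w \<subseteq> {1..m} \<times> {1..n}" for w
      using that by (simp add: in_free_algebra_iff)
    have "?s x * (fa_gen (k, l) * fa_gen (i, j) - (fa_const c * (fa_gen (i, j) * fa_gen (k, l))
        + fa_const d * (fa_gen (i, l) * fa_gen (k, j)))) * ?s y \<in> qmat_ideal q m n"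
      using 1 u by (intro qmat_ideal_closed(2,3) cd sc) auto
    also have "?s x * (fa_gen (k, l) * fa_gen (i, j) - (fa_const c * (fa_gen (i, j) * fa_gen (k, l))
        + fa_const d * (fa_gen (i, l) * fa_gen (k, j)))) * ?s y =
        ?s u - (fa_const c * ?s (x @ [b, a] @ y) + fa_const d * ?s (x @ [(i, l), (k, j)] @ y))"
      unfolding single_FWord_append u(1) fa_gen_mult_gen ab
      by (simp add: algebra_simps fa_const_central mult.assoc[symmetric, of _ "fa_const _"])
    finally have cong: "?s u - (fa_const c * ?s (x @ [b, a] @ y) + fa_const d * ?s (x @ [(i, l), (k, j)] @ y)) \<in> qmat_ideal q m n" .
    let ?M = "{mset (map fst u)}"
    have "\<exists>f \<in> normal_forms m n {mset (map fst (x @ [b, a] @ y))}. ?s (x @ [b, a] @ y) - f \<in> qmat_ideal q m n"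
    proof (rule 1(1))
      show "((inversions (map fst (x @ [b, a] @ y)), inversions (x @ [b, a] @ y)), inversions (map fst u), inversions u)
         \<in> {(x, y). x < y} <*lex*> {(x, y). x < y}"
        using inversions_swap[of b a x y] inversions_swap[of i k "map fst x" "map fst y"] u grid ab
        by (cases "i = k") auto
    qed (use 1 u in auto)
    then obtain f where f: "f \<in> normal_forms m n ?M" "?s (x @ [b, a] @ y) - f \<in> qmat_ideal q m n"
      using u ab by (auto simp: add_mset_commute)
    have "\<exists>g \<in> normal_forms m n ?M. fa_const d * ?s (x @ [(i, l), (k, j)] @ y) - g \<in> qmat_ideal q m n"
    proof (cases "i = k")
      case True
      then show ?thesis using cd(1) 
        by (intro bexI[of _ 0]) (auto simp: fa_const_0 qmat_ideal_closed normal_forms_def)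
    next
      case False
      have "\<exists>f \<in> normal_forms m n {mset (map fst (x @ [(i, l), (k, j)] @ y))}. ?s (x @ [(i, l), (k, j)] @ y) - f \<in> qmat_ideal q m n"
      proof (rule 1(1))
        show "((inversions (map fst (x @ [(i, l), (k, j)] @ y)), inversions (x @ [(i, l), (k, j)] @ y)), inversions (map fst u), inversions u)
           \<in> {(x, y). x < y} <*lex*> {(x, y). x < y}"
          using inversions_swap[of i k "map fst x" "map fst y"] u grid ab False by auto
      qed (use 1 u ab grid in auto)
      then obtain g where g: "g \<in> normal_forms m n ?M" "?s (x @ [(i, l), (k, j)] @ y) - g \<in> qmat_ideal q m n"
        using u ab by (auto simp: add_mset_commute)
      have "fa_const d * (?s (x @ [(i, l), (k, j)] @ y) - g) \<in> qmat_ideal q m n"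
        by (intro qmat_ideal_closed(2) g free_algebra_closed)
      with g normal_forms_scale[OF g(1)] show ?thesis by (auto simp: right_diff_distrib)
    qed
    then obtain g where g: "g \<in> normal_forms m n ?M"
      "fa_const d * ?s (x @ [(i, l), (k, j)] @ y) - g \<in> qmat_ideal q m n" by blast
    have "(?s u - (fa_const c * ?s (x @ [b, a] @ y) + fa_const d * ?s (x @ [(i, l), (k, j)] @ y)))
       + (fa_const c * (?s (x @ [b, a] @ y) - f) + (fa_const d * ?s (x @ [(i, l), (k, j)] @ y) - g)) \<in> qmat_ideal q m n"
      by (intro qmat_ideal_closed(1,2) cong f g free_algebra_closed)
    then have "?s u - (fa_const c * f + g) \<in> qmat_ideal q m n"
      by (simp add: algebra_simps)
    with f g show ?thesis by (blast intro: normal_forms_add normal_forms_scale)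
  qed
qed

section \<open>Growth of algebras over a central subfield\<close>

locale central_algebra = ring A for A :: "('a, 'b) ring_scheme" (structure) +
  fixes K :: "'a set"
  assumes K: "subfield K A"
    and central: "k \<in> K \<Longrightarrow> a \<in> carrier A \<Longrightarrow> k \<otimes> a = a \<otimes> k"
begin

lemma subspaceD:
  assumes "subalgebra K E A"
  shows "x \<in> E \<Longrightarrow> x \<in> carrier A" "\<zero> \<in> E" "x \<in> E \<Longrightarrow> y \<in> E \<Longrightarrow> x \<oplus> y \<in> E"
    "x \<in> E \<Longrightarrow> \<ominus> x \<in> E" "k \<in> K \<Longrightarrow> x \<in> E \<Longrightarrow> k \<otimes> x \<in> E"
  using subalgebra_in_carrier[OF assms] subalgebra.smult_closed[OF assms]
    subgroup.one_closed[OF subalgebra.axioms(1)[OF assms]]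
    add.subgroupE(3,4)[OF subalgebra.axioms(1)[OF assms]] by auto

lemma subspaceI:
  assumes "E \<subseteq> carrier A" "\<zero> \<in> E" "\<And>x y. x \<in> E \<Longrightarrow> y \<in> E \<Longrightarrow> x \<oplus> y \<in> E"
    "\<And>k x. k \<in> K \<Longrightarrow> x \<in> E \<Longrightarrow> k \<otimes> x \<in> E"
  shows "subalgebra K E A"
proof (intro subalgebra.intro add.subgroupI)
  have "\<ominus> \<one> \<in> K" using subringE(3,5)[OF subfieldE(1)[OF K]] by blast
  then show "\<ominus> x \<in> E" if "x \<in> E" for x
    using assms(4)[of "\<ominus> \<one>" x] that assms(1) by (auto simp: l_minus)
  show "subalgebra_axioms K E A" using assms(4) by (simp add: subalgebra_axioms_def)
qed (use assms in auto)

lemma K_subspace: "subalgebra K K A"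
  using subringE[OF subfieldE(1)[OF K]] by (intro subspaceI) auto

lemma ideal_prod_subspace:
  assumes E: "subalgebra K E A" and F: "subalgebra K F A"
  shows "subalgebra K (ideal_prod A E F) A"
proof -
  have carr: "x \<in> carrier A" if "x \<in> ideal_prod A E F" for x
    using that by induction (use subspaceD(1)[OF E] subspaceD(1)[OF F] in auto)
  have Kc: "K \<subseteq> carrier A" by (rule subfieldE(3)[OF K])
  show ?thesis
  proof (rule subspaceI)
    have "\<zero> \<otimes> \<zero> \<in> ideal_prod A E F" by (intro ideal_prod.prod subspaceD(2) E F)
    then show "\<zero> \<in> ideal_prod A E F" by simp
    show "k \<otimes> x \<in> ideal_prod A E F" if "k \<in> K" "x \<in> ideal_prod A E F" for k x
      using that(2)
    proof induction
      case (prod i j)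
      have "k \<otimes> i \<otimes> j \<in> ideal_prod A E F"
        by (intro ideal_prod.prod subspaceD(5)[OF E] prod that)
      then show ?case
        using prod that Kc subspaceD(1)[OF E] subspaceD(1)[OF F] by (metis m_assoc subsetD)
    next
      case (sum s1 s2)
      then show ?case
        using carr that(1) Kc ideal_prod.sum[OF sum.IH] by (metis r_distr subsetD)
    qed
  qed (use carr ideal_prod.sum in auto)
qed

section \<open>The filtration by powers of a generating subspace\<close>

context
  fixes V assumes V: "subalgebra K V A"
begin

lemma subspace_power_subspace: "subalgebra K (subspace_power A K V i) A"
  by (induction i) (simp_all add: K_subspace ideal_prod_subspace V)

lemma subspace_power_sum_subspace: "subalgebra K (subspace_power_sum A K V N) A"
proof (induction N)
  case (Suc N)
  let ?E = "subspace_power_sum A K V N" and ?F = "subspace_power A K V (Suc N)"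
  note E = subspaceD[OF Suc] and F = subspaceD[OF subspace_power_subspace[of "Suc N"]]
  have Kc: "k \<in> carrier A" if "k \<in> K" for k using subfieldE(3)[OF K] that by auto
  show ?case
    unfolding subspace_power_sum.simps
  proof (rule subspaceI)
    show "?E <+>\<^bsub>A\<^esub> ?F \<subseteq> carrier A" using E(1) F(1) unfolding set_add_def' by auto
    show "\<zero> \<in> ?E <+>\<^bsub>A\<^esub> ?F" using E(2) F(2) unfolding set_add_def' by (auto intro!: bexI[of _ \<zero>])
    fix x y assume "x \<in> ?E <+>\<^bsub>A\<^esub> ?F" "y \<in> ?E <+>\<^bsub>A\<^esub> ?F"
    then obtain a b a' b' where *: "a \<in> ?E" "b \<in> ?F" "a' \<in> ?E" "b' \<in> ?F" "x = a \<oplus> b" "y = a' \<oplus> b'"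
      unfolding set_add_def' by blast
    have "x \<oplus> y = (a \<oplus> a') \<oplus> (b \<oplus> b')" using * E(1) F(1) by (simp add: a_ac)
    moreover have "a \<oplus> a' \<in> ?E" "b \<oplus> b' \<in> ?F" using * E(3) F(3) by blast+
    ultimately show "x \<oplus> y \<in> ?E <+>\<^bsub>A\<^esub> ?F" unfolding set_add_def' by blast
  next
    fix k x assume k: "k \<in> K" and "x \<in> ?E <+>\<^bsub>A\<^esub> ?F"
    then obtain a b where *: "a \<in> ?E" "b \<in> ?F" "x = a \<oplus> b" unfolding set_add_def' by blast
    have "k \<otimes> x = k \<otimes> a \<oplus> k \<otimes> b" using * k Kc E(1) F(1) by (simp add: r_distr)
    moreover have "k \<otimes> a \<in> ?E" "k \<otimes> b \<in> ?F" using * k E(5) F(5) by blast+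
    ultimately show "k \<otimes> x \<in> ?E <+>\<^bsub>A\<^esub> ?F" unfolding set_add_def' by blast
  qed
qed (simp add: K_subspace)

lemma subspace_power_sum_Suc: "subspace_power_sum A K V N \<subseteq> subspace_power_sum A K V (Suc N)"
proof
  fix x assume x: "x \<in> subspace_power_sum A K V N"
  have "x = x \<oplus> \<zero>" using subspaceD(1)[OF subspace_power_sum_subspace x] by simp
  then show "x \<in> subspace_power_sum A K V (Suc N)"
    using x subspaceD(2)[OF subspace_power_subspace[of "Suc N"]]
    unfolding subspace_power_sum.simps set_add_def' by blast
qed

lemma subspace_power_sum_mono: "M \<le> N \<Longrightarrow> subspace_power_sum A K V M \<subseteq> subspace_power_sum A K V N"
  by (rule lift_Suc_mono_le[of "subspace_power_sum A K V"]) (rule subspace_power_sum_Suc)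

lemma subspace_power_subset_sum: "i \<le> N \<Longrightarrow> subspace_power A K V i \<subseteq> subspace_power_sum A K V N"
proof -
  have "subspace_power A K V i \<subseteq> subspace_power_sum A K V i"
  proof (cases i)
    case (Suc j)
    show ?thesis
    proof
      fix x assume x: "x \<in> subspace_power A K V i"
      have "x = \<zero> \<oplus> x" using subspaceD(1)[OF subspace_power_subspace x] by simp
      then show "x \<in> subspace_power_sum A K V i"
        using x subspaceD(2)[OF subspace_power_sum_subspace[of j]]
        unfolding Suc subspace_power_sum.simps set_add_def' by blast
    qed
  qed simp
  then show "i \<le> N \<Longrightarrow> ?thesis" using subspace_power_sum_mono by blast
qed

lemma subspace_power_mult:
  assumes x: "x \<in> subspace_power A K V i" and "y \<in> subspace_power A K V j"
  shows "x \<otimes> y \<in> subspace_power A K V (i + j)"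
  using assms(2)
proof (induction j arbitrary: y)
  case 0
  \<comment> \<open>The zeroth power is \<open>K\<close>, so this case is where centrality of the
    scalars enters.\<close>
  then have "x \<otimes> y = y \<otimes> x" using central subspaceD(1)[OF subspace_power_subspace x] by auto
  with 0 x show ?case using subspaceD(5)[OF subspace_power_subspace] by simp
next
  case (Suc j)
  note cx = subspaceD(1)[OF subspace_power_subspace x]
  have "y \<in> ideal_prod A (subspace_power A K V j) V" using Suc.prems by simp
  then show ?case
  proof induction
    case (prod a b)
    have "x \<otimes> a \<otimes> b \<in> subspace_power A K V (i + Suc j)"
      using ideal_prod.prod[OF Suc.IH[OF prod(1)] prod(2)] by simp
    then show ?case
      using cx prod subspaceD(1)[OF subspace_power_subspace] subspaceD(1)[OF V] by (simp add: m_assoc)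
  next
    case (sum s1 s2)
    have "s1 \<in> carrier A" "s2 \<in> carrier A"
      using sum subspaceD(1)[OF subspace_power_subspace[of "Suc j"]] by auto
    then have "x \<otimes> (s1 \<oplus> s2) = x \<otimes> s1 \<oplus> x \<otimes> s2" using cx by (simp add: r_distr)
    then show ?case using sum subspaceD(3)[OF subspace_power_subspace[of "i + Suc j"]] by simp
  qed
qed

lemma subspace_power_sum_induct [consumes 1, case_names power sum]:
  assumes "x \<in> subspace_power_sum A K V N"
    and "\<And>i x. i \<le> N \<Longrightarrow> x \<in> subspace_power A K V i \<Longrightarrow> P x"
    and "\<And>x y. x \<in> carrier A \<Longrightarrow> y \<in> carrier A \<Longrightarrow> P x \<Longrightarrow> P y \<Longrightarrow> P (x \<oplus> y)"
  shows "P x"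
  using assms(1,2)
proof (induction N arbitrary: x)
  case 0
  then show ?case by (metis le_refl subspace_power_sum.simps(1))
next
  case (Suc N)
  from Suc.prems(1) obtain a b where *: "a \<in> subspace_power_sum A K V N"
    "b \<in> subspace_power A K V (Suc N)" "x = a \<oplus> b"
    unfolding subspace_power_sum.simps set_add_def' by blast
  have "P a" by (rule Suc.IH[OF *(1)]) (use Suc.prems(2) le_SucI in blast)
  moreover have "P b" using Suc.prems(2) *(2) by blast
  ultimately show ?case
    unfolding *(3) using assms(3) *(1,2) subspaceD(1)[OF subspace_power_sum_subspace]
      subspaceD(1)[OF subspace_power_subspace] by blast
qed

lemma subspace_power_sum_mult:
  assumes "x \<in> subspace_power_sum A K V M" "y \<in> subspace_power_sum A K V N"
  shows "x \<otimes> y \<in> subspace_power_sum A K V (M + N)"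
  using assms(1)
proof (induction rule: subspace_power_sum_induct)
  case (power i x)
  note cx = subspaceD(1)[OF subspace_power_subspace power(2)]
  from assms(2) show ?case
  proof (induction rule: subspace_power_sum_induct)
    case (power j y)
    with subspace_power_mult[OF \<open>x \<in> subspace_power A K V i\<close> power(2)] \<open>i \<le> M\<close>
    show ?case using subspace_power_subset_sum[of "i + j" "M + N"] by auto
  next
    case (sum y z)
    with cx show ?case using subspaceD(3)[OF subspace_power_sum_subspace] by (simp add: r_distr)
  qed
next
  case (sum x z)
  moreover have "y \<in> carrier A" by (rule subspaceD(1)[OF subspace_power_sum_subspace assms(2)])
  ultimately show ?case using subspaceD(3)[OF subspace_power_sum_subspace] by (simp add: l_distr)
qed

lemma subset_subspace_power_sum: "V \<subseteq> subspace_power_sum A K V 1"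
proof
  fix v assume v: "v \<in> V"
  have "\<one> \<in> K" by (rule subringE(3)[OF subfieldE(1)[OF K]])
  then have "\<one> \<otimes> v \<in> subspace_power A K V 1" using v by (auto intro: ideal_prod.prod)
  then show "v \<in> subspace_power_sum A K V 1"
    using subspace_power_subset_sum[of 1 1] subspaceD(1)[OF V v] by auto
qed

lemma generated_in_subspace_power_sum:
  assumes "a \<in> generate_ring A (K \<union> V)"
  shows "\<exists>N. a \<in> subspace_power_sum A K V N"
  using assms
proof induction
  case one
  have "\<one> \<in> K" by (rule subringE(3)[OF subfieldE(1)[OF K]])
  then show ?case by (metis subspace_power.simps(1) subspace_power_sum.simps(1))
next
  case (incl h)
  then show ?case
    using subset_subspace_power_sum by (metis Un_iff subsetD subspace_power.simps(1) subspace_power_sum.simps(1))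
next
  case (a_inv h)
  then show ?case using subspaceD(4)[OF subspace_power_sum_subspace] by blast
next
  case (eng_add h1 h2)
  then obtain M N where "h1 \<in> subspace_power_sum A K V M" "h2 \<in> subspace_power_sum A K V N" by blast
  then have "h1 \<in> subspace_power_sum A K V (max M N)" "h2 \<in> subspace_power_sum A K V (max M N)"
    using subspace_power_sum_mono[of M "max M N"] subspace_power_sum_mono[of N "max M N"] by auto
  then show ?case using subspaceD(3)[OF subspace_power_sum_subspace] by blast
next
  case (eng_mult h1 h2)
  then show ?case using subspace_power_sum_mult by blast
qed

text \<open>Levels add under multiplication. A change of the generating space therefore only
  rescales \<open>N\<close> by a constant, which a logarithmic exponent does not see.\<close>

lemma subspace_power_sum_minimal:
  assumes W: "subalgebra K W A" and "W \<subseteq> subspace_power_sum A K V s"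
  shows "subspace_power_sum A K W N \<subseteq> subspace_power_sum A K V (s * N)"
proof -
  have KW: "k \<in> subspace_power_sum A K V M" if "k \<in> K" for k M
    using subspace_power_subset_sum[of 0 M] that by auto
  have pow: "subspace_power A K W i \<subseteq> subspace_power_sum A K V (s * i)" for i
  proof (induction i)
    case 0
    then show ?case by (auto intro: KW)
  next
    case (Suc i)
    show ?case
    proof
      fix x assume "x \<in> subspace_power A K W (Suc i)"
      then have "x \<in> ideal_prod A (subspace_power A K W i) W" by simp
      then show "x \<in> subspace_power_sum A K V (s * Suc i)"
      proof induction
        case (prod a b)
        then have "a \<otimes> b \<in> subspace_power_sum A K V (s * i + s)"
          using Suc assms(2) by (intro subspace_power_sum_mult) auto
        then show ?case by (simp add: add.commute)
      qed (use subspaceD(3)[OF subspace_power_sum_subspace] in blast)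
    qed
  qed
  show ?thesis
  proof (induction N)
    case 0
    then show ?case by (auto intro: KW)
  next
    case (Suc N)
    have le: "s * N \<le> s * Suc N" by simp
    show ?case
      using Suc pow[of "Suc N"] subspace_power_sum_mono[OF le] subspaceD(3)[OF subspace_power_sum_subspace[of "s * Suc N"]]
      unfolding subspace_power_sum.simps(2)[of A K W] set_add_def' by (blast dest: subsetD)
  qed
qed

end

text \<open>The value of \<open>dim\<close> is meaningful only in finite dimension. A bound on the
  length of independent lists provides a longest one, and a longest one must span
  \<open>E\<close>.\<close>

lemma dim_bounds:
  assumes E: "subalgebra K E A"
    and B: "\<And>Us. independent K Us \<Longrightarrow> set Us \<subseteq> E \<Longrightarrow> length Us \<le> B"
  shows "dim K E \<le> B" "independent K Us \<Longrightarrow> set Us \<subseteq> E \<Longrightarrow> length Us \<le> dim K E"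
proof -
  let ?L = "{length Us | Us. independent K Us \<and> set Us \<subseteq> E}"
  have fin: "finite ?L" by (rule finite_subset[of _ "{..B}"]) (use B in auto)
  moreover have "0 \<in> ?L" by (auto intro!: exI[of _ "[]"])
  ultimately have "Max ?L \<in> ?L" by (intro Max_in) auto
  then obtain Us where Us: "independent K Us" "set Us \<subseteq> E" "length Us = Max ?L" by auto
  have "Span K Us = E"
  proof (rule ccontr)
    assume "Span K Us \<noteq> E"
    moreover have "Span K Us \<subseteq> E" by (rule subalgebra_Span_incl[OF K E Us(2)])
    ultimately obtain v where v: "v \<in> E" "v \<notin> Span K Us" by blast
    have "independent K (v # Us)"
      by (rule li_Cons) (use v subspaceD(1)[OF E] Us in auto)
    then have "Suc (length Us) \<in> ?L" using v Us by (auto intro!: exI[of _ "v # Us"])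
    then show False using Us(3) Max_ge[OF fin] by fastforce
  qed
  then have "dimension (length Us) K E" by (rule dimensionI[OF K Us(1)])
  then have "dim K E = length Us" using dimI[OF K] by (simp add: over_def)
  then show "dim K E \<le> B" and "independent K Us' \<Longrightarrow> set Us' \<subseteq> E \<Longrightarrow> length Us' \<le> dim K E" for Us'
    using B Us(1,2) \<open>dimension (length Us) K E\<close> independent_length_le_dimension[OF K] by auto
qed

lemma generating_subspace_bound:
  assumes V: "fin_dim_generating_subspace A K V" and W: "fin_dim_generating_subspace A K W"
  obtains s where "\<And>N. subspace_power_sum A K V N \<subseteq> subspace_power_sum A K W (s * N)" "1 \<le> s"
proof -
  have V': "subalgebra K V A" "finite_dimension K V" and W': "subalgebra K W A"
    "generate_ring A (K \<union> W) = carrier A"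
    using V W by (auto simp: fin_dim_generating_subspace_def)
  obtain Us where Us: "set Us \<subseteq> carrier A" "Span K Us = V"
    using exists_base[OF K finite_dimensionE[OF K V'(2)]] by blast
  have "\<exists>N. u \<in> subspace_power_sum A K W N" if "u \<in> set Us" for u
    using generated_in_subspace_power_sum[OF W'(1)] W'(2) Us(1) that by blast
  then obtain f where f: "\<And>u. u \<in> set Us \<Longrightarrow> u \<in> subspace_power_sum A K W (f u)" by metis
  \<comment> \<open>The sum dominates every \<open>f u\<close>, so one level contains the whole
    basis; the successor makes \<open>s\<close> positive, so that it can serve as a divisor.\<close>
  define s where "s = Suc (\<Sum>u\<in>set Us. f u)"
  have "set Us \<subseteq> subspace_power_sum A K W s"
  proof
    fix u assume u: "u \<in> set Us"
    then have "f u \<le> s" unfolding s_def using member_le_sum[of u "set Us" f] by simp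
    then show "u \<in> subspace_power_sum A K W s"
      using f[OF u] subspace_power_sum_mono[OF W'(1)] by blast
  qed
  then have "V \<subseteq> subspace_power_sum A K W s"
    unfolding Us(2)[symmetric] by (rule subalgebra_Span_incl[OF K subspace_power_sum_subspace[OF W'(1)]])
  from subspace_power_sum_minimal[OF W'(1) V'(1) this] show thesis
    by (intro that[of s]) (auto simp: s_def)
qed

text \<open>The definition admits every generating space, so the exponent is computed for an
  arbitrary \<open>V\<close>, whose growth lies between rescalings of the growth of
  \<open>W\<close>. The form of the lower bound is the number of monomials in \<open>d\<close>
  elements with every exponent at most \<open>N div d\<close>.\<close>

lemma GKdim_eqI:
  assumes W: "fin_dim_generating_subspace A K W" and d: "1 \<le> d"
    and upper: "\<And>N Us. independent K Us \<Longrightarrow> set Us \<subseteq> subspace_power_sum A K W N \<Longrightarrow> length Us \<le> (N + 1) ^ d"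
    and lower: "\<And>N. \<exists>Us. independent K Us \<and> set Us \<subseteq> subspace_power_sum A K W N \<and> (N div d + 1) ^ d \<le> length Us"
  shows "GKdim A K = ereal (real d)"
proof -
  have "growth_exponent A K V = ereal (real d)" if V: "fin_dim_generating_subspace A K V" for V
  proof -
    have V': "subalgebra K V A" using V by (simp add: fin_dim_generating_subspace_def)
    obtain s where s: "\<And>N. subspace_power_sum A K V N \<subseteq> subspace_power_sum A K W (s * N)" "1 \<le> s"
      using generating_subspace_bound[OF V W] by blast
    obtain t where t: "\<And>N. subspace_power_sum A K W N \<subseteq> subspace_power_sum A K V (t * N)" "1 \<le> t"
      using generating_subspace_bound[OF W V] by blast
    define g where "g N = dim K (subspace_power_sum A K V N)" for N
    have up: "g N \<le> (s * N + 1) ^ d" and low: "(N div t div d + 1) ^ d \<le> g N" for N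
    proof -
      note bnd = upper[OF _ order_trans[OF _ s(1)]]
      show "g N \<le> (s * N + 1) ^ d"
        unfolding g_def by (rule dim_bounds(1)[OF subspace_power_sum_subspace[OF V']]) (rule bnd)
      obtain Us where Us: "independent K Us" "set Us \<subseteq> subspace_power_sum A K W (N div t)"
        "(N div t div d + 1) ^ d \<le> length Us" using lower by blast
      have "subspace_power_sum A K W (N div t) \<subseteq> subspace_power_sum A K V N"
        using t(1)[of "N div t"] subspace_power_sum_mono[OF V', of "t * (N div t)" N] by (simp add: order_trans)
      with Us have "length Us \<le> g N"
        unfolding g_def by (intro dim_bounds(2)[OF subspace_power_sum_subspace[OF V'], of _ "(s * N + 1) ^ d"] bnd) auto
      with Us show "(N div t div d + 1) ^ d \<le> g N" by simp
    qed
    have "(\<lambda>N. log (real N) (real (g N))) \<longlonglongrightarrow> real d"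
    proof (rule tendsto_sandwich)
      define c where "c = real (t * d)"
      define C where "C = real (s + 1)"
      have c: "c > 0" "C > 0" using t d by (auto simp: c_def C_def)
      \<comment> \<open>A constant factor \<open>b\<close> only contributes the term
        \<open>ln b / ln (real N)\<close>, which tends to 0, so both bounds have the same
        limit.\<close>
      have log_eq: "log (real N) ((real N * b) ^ d) = real d * (1 + ln b / ln (real N))"
        if "N \<ge> 2" "b > 0" for b N
        using that by (simp add: log_def ln_realpow ln_mult field_simps)
      have lim: "(\<lambda>N. real d * (1 + ln b / ln (real N))) \<longlonglongrightarrow> real d" for b
      proof -
        have "(\<lambda>N. real d * (1 + ln b / ln (real N))) \<longlonglongrightarrow> real d * (1 + 0)"
          by (intro tendsto_intros tendsto_divide_0[OF tendsto_const] filterlim_at_top_imp_at_infinity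
              filterlim_compose[OF ln_at_top filterlim_real_sequentially])
        then show ?thesis by simp
      qed
      show "(\<lambda>N. real d * (1 + ln (1 / c) / ln (real N))) \<longlonglongrightarrow> real d" by (rule lim)
      show "(\<lambda>N. real d * (1 + ln C / ln (real N))) \<longlonglongrightarrow> real d" by (rule lim)
      show "eventually (\<lambda>N. real d * (1 + ln (1 / c) / ln (real N)) \<le> log (real N) (real (g N))) sequentially"
        using eventually_ge_at_top[of 2]
      proof eventually_elim
        case (elim N)
        have "real N * (1 / c) \<le> real (N div t div d + 1)"
        proof -
          have "N < t * d * (N div (t * d) + 1)"
            using dividend_less_times_div[of "t * d" N] t d by simp
          then have "real N \<le> c * real (N div (t * d) + 1)"
            unfolding c_def by (metis less_imp_le of_nat_le_iff of_nat_mult)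
          then show ?thesis using c by (simp add: field_simps div_mult2_eq[symmetric])
        qed
        then have "(real N * (1 / c)) ^ d \<le> real (N div t div d + 1) ^ d"
          using c by (intro power_mono) auto
        also have "\<dots> \<le> real (g N)" using low[of N] by (metis of_nat_le_iff of_nat_power)
        finally have "log (real N) ((real N * (1 / c)) ^ d) \<le> log (real N) (real (g N))"
          using elim c by (intro log_mono) auto
        then show ?case using log_eq[of N "1 / c"] elim c by simp
      qed
      show "eventually (\<lambda>N. log (real N) (real (g N)) \<le> real d * (1 + ln C / ln (real N))) sequentially"
        using eventually_ge_at_top[of 2]
      proof eventually_elim
        case (elim N)
        have "g N \<le> (s * N + 1) ^ d" by (rule up)
        also have "\<dots> \<le> (N * (s + 1)) ^ d" using elim by (intro power_mono) auto
        finally have "real (g N) \<le> (real N * C) ^ d"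
          unfolding C_def by (metis of_nat_le_iff of_nat_mult of_nat_power)
        moreover have "0 < g N"
          using low[of N] by (metis Suc_eq_plus1 gr0I le_zero_eq power_eq_0_iff nat.distinct(1))
        ultimately have "log (real N) (real (g N)) \<le> log (real N) ((real N * C) ^ d)"
          using elim by (intro log_mono) auto
        then show ?case using log_eq[of N C] elim c by simp
      qed
    qed
    then have "(\<lambda>N. ereal (log (real N) (real (g N)))) \<longlonglongrightarrow> ereal (real d)" by simp
    then show ?thesis
      unfolding growth_exponent_def g_def[symmetric] by (intro lim_imp_Limsup) simp_all
  qed
  with W show ?thesis unfolding GKdim_def by (intro the_equality) auto
qed

end

section \<open>Faithfulness of the evaluation\<close>

lemma normal_forms_mono: "M \<subseteq> M' \<Longrightarrow> normal_forms m n M \<subseteq> normal_forms m n M'"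
  unfolding normal_forms_def by blast

lemma normal_forms_sum: "(\<And>a. a \<in> A \<Longrightarrow> f a \<in> normal_forms m n M) \<Longrightarrow> sum f A \<in> normal_forms m n M"
proof (induction A rule: infinite_finite_induct)
  case (insert a A)
  then show ?case by (simp add: normal_forms_add)
qed (simp_all add: normal_forms_def)

lemma qmat_ideal_sum: "(\<And>a. a \<in> A \<Longrightarrow> f a \<in> qmat_ideal q m n) \<Longrightarrow> sum f A \<in> qmat_ideal q m n"
proof (induction A rule: infinite_finite_induct)
  case (insert a A)
  then show ?case by (simp add: qmat_ideal_closed(1))
qed (simp_all add: qmat_ideal_closed(6))

lemma ex_normal_form:
  fixes q :: "'k::field"
  assumes q: "q \<noteq> 0" and p: "p \<in> carrier (qmat_free m n)"
    and M: "\<And>w. w \<in> Poly_Mapping.keys p \<Longrightarrow> mset (map fst (letters w)) \<in> M"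
  shows "\<exists>f \<in> normal_forms m n M. p - f \<in> qmat_ideal q m n"
proof -
  have "\<exists>f \<in> normal_forms m n M. Poly_Mapping.single w 1 - f \<in> qmat_ideal q m n"
    if w: "w \<in> Poly_Mapping.keys p" for w
    using word_normal_form[OF q, of "letters w" m n] normal_forms_mono[of "{mset (map fst (letters w))}" M m n]
      M[OF w] p w unfolding in_free_algebra_iff by (fastforce simp: fword.collapse)
  then obtain f where f: "\<And>w. w \<in> Poly_Mapping.keys p \<Longrightarrow> f w \<in> normal_forms m n M"
    "\<And>w. w \<in> Poly_Mapping.keys p \<Longrightarrow> Poly_Mapping.single w 1 - f w \<in> qmat_ideal q m n" by metis
  define g where "g = (\<Sum>w\<in>Poly_Mapping.keys p. fa_const (Poly_Mapping.lookup p w) * f w)"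
  have p_eq: "p = (\<Sum>w\<in>Poly_Mapping.keys p. fa_const (Poly_Mapping.lookup p w) * Poly_Mapping.single w 1)"
    using poly_mapping_eq_sum_single[of p] by (simp add: fa_const_single)
  have "(\<Sum>w\<in>Poly_Mapping.keys p. fa_const (Poly_Mapping.lookup p w) * (Poly_Mapping.single w 1 - f w)) \<in> qmat_ideal q m n"
    by (intro qmat_ideal_sum qmat_ideal_closed f free_algebra_closed)
  then have "p - g \<in> qmat_ideal q m n"
    by (subst p_eq) (simp add: g_def right_diff_distrib sum_subtractf)
  moreover have "g \<in> normal_forms m n M"
    unfolding g_def by (intro normal_forms_sum normal_forms_scale f)
  ultimately show ?thesis by blast
qed

definition word_vec :: "nat \<Rightarrow> nat \<Rightarrow> (nat \<times> nat) list \<Rightarrow> nat \<times> nat \<Rightarrow> nat" where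
  "word_vec m n u = sum_list (map (case_prod (path_vec m (m + n))) u)"

lemma word_vec_apply: "word_vec m n u I = sum_list (map (\<lambda>(i, j). path_vec m (m + n) i j I) u)"
  by (induction u) (auto simp: word_vec_def)

text \<open>The exponent of a word is the combination of path exponents whose coefficients are the
  multiplicities of its letters. Linear independence over the integers recovers these
  multiplicities.\<close>

lemma word_vec_inj:
  assumes u: "set u \<subseteq> {1..m} \<times> {1..n}" "set u' \<subseteq> {1..m} \<times> {1..n}" and mn: "m \<le> n"
    and eq: "word_vec m n u = word_vec m n u'"
  shows "mset u = mset u'"
proof (rule multiset_eqI)
  fix x
  define d where "d i j = int (count_list u (i, j)) - int (count_list u' (i, j))" for i j
  have vec: "int (word_vec m n v I) = (\<Sum>i=1..m. \<Sum>j=1..n. int (count_list v (i, j)) * int (path_vec m (m + n) i j I))"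
    if "set v \<subseteq> {1..m} \<times> {1..n}" for v I
    unfolding word_vec_apply sum_list_map_eq_sum_count2[OF that finite_cartesian_product[OF finite_atLeastAtMost finite_atLeastAtMost]]
    by (simp add: sum.cartesian_product case_prod_beta)
  have d: "(\<Sum>i=1..m. \<Sum>j=1..n. d i j * int (path_vec m (m + n) i j I)) = 0" for I
    using vec[OF u(1), of I] vec[OF u(2), of I] eq
    by (simp add: d_def left_diff_distrib sum_subtractf)
  show "count (mset u) x = count (mset u') x"
  proof (cases "x \<in> {1..m} \<times> {1..n}")
    case True
    then obtain i j where "x = (i, j)" "1 \<le> i" "i \<le> m" "1 \<le> j" "j \<le> n" by auto
    with path_vec_independent[of d, OF d, of i j] mn show ?thesis
      by (simp add: d_def count_mset)
  next
    case False
    with u have "x \<notin># mset u" "x \<notin># mset u'" by auto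
    then show ?thesis by (simp only: not_in_iff)
  qed
qed

lemma net_weight_add: "net_weight m n (u + v) = net_weight m n u + net_weight m n v"
  by (simp add: net_weight_def weight_add)

context
  fixes q :: "'k::field" and m n :: nat
  assumes q: "q \<noteq> 0" and mn: "m \<le> n"
begin

lemma net_final:
  assumes "1 \<le> i" "i \<le> m" "1 \<le> j" "j \<le> n"
  shows "op_leads (net_weight m n) (net q m (m + n) i j) (path_vec m (m + n) i j)"
    "net_weight m n (path_vec m (m + n) i j)
       = 2 * int n * (int j - int i) - (int j - int i) * (int j - int i - 1)"
  using net_leads[OF q mn, of "m + n" i j] assms mn
  by (auto simp: reachable_def net_width_def path_weight_def Let_def)

lemma quantum_matrix_net_final:
  "quantum_matrix (scalar_op q) (scalar_op (inverse q)) m n (net q m (m + n))"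
  using quantum_matrix_net[OF q, of m "m + n"] mn by (simp add: net_width_def)

lemma eval_word_leads:
  assumes "set u \<subseteq> {1..m} \<times> {1..n}"
  shows "op_leads (net_weight m n) (prod_list (map (case_prod (net q m (m + n))) u)) (word_vec m n u)"
proof -
  have "op_leads (net_weight m n) (prod_list (map (case_prod (net q m (m + n))) u))
     (sum_list (rev (map (case_prod (path_vec m (m + n))) u)))"
    by (rule op_leads_prod_list[where w = "net_weight m n", OF net_weight_add]) (use assms in \<open>auto intro!: net_final\<close>)
  then show ?thesis by (simp add: word_vec_def sum_list_rev)
qed

text \<open>Modulo the ideal, \<open>p\<close> is a combination of sorted words. A sorted word is
  determined by its multiset of letters, so distinct sorted words have distinct leading exponents
  and independent values. The same reasoning shows that the sorted words form a basis of the
  quotient.\<close>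

lemma fa_eval_net_eq_0:
  assumes p: "p \<in> carrier (qmat_free m n)" and "fa_eval (case_prod (net q m (m + n))) p = 0"
  shows "p \<in> qmat_ideal q m n"
proof -
  obtain f where f: "f \<in> normal_forms m n UNIV" "p - f \<in> qmat_ideal q m n"
    using ex_normal_form[OF q p, of UNIV] by blast
  have "fa_eval (case_prod (net q m (m + n))) (p - f) = 0"
    by (rule fa_eval_qmat_ideal[OF quantum_matrix_net_final f(2)])
  with assms(2) have 0: "(\<Sum>w\<in>Poly_Mapping.keys f. scalar_op (Poly_Mapping.lookup f w) *
      eval_word (case_prod (net q m (m + n))) w) = 0"
    by (simp add: fa_eval_diff fa_eval_def[of _ f])
  have f': "sorted (letters w)" "set (letters w) \<subseteq> {1..m} \<times> {1..n}" if "w \<in> Poly_Mapping.keys f" for w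
    using f(1) that by (auto simp: normal_forms_def)
  have inj: "inj_on (\<lambda>w. word_vec m n (letters w)) (Poly_Mapping.keys f)"
  proof (rule inj_onI)
    fix v w assume vw: "v \<in> Poly_Mapping.keys f" "w \<in> Poly_Mapping.keys f"
      "word_vec m n (letters v) = word_vec m n (letters w)"
    then have "mset (letters v) = mset (letters w)" using word_vec_inj f' mn by blast
    then have "letters v = letters w" using f' vw by (metis properties_for_sort)
    then show "v = w" by (rule fword.expand)
  qed
  have "Poly_Mapping.lookup f w = 0" if "w \<in> Poly_Mapping.keys f" for w
    by (rule op_leads_independent[where w = "net_weight m n", OF net_weight_add _ inj _ 0 that])
      (auto simp: eval_word_def intro!: eval_word_leads f')
  then have "f = 0" by (intro poly_mapping_eqI) (metis in_keys_iff lookup_zero)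
  with f(2) show ?thesis by simp
qed

end

section \<open>Leading exponents of minors\<close>

lemma inversions_conv_card: "inversions xs = card {(i, j). i < j \<and> j < length xs \<and> xs ! j < xs ! i}"
proof (induction xs)
  case (Cons x xs)
  let ?A = "{j. j < length xs \<and> xs ! j < x}"
    and ?B = "{(i, j). i < j \<and> j < length xs \<and> xs ! j < xs ! i}"
  have fB: "finite ?B" by (rule finite_subset[of _ "{..<length xs} \<times> {..<length xs}"]) auto
  have "{(i, j). i < j \<and> j < length (x # xs) \<and> (x # xs) ! j < (x # xs) ! i}
      = (\<lambda>j. (0::nat, Suc j)) ` ?A \<union> map_prod Suc Suc ` ?B" (is "?L = ?R")
  proof (rule Set.set_eqI)
    fix p :: "nat \<times> nat"
    obtain i j where p: "p = (i, j)" by (cases p)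
    show "p \<in> ?L \<longleftrightarrow> p \<in> ?R"
      unfolding p by (cases i; cases j) (auto simp: image_iff)
  qed
  moreover have "card ?R = card ((\<lambda>j. (0::nat, Suc j)) ` ?A) + card (map_prod Suc Suc ` ?B)"
    by (rule Finite_Set.card_Un_disjoint) (use fB in auto)
  ultimately show ?case
    using Cons by (simp add: card_image inj_on_def length_filter_conv_card)
qed simp

text \<open>Minors are kept in the free algebra so that they can be evaluated on different quantum
  matrices, on the full product as well as on the band.\<close>

definition fa_minor :: "'k::field \<Rightarrow> nat \<Rightarrow> nat set \<Rightarrow> (nat \<times> nat) fword \<Rightarrow>\<^sub>0 'k" where
  "fa_minor q m J = (\<Sum>\<sigma> | \<sigma> permutes {1..m}. fa_const ((- q) ^ perm_length m \<sigma>) *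
        prod_list (map (\<lambda>i. fa_gen (i, elem_at J (\<sigma> i))) [1..<m + 1]))"

lemma qminor_eq: "qminor q m n J = qmat_class q m n (fa_minor q m J)"
  by (simp add: qminor_def fa_minor_def)

lemma minor_indicesD:
  assumes "J \<in> minor_indices m n"
  shows "finite J" "card J = m" "J \<subseteq> {1..n}" "length (sorted_list_of_set J) = m"
proof -
  show J: "J \<subseteq> {1..n}" "card J = m" using assms by (auto simp: minor_indices_def)
  then show "finite J" by (rule_tac finite_subset) auto
  show "length (sorted_list_of_set J) = m" using J by simp
qed

lemma map_elem_at:
  assumes "J \<in> minor_indices m n"
  shows "map (elem_at J) [1..<m+1] = sorted_list_of_set J"
  by (rule nth_equalityI) (use minor_indicesD[OF assms] in \<open>auto simp: elem_at_def simp del: upt_Suc\<close>)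

lemma elem_at_in:
  assumes "J \<in> minor_indices m n" "1 \<le> i" "i \<le> m"
  shows "elem_at J i \<in> J"
proof -
  have "sorted_list_of_set J ! (i - 1) \<in> set (sorted_list_of_set J)"
    using minor_indicesD(4)[OF assms(1)] assms(2,3) by (intro nth_mem) simp
  then show ?thesis using minor_indicesD(1)[OF assms(1)] by (simp add: elem_at_def)
qed

lemma elem_at_less_iff:
  assumes "J \<in> minor_indices m n" "1 \<le> i" "i \<le> m" "1 \<le> j" "j \<le> m"
  shows "elem_at J i < elem_at J j \<longleftrightarrow> i < j"
proof -
  have less: "elem_at J i < elem_at J j" if "1 \<le> i" "i < j" "j \<le> m" for i j
    unfolding elem_at_def
    by (rule sorted_wrt_nth_less[OF strict_sorted_list_of_set]) (use that minor_indicesD(4)[OF assms(1)] in auto)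
  from less[of i j] less[of j i] assms show ?thesis by (cases i j rule: linorder_cases) auto
qed

text \<open>Reading off the columns row by row turns the permutations in the definition of a minor
  into the orderings over which \<open>qdet\<close> sums. Surjectivity follows by counting, since
  there are equally many of both.\<close>

lemma bij_betw_permutes_permutations_of_set:
  assumes J: "J \<in> minor_indices m n"
  shows "bij_betw (\<lambda>\<sigma>. map (\<lambda>i. elem_at J (\<sigma> i)) [1..<m+1]) {\<sigma>. \<sigma> permutes {1..m}} (permutations_of_set J)"
    (is "bij_betw ?f ?P _")
proof -
  note [simp del] = upt_Suc
  have set: "set [1..<m+1] = {1..m}" by auto
  have inj_J: "inj_on (elem_at J) {1..m}"
    by (rule inj_onI) (metis elem_at_less_iff[OF J] atLeastAtMost_iff linorder_neq_iff)
  have inj: "inj_on ?f ?P"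
  proof (rule inj_onI)
    fix \<sigma> \<tau> assume *: "\<sigma> \<in> ?P" "\<tau> \<in> ?P" "?f \<sigma> = ?f \<tau>"
    show "\<sigma> = \<tau>"
    proof
      fix i show "\<sigma> i = \<tau> i"
      proof (cases "i \<in> {1..m}")
        case True
        then have "elem_at J (\<sigma> i) = elem_at J (\<tau> i)" using *(3) set by (auto simp: map_eq_conv)
        moreover have "\<sigma> i \<in> {1..m}" "\<tau> i \<in> {1..m}"
          using * True permutes_in_image[of \<sigma> "{1..m}" i] permutes_in_image[of \<tau> "{1..m}" i] by simp_all
        ultimately show ?thesis by (rule inj_onD[OF inj_J])
      next
        case False
        then show ?thesis using * by (simp add: permutes_not_in)
      qed
    qed
  qed
  have sub: "?f ` ?P \<subseteq> permutations_of_set J"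
  proof (rule image_subsetI)
    fix \<sigma> assume "\<sigma> \<in> ?P"
    then have \<sigma>: "\<sigma> permutes {1..m}" by simp
    have "inj_on (\<lambda>i. elem_at J (\<sigma> i)) {1..m}"
      using comp_inj_on[OF permutes_inj_on[OF \<sigma>, of "{1..m}"], of "elem_at J"] permutes_image[OF \<sigma>] inj_J
      by (simp add: o_def)
    then have d: "distinct (?f \<sigma>)" by (simp add: distinct_map atLeastLessThanSuc_atLeastAtMost)
    have "elem_at J (\<sigma> i) \<in> J" if "i \<in> {1..m}" for i
      using elem_at_in[OF J, of "\<sigma> i"] permutes_in_image[OF \<sigma>, of i] that by simp
    then have "set (?f \<sigma>) \<subseteq> J" by auto
    moreover have "card (set (?f \<sigma>)) = card J" using d minor_indicesD(2)[OF J] by (simp add: distinct_card del: set_map)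
    ultimately have "set (?f \<sigma>) = J" using minor_indicesD(1)[OF J] by (simp add: card_subset_eq)
    with d show "?f \<sigma> \<in> permutations_of_set J" by (simp add: permutations_of_set_def)
  qed
  have "card (?f ` ?P) = card ?P" by (rule card_image[OF inj])
  then have "card (?f ` ?P) = card (permutations_of_set J)"
    using card_permutations[of "{1..m}" m] minor_indicesD(1,2)[OF J] by simp
  with sub have "?f ` ?P = permutations_of_set J" by (intro card_subset_eq) auto
  with inj show ?thesis by (simp add: bij_betw_def)
qed

lemma inversions_permutes:
  assumes J: "J \<in> minor_indices m n" and \<sigma>: "\<sigma> permutes {1..m}"
  shows "inversions (map (\<lambda>i. elem_at J (\<sigma> i)) [1..<m+1]) = perm_length m \<sigma>"
proof -
  note [simp del] = upt_Suc
  let ?B = "{(i, j). i < j \<and> j < m \<and> elem_at J (\<sigma> (Suc j)) < elem_at J (\<sigma> (Suc i))}"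
  have "{(i, j). 1 \<le> i \<and> i < j \<and> j \<le> m \<and> \<sigma> j < \<sigma> i} = map_prod Suc Suc ` ?B" (is "?L = ?R")
  proof (rule Set.set_eqI)
    fix p :: "nat \<times> nat"
    obtain i j where p: "p = (i, j)" by (cases p)
    have "\<sigma> i \<in> {1..m} \<longleftrightarrow> i \<in> {1..m}" "\<sigma> j \<in> {1..m} \<longleftrightarrow> j \<in> {1..m}"
      using permutes_in_image[OF \<sigma>] by auto
    then have "1 \<le> i \<and> i < j \<and> j \<le> m \<Longrightarrow> elem_at J (\<sigma> j) < elem_at J (\<sigma> i) \<longleftrightarrow> \<sigma> j < \<sigma> i"
      by (intro elem_at_less_iff[OF J]) auto
    then show "p \<in> ?L \<longleftrightarrow> p \<in> ?R"
      unfolding p by (cases i; cases j) (auto simp: image_iff)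
  qed
  then have "perm_length m \<sigma> = card ?B"
    unfolding perm_length_def by (simp add: card_image inj_on_def)
  also have "?B = {(i, j). i < j \<and> j < length (map (\<lambda>i. elem_at J (\<sigma> i)) [1..<m+1]) \<and>
     map (\<lambda>i. elem_at J (\<sigma> i)) [1..<m+1] ! j < map (\<lambda>i. elem_at J (\<sigma> i)) [1..<m+1] ! i}"
    by auto
  finally show ?thesis by (simp add: inversions_conv_card)
qed

lemma fa_eval_prod_list: "fa_eval X (prod_list ps) = prod_list (map (fa_eval X) ps)"
proof (induction ps)
  case Nil
  have "fa_eval X 1 = 1" using fa_eval_const[of X 1] by (simp add: fa_const_1)
  then show ?case by simp
qed (simp add: fa_eval_mult)

lemma fa_eval_minor:
  assumes J: "J \<in> minor_indices m n"
  shows "fa_eval (case_prod X) (fa_minor q m J) = qdet (scalar_op q) X [1..<m+1] J"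
proof -
  have zip: "map2 X l (map f l) = map (\<lambda>i. X i (f i)) l" for l :: "nat list" and f
    by (induction l) auto
  have "fa_eval (case_prod X) (fa_minor q m J) = (\<Sum>\<sigma> | \<sigma> permutes {1..m}.
      (- scalar_op q) ^ perm_length m \<sigma> * prod_list (map (\<lambda>i. X i (elem_at J (\<sigma> i))) [1..<m+1]))"
    unfolding fa_minor_def fa_eval_sum fa_eval_mult fa_eval_prod_list
    by (simp add: scalar_op_power scalar_op_minus o_def del: upt_Suc)
  also have "\<dots> = (\<Sum>\<sigma> | \<sigma> permutes {1..m}. (- scalar_op q) ^ inversions (map (\<lambda>i. elem_at J (\<sigma> i)) [1..<m+1]) *
      prod_list (map2 X [1..<m+1] (map (\<lambda>i. elem_at J (\<sigma> i)) [1..<m+1])))"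
    by (intro sum.cong refl) (simp only: inversions_permutes[OF J] zip mem_Collect_eq)
  also have "\<dots> = qdet (scalar_op q) X [1..<m+1] J"
    unfolding qdet_def
    by (rule sum.reindex_bij_betw[OF bij_betw_permutes_permutations_of_set[OF J]])
  finally show ?thesis .
qed

section \<open>The diagonal term of a quantum minor\<close>

definition diag_word :: "nat \<Rightarrow> nat set \<Rightarrow> (nat \<times> nat) list" where
  "diag_word m J = zip [1..<m+1] (sorted_list_of_set J)"

lemma diag_word_eq:
  assumes J: "J \<in> minor_indices m n"
  shows "diag_word m J = map (\<lambda>i. (i, elem_at J i)) [1..<m+1]"
  unfolding diag_word_def map_elem_at[OF J, symmetric] by (simp only: zip_map2 zip_same_conv_map) simp

lemma set_diag_word:
  assumes "J \<in> minor_indices m n"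
  shows "set (diag_word m J) \<subseteq> {1..m} \<times> {1..n}"
  using elem_at_in[OF assms] minor_indicesD(3)[OF assms] unfolding diag_word_eq[OF assms] by auto

text \<open>This is \<open>path_weight\<close> at the final time \<open>m + n\<close>, where
  \<open>m\<close> has dropped out.\<close>

definition entry_weight :: "nat \<Rightarrow> nat \<Rightarrow> nat \<Rightarrow> int" where
  "entry_weight n i j = 2 * int n * (int j - int i) - (int j - int i) * (int j - int i - 1)"

primrec row_weight :: "nat \<Rightarrow> nat \<Rightarrow> nat list \<Rightarrow> int" where
  "row_weight n r [] = 0"
| "row_weight n r (c # cs) = entry_weight n r c + row_weight n (Suc r) cs"

lemma row_weight_append: "row_weight n r (us @ vs) = row_weight n r us + row_weight n (r + length us) vs"
  by (induction us arbitrary: r) auto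

text \<open>The weights are strictly supermodular, so the diagonal term dominates a quantum minor.\<close>

lemma row_weight_swap:
  assumes "b < a"
  shows "row_weight n r (us @ [a, b] @ vs) < row_weight n r (us @ [b, a] @ vs)"
proof -
  \<comment> \<open>The weight is a strictly concave function of column minus row. The differences
    \<open>a - r\<close> and \<open>b - r - 1\<close> have the same sum as \<open>b - r\<close> and
    \<open>a - r - 1\<close>, but lie further apart.\<close>
  have "entry_weight n r a + entry_weight n (Suc r) b < entry_weight n r b + entry_weight n (Suc r) a" for r
    using assms by (auto simp: entry_weight_def algebra_simps dest!: less_imp_Suc_add)
  from this[of "r + length us"] show ?thesis by (simp add: row_weight_append)
qed

lemma row_weight_sort: "row_weight n r xs \<le> row_weight n r (sort xs) \<and>
    (row_weight n r xs = row_weight n r (sort xs) \<longrightarrow> sorted xs)"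
proof (induction xs rule: bubble_induct)
  case (swap us a b vs)
  have "sort (us @ [a, b] @ vs) = sort (us @ [b, a] @ vs)" by (rule properties_for_sort) auto
  then show ?case using swap row_weight_swap[OF swap.hyps, of n r us vs] by auto
qed (simp add: sorted_sort_id)

lemma op_bound_power_uminus_scalar:
  assumes "w 0 = 0"
  shows "op_bound w ((- scalar_op q) ^ k) 0"
  using op_bound_scalar[of w "(- q) ^ k"] by (simp add: scalar_op_power scalar_op_minus)

context
  fixes q :: "'k::field" and m n :: nat
  assumes q: "q \<noteq> 0" and mn: "m \<le> n"
begin

lemma word_vec_Cons: "word_vec m n ((i, j) # u) = path_vec m (m + n) i j + word_vec m n u"
  by (simp add: word_vec_def)

lemma net_weight_zip:
  assumes "1 \<le> r" "r + length cs \<le> m + 1" "set cs \<subseteq> {1..n}"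
  shows "net_weight m n (word_vec m n (zip [r..<r + length cs] cs)) = row_weight n r cs"
  using assms
proof (induction cs arbitrary: r)
  case Nil
  then show ?case by (simp add: word_vec_def net_weight_def weight_def)
next
  case (Cons c cs)
  have "[r..<r + length (c # cs)] = r # [Suc r..<Suc r + length cs]" by (simp add: upt_rec)
  then have eq: "word_vec m n (zip [r..<r + length (c # cs)] (c # cs))
      = path_vec m (m + n) r c + word_vec m n (zip [Suc r..<Suc r + length cs] cs)"
    by (simp only: zip_Cons_Cons word_vec_Cons)
  have "net_weight m n (word_vec m n (zip [Suc r..<Suc r + length cs] cs)) = row_weight n (Suc r) cs"
    by (rule Cons.IH) (use Cons.prems in auto)
  then show ?case
    using Cons.prems net_final(2)[OF q mn, of r c]
    unfolding eq net_weight_add by (simp add: entry_weight_def)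
qed

text \<open>The term of an ordering \<open>cs\<close> has a leader of weight
  \<open>row_weight n 1 cs\<close>. By \<open>row_weight_sort\<close> only the sorted ordering
  attains the maximum, and since weights are integers all other terms fall short by at least
  1.\<close>

lemma qdet_net_leads:
  assumes J: "J \<in> minor_indices m n"
  shows "op_leads (net_weight m n) (qdet (scalar_op q) (net q m (m + n)) [1..<m+1] J) (word_vec m n (diag_word m J))"
proof -
  let ?w = "net_weight m n" and ?X = "net q m (m + n)" and ?js = "sorted_list_of_set J"
  note [simp del] = upt_Suc
  have perm: "length cs = m" "set cs \<subseteq> {1..n}" "set cs = J" "distinct cs" if "cs \<in> permutations_of_set J" for cs
    using that minor_indicesD[OF J] length_finite_permutations_of_set[OF that]
    by (auto simp: permutations_of_set_def)
  have js: "?js \<in> permutations_of_set J" using minor_indicesD(1)[OF J] by (simp add: permutations_of_set_def)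
  have w: "?w (word_vec m n (zip [1..<m+1] cs)) = row_weight n 1 cs" if "cs \<in> permutations_of_set J" for cs
    using net_weight_zip[of 1 cs] perm[OF that] by (simp add: add.commute)
  have leads: "op_leads ?w (prod_list (map2 ?X [1..<m+1] cs)) (word_vec m n (zip [1..<m+1] cs))"
    if "cs \<in> permutations_of_set J" for cs
  proof (rule eval_word_leads[OF q mn])
    have "set (zip [1..<m+1] cs) \<subseteq> set [1..<m+1] \<times> set cs"
      by (auto simp del: set_upt dest: set_zip_leftD set_zip_rightD)
    with perm(2)[OF that] show "set (zip [1..<m+1] cs) \<subseteq> {1..m} \<times> {1..n}" by auto
  qed
  have w0: "?w 0 = 0" by (simp add: net_weight_def weight_def)
  show ?thesis
    unfolding qdet_def diag_word_def
  proof (rule op_leads_sum[where w = "net_weight m n" and a = ?js, OF net_weight_add _ js])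
    show "op_leads ?w ((- scalar_op q) ^ inversions ?js * prod_list (map2 ?X [1..<m+1] ?js)) (word_vec m n (zip [1..<m+1] ?js))"
      using leads[OF js] by (simp add: inversions_sorted)
    fix cs assume cs: "cs \<in> permutations_of_set J" "cs \<noteq> ?js"
    have srt: "sort cs = ?js" using perm[OF cs(1)] by (metis sorted_list_of_set_sort_remdups distinct_remdups_id)
    have "\<not> sorted cs" using cs(2) srt sorted_sort_id by metis
    then have "row_weight n 1 cs < row_weight n 1 ?js" using row_weight_sort[of n 1 cs] srt by auto
    moreover have "op_bound ?w ((- scalar_op q) ^ inversions cs * prod_list (map2 ?X [1..<m+1] cs)) (0 + row_weight n 1 cs)"
      unfolding w[OF cs(1), symmetric]
      by (intro op_bound_mult op_bound_power_uminus_scalar op_leads_bound leads cs w0)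
    ultimately show "op_bound ?w ((- scalar_op q) ^ inversions cs * prod_list (map2 ?X [1..<m+1] cs))
        (?w (word_vec m n (zip [1..<m+1] ?js)) - 1)"
      unfolding w[OF js] by (auto intro: op_bound_mono)
  qed simp
qed

end

section \<open>Quotients and the order on index sets\<close>

lemma qmat_class_carrier: "f \<in> carrier (qmat_free m n) \<Longrightarrow> qmat_class q m n f \<in> carrier (quantum_matrices q m n)"
  unfolding qmat_class_def quantum_matrices_def FactRing_def
  by (auto simp: A_RCOSETS_def' a_r_coset_def')

lemma quantum_matrices_carrierE:
  assumes "a \<in> carrier (quantum_matrices q m n)"
  obtains f where "f \<in> carrier (qmat_free m n)" "a = qmat_class q m n f"
  using assms unfolding quantum_matrices_def FactRing_def qmat_class_def
  by (auto simp: A_RCOSETS_def' a_r_coset_def')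

lemma qmat_class_simps:
  fixes q :: "'k::field"
  assumes "f \<in> carrier (qmat_free m n)" "g \<in> carrier (qmat_free m n)"
  shows "qmat_class q m n f \<otimes>\<^bsub>quantum_matrices q m n\<^esub> qmat_class q m n g = qmat_class q m n (f * g)"
    and "qmat_class q m n f \<oplus>\<^bsub>quantum_matrices q m n\<^esub> qmat_class q m n g = qmat_class q m n (f + g)"
    and "qmat_class q m n f = qmat_class q m n g \<longleftrightarrow> f - g \<in> qmat_ideal q m n"
proof -
  interpret ideal "qmat_ideal q m n" "qmat_free m n :: ((nat \<times> nat) fword \<Rightarrow>\<^sub>0 'k) ring" by (rule qmat_ideal)
  show "qmat_class q m n f \<otimes>\<^bsub>quantum_matrices q m n\<^esub> qmat_class q m n g = qmat_class q m n (f * g)"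
    using rcoset_mult_add[OF assms] by (simp add: qmat_class_def quantum_matrices_def FactRing_def)
  show "qmat_class q m n f \<oplus>\<^bsub>quantum_matrices q m n\<^esub> qmat_class q m n g = qmat_class q m n (f + g)"
    using a_rcos_sum[OF assms] by (simp add: qmat_class_def quantum_matrices_def FactRing_def)
  have inv: "\<ominus>\<^bsub>qmat_free m n\<^esub> g = - g"
    by (rule add.inv_equality) (use assms in \<open>simp_all add: free_algebra_closed\<close>)
  show "qmat_class q m n f = qmat_class q m n g \<longleftrightarrow> f - g \<in> qmat_ideal q m n"
    using quotient_eq_iff_same_a_r_cos[OF qmat_ideal assms, of q]
    unfolding qmat_class_def a_minus_def inv by simp
qed

lemma qmat_class_one_zero:
  "qmat_class q m n 1 = \<one>\<^bsub>quantum_matrices q m n\<^esub>" "qmat_class q m n 0 = \<zero>\<^bsub>quantum_matrices q m n\<^esub>"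
proof -
  interpret ideal "qmat_ideal q m n" "qmat_free m n" by (rule qmat_ideal)
  show "qmat_class q m n 1 = \<one>\<^bsub>quantum_matrices q m n\<^esub>"
    by (simp add: qmat_class_def quantum_matrices_def FactRing_def)
  show "qmat_class q m n 0 = \<zero>\<^bsub>quantum_matrices q m n\<^esub>"
    using a_coset_add_zero[OF a_subset] by (simp add: qmat_class_def quantum_matrices_def FactRing_def)
qed

lemma ring_quantum_matrices: "ring (quantum_matrices q m n)"
  unfolding quantum_matrices_def by (rule ideal.quotient_is_ring[OF qmat_ideal])

lemma free_algebra_prod_list:
  "(\<And>p. p \<in> set ps \<Longrightarrow> p \<in> carrier (free_algebra S)) \<Longrightarrow> prod_list ps \<in> carrier (free_algebra S)"
  by (induction ps) (simp_all add: free_algebra_closed)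

lemma free_algebra_sum:
  "(\<And>a. a \<in> A \<Longrightarrow> f a \<in> carrier (free_algebra S)) \<Longrightarrow> sum f A \<in> carrier (free_algebra S)"
  by (induction A rule: infinite_finite_induct) (simp_all add: free_algebra_closed)

lemma fa_minor_carrier:
  assumes J: "J \<in> minor_indices m n"
  shows "fa_minor q m J \<in> carrier (qmat_free m n)"
  unfolding fa_minor_def
proof (intro free_algebra_sum free_algebra_closed(2) free_algebra_closed(5) free_algebra_prod_list)
  fix \<sigma> and p :: "(nat \<times> nat) fword \<Rightarrow>\<^sub>0 'a"
  assume \<sigma>: "\<sigma> \<in> {\<sigma>. \<sigma> permutes {1..m}}" and "p \<in> set (map (\<lambda>i. fa_gen (i, elem_at J (\<sigma> i))) [1..<m + 1])"
  then obtain i where i: "p = fa_gen (i, elem_at J (\<sigma> i))" "i \<in> {1..m}" by auto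
  then have "\<sigma> i \<in> {1..m}" using permutes_in_image[of \<sigma> "{1..m}" i] \<sigma> by simp
  then have "elem_at J (\<sigma> i) \<in> {1..n}"
    using elem_at_in[OF J, of "\<sigma> i"] minor_indicesD(3)[OF J] by auto
  with i show "p \<in> carrier (qmat_free m n)" by (auto intro!: free_algebra_closed(8))
qed

lemma op_leads_unique:
  fixes T :: "('e::monoid_add, 'k::field) linop"
  assumes "op_leads w T v" "op_leads w T v'"
  shows "v = v'"
proof -
  define f :: "'e \<Rightarrow> 'k" where "f = (\<lambda>u. if u = 0 then 1 else 0)"
  have "leads w f 0" by (simp add: leads_def f_def)
  with assms have "leads w (apply_op T f) (0 + v)" "leads w (apply_op T f) (0 + v')"
    unfolding op_leads_def by blast+
  then show ?thesis unfolding leads_def by (metis add_0 less_asym)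
qed

lemma mset_diag_word_inj:
  assumes A: "A \<in> minor_indices m n" and B: "B \<in> minor_indices m n" 
    and "mset (diag_word m A) = mset (diag_word m B)"
  shows "A = B"
proof -
  have "set (map snd (diag_word m J)) = J" if "J \<in> minor_indices m n" for J
    unfolding diag_word_def using minor_indicesD[OF that] by (simp del: upt_Suc)
  with A B assms(3) show ?thesis by (metis mset_eq_setD mset_map)
qed

text \<open>Distinct index sets have distinct diagonal words and hence distinct leading exponents.
  This transfers statements about paths of minors, which are cosets, to index sets.\<close>

lemma qminor_inj:
  assumes q: "q \<noteq> 0" and mn: "m \<le> n"
  shows "inj_on (qminor q m n) (minor_indices m n)"
proof (rule inj_onI)
  fix A B assume A: "A \<in> minor_indices m n" and B: "B \<in> minor_indices m n"
    and "qminor q m n A = qminor q m n B"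
  then have "fa_minor q m A - fa_minor q m B \<in> qmat_ideal q m n"
    unfolding qminor_eq by (simp only: qmat_class_simps(3) fa_minor_carrier)
  from fa_eval_qmat_ideal[OF quantum_matrix_net_final[OF q mn] this]
  have eq: "qdet (scalar_op q) (net q m (m + n)) [1..<m+1] A = qdet (scalar_op q) (net q m (m + n)) [1..<m+1] B"
    by (simp only: fa_eval_diff fa_eval_minor[OF A] fa_eval_minor[OF B] right_minus_eq)
  have "word_vec m n (diag_word m A) = word_vec m n (diag_word m B)"
    using qdet_net_leads[OF q mn A] qdet_net_leads[OF q mn B] unfolding eq by (rule op_leads_unique)
  then show "A = B"
    using word_vec_inj set_diag_word A B mn mset_diag_word_inj by metis
qed

section \<open>The componentwise order on index sets and its rank\<close>

definition index_le :: "nat \<Rightarrow> nat set \<Rightarrow> nat set \<Rightarrow> bool" where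
  "index_le m A B \<longleftrightarrow> (\<forall>i\<in>{1..m}. elem_at A i \<le> elem_at B i)"

text \<open>The rank function of the order: a cover raises this sum by exactly one, which is why all
  saturated chains between two index sets are equally long.\<close>

definition index_rank :: "nat \<Rightarrow> nat set \<Rightarrow> nat" where
  "index_rank m A = (\<Sum>i=1..m. elem_at A i)"

lemma minor_indices_eqI:
  assumes A: "A \<in> minor_indices m n" and B: "B \<in> minor_indices m n"
    and "\<And>i. i \<in> {1..m} \<Longrightarrow> elem_at A i = elem_at B i"
  shows "A = B"
proof -
  have "sorted_list_of_set A = sorted_list_of_set B"
    unfolding map_elem_at[OF A, symmetric] map_elem_at[OF B, symmetric]
    by (intro map_cong refl assms(3)) auto
  then show ?thesis using minor_indicesD(1) A B by (metis set_sorted_list_of_set)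
qed

lemma ex_minor_index:
  assumes f: "\<And>i. i \<in> {1..m} \<Longrightarrow> f i \<in> {1..n}" "\<And>i j. i \<in> {1..m} \<Longrightarrow> j \<in> {1..m} \<Longrightarrow> i < j \<Longrightarrow> f i < f j"
  shows "f ` {1..m} \<in> minor_indices m n" "i \<in> {1..m} \<Longrightarrow> elem_at (f ` {1..m}) i = f i"
proof -
  have inj: "inj_on f {1..m}" by (rule inj_onI) (metis f(2) linorder_neqE_nat less_irrefl)
  then show mi: "f ` {1..m} \<in> minor_indices m n" using f(1) by (auto simp: minor_indices_def card_image)
  have "sorted (map f [1..<m+1])"
    using f(2) by (fastforce simp: sorted_iff_nth_mono_less simp del: upt_Suc intro: less_imp_le)
  then have "sorted_list_of_set (f ` {1..m}) = map f [1..<m+1]"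
    using inj by (intro sorted_distinct_set_unique)
      (auto simp: distinct_map atLeastLessThanSuc_atLeastAtMost simp del: upt_Suc)
  then show "elem_at (f ` {1..m}) i = f i" if "i \<in> {1..m}" for i
    using that by (auto simp: elem_at_def simp del: upt_Suc)
qed

lemma index_rank_less:
  assumes A: "A \<in> minor_indices m n" and B: "B \<in> minor_indices m n" 
    and "index_le m A B" "A \<noteq> B"
  shows "index_rank m A < index_rank m B"
proof -
  obtain i where i: "i \<in> {1..m}" "elem_at A i \<noteq> elem_at B i"
    using minor_indices_eqI[OF A B] assms(4) by blast
  with assms(3) have "elem_at A i < elem_at B i" by (force simp: index_le_def)
  with i assms(3) show ?thesis
    unfolding index_rank_def index_le_def by (intro sum_strict_mono_ex1) auto
qed

text \<open>The last entry of \<open>A\<close> that is still below its counterpart in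
  \<open>B\<close> can be raised by one. All later entries already agree with those of
  \<open>B\<close>, so they leave room for it.\<close>

lemma ex_index_between:
  assumes A: "A \<in> minor_indices m n" and B: "B \<in> minor_indices m n" 
    and le: "index_le m A B" and "A \<noteq> B"
  shows "\<exists>C \<in> minor_indices m n. index_le m A C \<and> index_le m C B \<and> index_rank m C = Suc (index_rank m A)"
proof -
  define S where "S = {i \<in> {1..m}. elem_at A i < elem_at B i}"
  have "S \<noteq> {}"
    using minor_indices_eqI[OF A B] le \<open>A \<noteq> B\<close> by (force simp: S_def index_le_def)
  then have i: "Max S \<in> S" by (intro Max_in) (simp_all add: S_def)
  define i where "i = Max S"
  have iS: "i \<in> {1..m}" "elem_at A i < elem_at B i" using i by (auto simp: S_def i_def)
  have eq: "elem_at A k = elem_at B k" if "k \<in> {1..m}" "i < k" for k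
  proof (rule ccontr)
    assume "elem_at A k \<noteq> elem_at B k"
    moreover have "elem_at A k \<le> elem_at B k" using that(1) le by (simp add: index_le_def)
    ultimately have "k \<in> S" using that(1) by (simp add: S_def)
    then have "k \<le> i" unfolding i_def by (intro Max_ge) (simp_all add: S_def)
    with that show False by simp
  qed
  define f where "f = (elem_at A)(i := Suc (elem_at A i))"
  have bound: "f k \<le> elem_at B k" "elem_at A k \<le> f k" if "k \<in> {1..m}" for k
    using that le iS by (auto simp: f_def index_le_def)
  have mono: "f k < f l" if "k \<in> {1..m}" "l \<in> {1..m}" "k < l" for k l
  proof (cases "k = i")
    case True
    have "f k \<le> elem_at B k" by (rule bound(1)[OF that(1)])
    moreover have "f l = elem_at B l" using eq[of l] that True by (simp add: f_def)
    moreover have "elem_at B k < elem_at B l" using elem_at_less_iff[OF B, of k l] that by auto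
    ultimately show ?thesis by simp
  next
    case False
    then have "f k = elem_at A k" by (simp add: f_def)
    also have "\<dots> < elem_at A l" using elem_at_less_iff[OF A, of k l] that by auto
    also have "\<dots> \<le> f l" using bound that by simp
    finally show ?thesis .
  qed
  have range: "f k \<in> {1..n}" if "k \<in> {1..m}" for k
    using bound[OF that] elem_at_in[OF A, of k] elem_at_in[OF B, of k] that
      minor_indicesD(3)[OF A] minor_indicesD(3)[OF B] by fastforce
  note C = ex_minor_index[of m f n, OF range mono]
  have "index_rank m (f ` {1..m}) = (\<Sum>k=1..m. f k)"
    unfolding index_rank_def by (intro sum.cong refl C(2))
  also have "\<dots> = f i + (\<Sum>k\<in>{1..m} - {i}. f k)" using iS by (subst sum.remove[of _ i]) auto
  also have "\<dots> = Suc (elem_at A i + (\<Sum>k\<in>{1..m} - {i}. elem_at A k))"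
    by (simp add: f_def)
  also have "\<dots> = Suc (index_rank m A)" unfolding index_rank_def using iS by (subst (2) sum.remove[of _ i]) auto
  finally show ?thesis using C bound by (intro bexI[of _ "f ` {1..m}"]) (auto simp: index_le_def)
qed

lemma ex_index_chain:
  assumes "A \<in> minor_indices m n" "B \<in> minor_indices m n" "index_le m A B"
  shows "\<exists>ps. ps \<noteq> [] \<and> set ps \<subseteq> minor_indices m n \<and> hd ps = A \<and> last ps = B \<and>
     (\<forall>i. Suc i < length ps \<longrightarrow> index_le m (ps ! i) (ps ! Suc i) \<and> index_rank m (ps ! Suc i) = Suc (index_rank m (ps ! i)))"
  using assms(1,3)
proof (induction "index_rank m B - index_rank m A" arbitrary: A rule: less_induct)
  case less
  show ?case
  proof (cases "A = B")
    case True
    then show ?thesis using less.prems by (intro exI[of _ "[A]"]) auto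
  next
    case False
    obtain C where C: "C \<in> minor_indices m n" "index_le m A C" "index_le m C B" "index_rank m C = Suc (index_rank m A)"
      using ex_index_between[OF less.prems(1) assms(2) less.prems(2) False] by blast
    have "index_rank m B - index_rank m C < index_rank m B - index_rank m A"
      using C(4) index_rank_less[OF less.prems(1) assms(2) less.prems(2) False] by simp
    from less.hyps[OF this C(1,3)] obtain ps where ps: "ps \<noteq> []" "set ps \<subseteq> minor_indices m n" "hd ps = C" "last ps = B"
      "\<And>i. Suc i < length ps \<Longrightarrow> index_le m (ps ! i) (ps ! Suc i) \<and> index_rank m (ps ! Suc i) = Suc (index_rank m (ps ! i))"
      by blast
    have "index_le m ((A # ps) ! i) ((A # ps) ! Suc i) \<and> index_rank m ((A # ps) ! Suc i) = Suc (index_rank m ((A # ps) ! i))"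
      if "Suc i < length (A # ps)" for i
    proof (cases i)
      case 0
      then show ?thesis using C ps(1,3) by (simp add: hd_conv_nth)
    next
      case (Suc j)
      then show ?thesis using ps(5)[of j] that by simp
    qed
    then show ?thesis using ps less.prems by (intro exI[of _ "A # ps"]) auto
  qed
qed

lemma elem_at_interval:
  assumes "a + m \<le> n"
  shows "{a + 1..a + m} \<in> minor_indices m n" "i \<in> {1..m} \<Longrightarrow> elem_at {a + 1..a + m} i = a + i"
proof -
  have img: "(\<lambda>i. a + i) ` {1..m} = {a + 1..a + m}" by (simp add: image_add_atLeastAtMost add.commute)
  have "a + i \<in> {1..n}" if "i \<in> {1..m}" for i using that assms by auto
  from ex_minor_index[of m "\<lambda>i. a + i" n, OF this]
  show "{a + 1..a + m} \<in> minor_indices m n" "i \<in> {1..m} \<Longrightarrow> elem_at {a + 1..a + m} i = a + i"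
    unfolding img by auto
qed

lemma index_rank_chain:
  assumes "\<And>i. Suc i < length ps \<Longrightarrow> index_rank m (ps ! Suc i) = Suc (index_rank m (ps ! i))" "i < length ps"
  shows "index_rank m (ps ! i) = index_rank m (ps ! 0) + i"
  using assms(2) by (induction i) (use assms(1) in auto)

section \<open>The quantum grassmannian as an algebra of operators\<close>

lemma scalar_op_eq_0_iff: "(scalar_op c :: ('i, 'k::field) linop) = 0 \<longleftrightarrow> c = 0"
proof
  assume 0: "(scalar_op c :: ('i, 'k) linop) = 0"
  show "c = 0"
  proof (rule ccontr)
    assume "c \<noteq> 0"
    then have "(scalar_op (inverse c) :: ('i, 'k) linop) * scalar_op c = 1"
      by (simp add: scalar_op_mult[symmetric])
    with 0 show False by simp
  qed
qed simp

locale quantum_grassmannian_setting =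
  fixes q :: "'k::field" and m n :: nat
  assumes q: "q \<noteq> 0" and m: "1 \<le> m" and mn: "m \<le> n"
begin

abbreviation "MQ \<equiv> quantum_matrices q m n"
abbreviation "GQ \<equiv> quantum_grassmannian q m n"
abbreviation "SC \<equiv> qmat_scalars q m n"
abbreviation "cls \<equiv> qmat_class q m n"
abbreviation "FA \<equiv> qmat_free m n :: ((nat \<times> nat) fword \<Rightarrow>\<^sub>0 'k) ring"
abbreviation "X \<equiv> net q m (m + n)"

sublocale MQ: ring MQ by (rule ring_quantum_matrices)

lemma scalars_closed: "SC \<subseteq> carrier MQ"
  unfolding qmat_scalars_def by (auto intro!: qmat_class_carrier free_algebra_closed)

lemma qminors_closed: "qminors q m n \<subseteq> carrier MQ"
  unfolding qminors_def qminor_eq by (auto intro!: qmat_class_carrier fa_minor_carrier)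

lemma GQ_simps [simp]:
  "mult GQ = mult MQ" "add GQ = add MQ" "one GQ = one MQ" "zero GQ = zero MQ"
  "carrier GQ = generate_ring MQ (SC \<union> qminors q m n)"
  by (simp_all add: quantum_grassmannian_def)

lemma subring_GQ: "subring (carrier GQ) MQ"
  using scalars_closed qminors_closed by (simp add: MQ.generate_ring_is_subring)

lemma ring_GQ: "ring GQ"
  unfolding quantum_grassmannian_def
  using scalars_closed qminors_closed by (intro MQ.generate_ring_is_ring) auto

lemma GQ_subset: "carrier GQ \<subseteq> carrier MQ"
  using subringE(1)[OF subring_GQ] .

lemma cls_simps:
  assumes "f \<in> carrier FA" "g \<in> carrier FA"
  shows "cls f \<otimes>\<^bsub>MQ\<^esub> cls g = cls (f * g)" "cls f \<oplus>\<^bsub>MQ\<^esub> cls g = cls (f + g)"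
  using qmat_class_simps[OF assms, of q] by auto

definition \<psi> :: "((nat \<times> nat) fword \<Rightarrow>\<^sub>0 'k) set \<Rightarrow> (nat \<times> nat \<Rightarrow> nat, 'k) linop" where
  "\<psi> a = fa_eval (case_prod X) (SOME f. f \<in> carrier FA \<and> a = cls f)"

lemma psi_cls:
  assumes f: "f \<in> carrier FA"
  shows "\<psi> (cls f) = fa_eval (case_prod X) f"
proof -
  define g where "g = (SOME g. g \<in> carrier FA \<and> cls f = cls g)"
  have g: "g \<in> carrier FA \<and> cls f = cls g"
    unfolding g_def by (rule someI[of _ f]) (use f in simp)
  then have "f - g \<in> qmat_ideal q m n" using qmat_class_simps(3)[OF f] by blast
  from fa_eval_qmat_ideal[OF quantum_matrix_net_final[OF q mn] this]
  show ?thesis unfolding \<psi>_def g_def[symmetric] by (simp only: fa_eval_diff right_minus_eq)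
qed

lemma psi_simps:
  assumes "a \<in> carrier MQ" "b \<in> carrier MQ"
  shows "\<psi> (a \<otimes>\<^bsub>MQ\<^esub> b) = \<psi> a * \<psi> b" "\<psi> (a \<oplus>\<^bsub>MQ\<^esub> b) = \<psi> a + \<psi> b"
proof -
  obtain f where f: "f \<in> carrier FA" "a = cls f" using quantum_matrices_carrierE[OF assms(1)] .
  obtain g where g: "g \<in> carrier FA" "b = cls g" using quantum_matrices_carrierE[OF assms(2)] .
  show "\<psi> (a \<otimes>\<^bsub>MQ\<^esub> b) = \<psi> a * \<psi> b" "\<psi> (a \<oplus>\<^bsub>MQ\<^esub> b) = \<psi> a + \<psi> b"
    unfolding f(2) g(2) cls_simps[OF f(1) g(1)]
    using f(1) g(1) by (simp_all only: psi_cls free_algebra_closed fa_eval_mult fa_eval_add)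
qed

lemma psi_inj: "inj_on \<psi> (carrier MQ)"
proof (rule inj_onI)
  fix a b assume "a \<in> carrier MQ" "b \<in> carrier MQ" and eq: "\<psi> a = \<psi> b"
  then obtain f g where f: "f \<in> carrier FA" "a = cls f" and g: "g \<in> carrier FA" "b = cls g"
    by (metis quantum_matrices_carrierE)
  have "fa_eval (case_prod X) (f - g) = 0"
    using eq unfolding f(2) g(2) psi_cls[OF f(1)] psi_cls[OF g(1)] by (simp only: fa_eval_diff right_minus_eq)
  then have "f - g \<in> qmat_ideal q m n"
    using f g by (intro fa_eval_net_eq_0[OF q mn] free_algebra_closed)
  then show "a = b" unfolding f(2) g(2) using qmat_class_simps(3)[OF f(1) g(1)] by blast
qed

lemma psi_scalar: "\<psi> (cls (fa_const c)) = scalar_op c"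
  by (simp only: psi_cls free_algebra_closed fa_eval_const)

lemma psi_zero: "\<psi> \<zero>\<^bsub>MQ\<^esub> = 0"
  unfolding qmat_class_one_zero(2)[symmetric] by (simp only: psi_cls free_algebra_closed fa_eval_0)

lemma scalar_simps:
  "cls (fa_const a) \<otimes>\<^bsub>MQ\<^esub> cls (fa_const b) = cls (fa_const (a * b))"
  "cls (fa_const a) \<oplus>\<^bsub>MQ\<^esub> cls (fa_const b) = cls (fa_const (a + b))"
  "cls (fa_const 1) = \<one>\<^bsub>MQ\<^esub>" "cls (fa_const 0) = \<zero>\<^bsub>MQ\<^esub>"
  by (simp_all only: cls_simps free_algebra_closed fa_const_mult fa_const_add fa_const_0 fa_const_1 qmat_class_one_zero)

text \<open>The presentation alone does not exclude that the quotient collapses to 0. The operators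
  do exclude it, and this makes \<open>SC\<close> a subfield.\<close>

lemma scalar_eq_0_iff: "cls (fa_const c) = \<zero>\<^bsub>MQ\<^esub> \<longleftrightarrow> c = 0"
  using psi_scalar[of c] psi_zero by (auto simp: scalar_simps scalar_op_eq_0_iff)

lemma scalar_central:
  assumes "k \<in> SC" "a \<in> carrier MQ"
  shows "k \<otimes>\<^bsub>MQ\<^esub> a = a \<otimes>\<^bsub>MQ\<^esub> k"
proof -
  obtain c where c: "k = cls (fa_const c)" using assms(1) by (auto simp: qmat_scalars_def)
  obtain f where f: "f \<in> carrier FA" "a = cls f" using quantum_matrices_carrierE[OF assms(2)] .
  show ?thesis unfolding c f(2) cls_simps[OF f(1) free_algebra_closed(5)] cls_simps[OF free_algebra_closed(5) f(1)]
    by (simp only: fa_const_central)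
qed

lemma scalars_subset_GQ: "SC \<subseteq> carrier GQ"
  by (auto intro: generate_ring.incl)

lemma qminors_subset_GQ: "qminors q m n \<subseteq> carrier GQ"
  by (auto intro: generate_ring.incl)

lemma subfield_scalars: "subfield SC GQ"
proof -
  interpret GQ: ring GQ by (rule ring_GQ)
  have neg: "\<ominus>\<^bsub>GQ\<^esub> h \<in> SC" if h: "h \<in> SC" for h
  proof -
    obtain c where c: "h = cls (fa_const c)" using h by (auto simp: qmat_scalars_def)
    have c': "cls (fa_const (- c)) \<in> SC" by (auto simp: qmat_scalars_def)
    have "cls (fa_const (- c)) \<oplus>\<^bsub>GQ\<^esub> h = \<zero>\<^bsub>GQ\<^esub>" by (simp add: c scalar_simps)
    then have "\<ominus>\<^bsub>GQ\<^esub> h = cls (fa_const (- c))"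
      using h c' scalars_subset_GQ by (intro GQ.minus_equality) auto
    with c' show ?thesis by simp
  qed
  have "subring SC GQ"
  proof (rule GQ.subringI)
    show "SC \<subseteq> carrier GQ" by (rule scalars_subset_GQ)
    show "\<one>\<^bsub>GQ\<^esub> \<in> SC" by (auto simp: qmat_scalars_def scalar_simps(3)[symmetric])
  qed (use neg in \<open>auto simp: qmat_scalars_def scalar_simps\<close>)
  then have "subcring SC GQ"
    by (rule GQ.subcringI) (use scalar_central scalars_closed in auto)
  moreover have "Units (GQ\<lparr>carrier := SC\<rparr>) = SC - {\<zero>\<^bsub>GQ\<^esub>}"
  proof (intro equalityI subsetI)
    fix x assume "x \<in> Units (GQ\<lparr>carrier := SC\<rparr>)"
    then obtain y where x: "x \<in> SC" and y: "y \<in> SC" "x \<otimes>\<^bsub>MQ\<^esub> y = \<one>\<^bsub>MQ\<^esub>" by (auto simp: Units_def)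
    moreover have "x \<noteq> \<zero>\<^bsub>MQ\<^esub>"
    proof
      assume "x = \<zero>\<^bsub>MQ\<^esub>"
      then have "\<one>\<^bsub>MQ\<^esub> = \<zero>\<^bsub>MQ\<^esub>" using y scalars_closed by auto
      then show False using scalar_eq_0_iff[of 1] scalar_simps(3) by simp
    qed
    ultimately show "x \<in> SC - {\<zero>\<^bsub>GQ\<^esub>}" by simp
  next
    fix x assume x: "x \<in> SC - {\<zero>\<^bsub>GQ\<^esub>}"
    then obtain c where c: "x = cls (fa_const c)" "c \<noteq> 0"
      using scalar_simps(4) by (auto simp: qmat_scalars_def)
    then have "x \<otimes>\<^bsub>MQ\<^esub> cls (fa_const (inverse c)) = \<one>\<^bsub>MQ\<^esub>" "cls (fa_const (inverse c)) \<otimes>\<^bsub>MQ\<^esub> x = \<one>\<^bsub>MQ\<^esub>"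
      by (simp_all only: c scalar_simps left_inverse right_inverse not_False_eq_True)
    moreover have "cls (fa_const (inverse c)) \<in> SC" by (auto simp: qmat_scalars_def)
    ultimately show "x \<in> Units (GQ\<lparr>carrier := SC\<rparr>)" using x by (auto simp: Units_def)
  qed
  ultimately show ?thesis by (rule GQ.subfieldI)
qed

sublocale GQ: central_algebra GQ SC
proof (intro central_algebra.intro ring_GQ central_algebra_axioms.intro subfield_scalars)
  fix k a assume k: "k \<in> SC" and a: "a \<in> carrier GQ"
  show "k \<otimes>\<^bsub>GQ\<^esub> a = a \<otimes>\<^bsub>GQ\<^esub> k"
    unfolding GQ_simps(1) by (rule scalar_central[OF k subsetD[OF GQ_subset a]])
qed

lemma finite_minor_indices: "finite (minor_indices m n)"
  by (rule finite_subset[of _ "Pow {1..n}"]) (auto simp: minor_indices_def)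

text \<open>The linear span of the minors. It is described by minimality so that a property closed
  under linear combinations has to be checked on the minors only.\<close>

lemma ex_minor_span:
  obtains W where "fin_dim_generating_subspace GQ SC W" "qminors q m n \<subseteq> W"
    "\<And>E. subalgebra SC E GQ \<Longrightarrow> qminors q m n \<subseteq> E \<Longrightarrow> W \<subseteq> E"
proof -
  have "finite (qminors q m n)" unfolding qminors_def by (rule finite_imageI[OF finite_minor_indices])
  then obtain Us where Us: "set Us = qminors q m n" using finite_list by blast
  then have Us_G: "set Us \<subseteq> carrier GQ" using qminors_subset_GQ by simp
  define W where "W = GQ.Span SC Us"
  have base: "set Us \<subseteq> W" unfolding W_def by (rule GQ.Span_base_incl[OF subfield_scalars Us_G])
  have W: "W \<subseteq> carrier GQ" unfolding W_def by (rule GQ.Span_subgroup_props(1)[OF subfield_scalars Us_G])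
  have "generate_ring GQ (SC \<union> W) = carrier GQ"
  proof
    show "generate_ring GQ (SC \<union> W) \<subseteq> carrier GQ"
      using W scalars_subset_GQ by (intro GQ.generate_ring_incl) auto
    have "carrier GQ = generate_ring GQ (SC \<union> qminors q m n)"
      using MQ.subring_gen_equality[OF subring_GQ, of "SC \<union> qminors q m n"] scalars_subset_GQ qminors_subset_GQ
      by (simp add: quantum_grassmannian_def)
    also have "\<dots> \<subseteq> generate_ring GQ (SC \<union> W)"
      using W base Us scalars_subset_GQ by (intro GQ.mono_generate_ring) auto
    finally show "carrier GQ \<subseteq> generate_ring GQ (SC \<union> W)" .
  qed
  then have "fin_dim_generating_subspace GQ SC W"
    unfolding fin_dim_generating_subspace_def
    using GQ.Span_is_subalgebra[OF subfield_scalars Us_G] GQ.Span_finite_dimension[OF subfield_scalars Us_G] W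
    by (simp add: W_def)
  moreover have "W \<subseteq> E" if "subalgebra SC E GQ" "qminors q m n \<subseteq> E" for E
    unfolding W_def by (rule GQ.subalgebra_Span_incl[OF subfield_scalars that(1)]) (use that Us in simp)
  ultimately show thesis using that base Us by blast
qed

lemma psi_preimage_subspace:
  assumes "linop.subspace S"
  shows "subalgebra SC {a \<in> carrier GQ. \<psi> a \<in> S} GQ"
proof (rule GQ.subspaceI)
  have mem: "a \<in> carrier MQ" if "a \<in> carrier GQ" for a using GQ_subset that by blast
  show "\<zero>\<^bsub>GQ\<^esub> \<in> {a \<in> carrier GQ. \<psi> a \<in> S}"
    using linop.subspace_0[OF assms] psi_zero GQ.zero_closed by auto
  show "x \<oplus>\<^bsub>GQ\<^esub> y \<in> {a \<in> carrier GQ. \<psi> a \<in> S}" if "x \<in> {a \<in> carrier GQ. \<psi> a \<in> S}" "y \<in> {a \<in> carrier GQ. \<psi> a \<in> S}" for x y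
    using that linop.subspace_add[OF assms] GQ.add.m_closed[of x y] psi_simps(2)[of x y] mem by auto
  show "k \<otimes>\<^bsub>GQ\<^esub> x \<in> {a \<in> carrier GQ. \<psi> a \<in> S}" if k: "k \<in> SC" and x: "x \<in> {a \<in> carrier GQ. \<psi> a \<in> S}" for k x
  proof -
    obtain c where c: "k = cls (fa_const c)" using k by (auto simp: qmat_scalars_def)
    have "\<psi> (k \<otimes>\<^bsub>MQ\<^esub> x) = scalar_op c * \<psi> x"
      using psi_simps(1)[of k x] psi_scalar[of c] k x scalars_closed mem c by auto
    then show ?thesis
      using linop.subspace_scale[OF assms, of "\<psi> x" c] x GQ.m_closed[of k x] scalars_subset_GQ k by auto
  qed
qed auto

lemma psi_Span:
  assumes "set Us \<subseteq> carrier GQ" "a \<in> GQ.Span SC Us"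
  shows "\<psi> a \<in> linop.span (\<psi> ` set Us)"
proof -
  have "GQ.Span SC Us \<subseteq> {a \<in> carrier GQ. \<psi> a \<in> linop.span (\<psi> ` set Us)}"
    using assms(1) by (intro GQ.subalgebra_Span_incl[OF subfield_scalars psi_preimage_subspace])
      (auto intro: linop.span_base)
  with assms(2) show ?thesis by blast
qed

text \<open>Independence is carried from lists over the subfield \<open>SC\<close> to sets in the
  vector space of operators; injectivity of \<open>\<psi>\<close> keeps distinct list entries
  distinct.\<close>

lemma psi_independent:
  assumes "GQ.independent SC Us"
  shows "linop.independent (\<psi> ` set Us) \<and> card (\<psi> ` set Us) = length Us"
  using assms
proof (induction Us rule: list.induct)
  case (Cons u Us)
  note ind = GQ.independent_backwards[OF Cons.prems]
  have Us: "set Us \<subseteq> carrier GQ" by (rule GQ.independent_in_carrier[OF ind(2)])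
  have "\<psi> u \<notin> linop.span (\<psi> ` set Us)"
  proof
    assume u: "\<psi> u \<in> linop.span (\<psi> ` set Us)"
    \<comment> \<open>The image of the span is a subspace and so contains the span of the images; a
      linear relation between operators thereby lifts to the algebra.\<close>
    have "linop.subspace (\<psi> ` GQ.Span SC Us)"
    proof (rule linop.subspaceI)
      note props = GQ.Span_subgroup_props[OF subfield_scalars Us] 
      have mem: "a \<in> carrier MQ" if "a \<in> GQ.Span SC Us" for a using GQ_subset props(1) that by blast
      show "0 \<in> \<psi> ` GQ.Span SC Us" using props(2) psi_zero by (force intro: image_eqI)
      show "x + y \<in> \<psi> ` GQ.Span SC Us" if xy: "x \<in> \<psi> ` GQ.Span SC Us" "y \<in> \<psi> ` GQ.Span SC Us" for x y
      proof -
        obtain a b where ab: "a \<in> GQ.Span SC Us" "b \<in> GQ.Span SC Us" "x = \<psi> a" "y = \<psi> b" using xy by blast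
        then show ?thesis using props(3)[OF ab(1,2)] psi_simps(2)[OF mem mem, OF ab(1,2)] by (metis GQ_simps(2) image_eqI)
      qed
      show "scalar_op c * x \<in> \<psi> ` GQ.Span SC Us" if x: "x \<in> \<psi> ` GQ.Span SC Us" for c x
      proof -
        obtain a where a: "a \<in> GQ.Span SC Us" "x = \<psi> a" using x by blast
        have k: "cls (fa_const c) \<in> SC" by (auto simp: qmat_scalars_def)
        have "\<psi> (cls (fa_const c) \<otimes>\<^bsub>MQ\<^esub> a) = scalar_op c * x"
          using psi_simps(1)[OF _ mem, of "cls (fa_const c)" a] k scalars_closed a psi_scalar by auto
        then show ?thesis
          using GQ.Span_smult_closed[OF subfield_scalars Us k a(1)] by (metis GQ_simps(1) image_eqI)
      qed
    qed
    then have "linop.span (\<psi> ` set Us) \<subseteq> \<psi> ` GQ.Span SC Us"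
      using GQ.Span_base_incl[OF subfield_scalars Us] by (intro linop.span_minimal image_mono)
    with u obtain a where a: "a \<in> GQ.Span SC Us" "\<psi> u = \<psi> a" by blast
    have "a \<in> carrier GQ" using GQ.Span_subgroup_props(1)[OF subfield_scalars Us] a(1) by blast
    then have "u = a" using inj_onD[OF psi_inj a(2)] ind(3) GQ_subset by blast
    with a ind(1) show False by simp
  qed
  moreover from this have "\<psi> u \<notin> \<psi> ` set Us" using linop.span_base by blast
  ultimately show ?case
    using Cons.IH[OF ind(2)] by (simp add: linop.independent_insert)
qed (simp add: linop.independent_empty)

end

section \<open>The upper bound\<close>

lemma commute_prod_list:
  fixes T :: "'r::monoid_mult"
  shows "(\<And>x. x \<in> set xs \<Longrightarrow> T * f x = f x * T) \<Longrightarrow> T * prod_list (map f xs) = prod_list (map f xs) * T"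
proof (induction xs)
  case (Cons x xs)
  have "T * prod_list (map f (x # xs)) = T * f x * prod_list (map f xs)" by (simp add: mult.assoc)
  also have "\<dots> = f x * (T * prod_list (map f xs))" using Cons.prems[of x] by (simp add: mult.assoc)
  also have "\<dots> = prod_list (map f (x # xs)) * T" using Cons by (simp add: mult.assoc)
  finally show ?case .
qed simp

lemma qdet_cong:
  assumes "\<And>i j. j \<in> J \<Longrightarrow> X i j = Y i j"
  shows "qdet Q X ks J = qdet Q Y ks J"
proof -
  have "map2 X ks cs = map2 Y ks cs" if "cs \<in> permutations_of_set J" for cs
    using that assms by (intro map_cong refl) (auto simp: permutations_of_set_def dest: set_zip_rightD)
  then show ?thesis unfolding qdet_def by (intro sum.cong refl) metis
qed

lemma qdet_commute:
  fixes T :: "'r::ring_1"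
  assumes "\<And>i j. T * Z i j = Z i j * T" "T * Q = Q * T"
  shows "T * qdet Q Z ks J = qdet Q Z ks J * T"
proof -
  have "T * (- Q) ^ k = (- Q) ^ k * T" for k
  proof (induction k)
    case (Suc k)
    have "T * (- Q) ^ Suc k = (T * - Q) * (- Q) ^ k" by (simp add: mult.assoc)
    also have "\<dots> = - Q * (T * (- Q) ^ k)" using assms(2) by (simp add: mult.assoc[symmetric])
    finally show ?case using Suc by (simp add: mult.assoc)
  qed simp
  moreover have "T * prod_list (map2 Z ks cs) = prod_list (map2 Z ks cs) * T" for cs
    by (rule commute_prod_list) (auto simp: assms(1))
  ultimately have "T * ((- Q) ^ k * prod_list (map2 Z ks cs)) = (- Q) ^ k * prod_list (map2 Z ks cs) * T" for k cs
    by (metis mult.assoc)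
  then show ?thesis unfolding qdet_def sum_distrib_left sum_distrib_right by simp
qed

lemma prod_list_fa_gen: "prod_list (map fa_gen u) = Poly_Mapping.single (FWord u) 1"
proof (induction u)
  case Nil
  show ?case using fa_const_1 by (simp add: fa_const_def zero_fword_def)
qed (simp add: fa_gen_def mult_single plus_fword_def)

text \<open>A product of \<open>i\<close> minors uses each row exactly \<open>i\<close> times.
  Recording every row, and not just the total degree, is what removes one free multiplicity per row
  in the count of band words.\<close>

definition graded :: "nat \<Rightarrow> nat \<Rightarrow> nat \<Rightarrow> ((nat \<times> nat) fword \<Rightarrow>\<^sub>0 'k::field) set" where
  "graded m n i = {g \<in> carrier (qmat_free m n). \<forall>w\<in>Poly_Mapping.keys g.
     mset (map fst (letters w)) = repeat_mset i (mset [1..<m+1])}"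

lemma graded_closed:
  shows "g \<in> graded m n i \<Longrightarrow> h \<in> graded m n i \<Longrightarrow> g + h \<in> graded m n i"
    and "g \<in> graded m n i \<Longrightarrow> h \<in> graded m n j \<Longrightarrow> g * h \<in> graded m n (i + j)"
    and "g \<in> graded m n i \<Longrightarrow> fa_const c * g \<in> graded m n i"
    and "0 \<in> graded m n i" "fa_const c \<in> graded m n 0"
proof -
  note [simp del] = upt_Suc
  show "g \<in> graded m n i \<Longrightarrow> h \<in> graded m n i \<Longrightarrow> g + h \<in> graded m n i"
    using keys_add[of g h] unfolding graded_def by (auto simp: free_algebra_closed)
  show "g \<in> graded m n i \<Longrightarrow> h \<in> graded m n j \<Longrightarrow> g * h \<in> graded m n (i + j)"
    using keys_mult[of g h] unfolding graded_def
    by (auto simp: free_algebra_closed plus_fword_def repeat_mset_distrib dest!: subsetD)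
  show "g \<in> graded m n i \<Longrightarrow> fa_const c * g \<in> graded m n i"
    using keys_fa_const_mult[of c g] unfolding graded_def by (auto simp: free_algebra_closed)
  show "0 \<in> graded m n i" unfolding graded_def by (auto simp: free_algebra_closed)
  show "fa_const c \<in> graded m n 0"
    unfolding graded_def by (simp only: mem_Collect_eq free_algebra_closed(5))
      (auto simp: fa_const_def zero_fword_def split: if_splits)
qed

lemma fa_minor_graded:
  assumes J: "J \<in> minor_indices m n"
  shows "fa_minor q m J \<in> graded m n 1"
proof -
  note [simp del] = upt_Suc
  have "mset (map fst (letters w)) = mset [1..<m+1]" if w: "w \<in> Poly_Mapping.keys (fa_minor q m J)" for w
  proof -
    have "w \<in> (\<Union>\<sigma>\<in>{\<sigma>. \<sigma> permutes {1..m}}. Poly_Mapping.keys (fa_const ((- q) ^ perm_length m \<sigma>) *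
        prod_list (map (\<lambda>i. fa_gen (i, elem_at J (\<sigma> i))) [1..<m + 1])))"
      using w keys_sum unfolding fa_minor_def by (rule subsetD[rotated])
    then obtain \<sigma> where "w \<in> Poly_Mapping.keys (prod_list (map (\<lambda>i. fa_gen (i, elem_at J (\<sigma> i))) [1..<m + 1]) :: _ \<Rightarrow>\<^sub>0 'a)"
      using keys_fa_const_mult by blast
    also have "map (\<lambda>i. fa_gen (i, elem_at J (\<sigma> i))) [1..<m + 1] = map fa_gen (map (\<lambda>i. (i, elem_at J (\<sigma> i))) [1..<m + 1])"
      by simp
    finally show ?thesis unfolding prod_list_fa_gen by (simp add: o_def)
  qed
  then show ?thesis using fa_minor_carrier[OF J] by (auto simp: graded_def)
qed

definition band_words :: "nat \<Rightarrow> nat \<Rightarrow> nat \<Rightarrow> (nat \<times> nat) list set" where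
  "band_words m r i = {u. sorted u \<and> set u \<subseteq> {(a, b). a \<in> {1..m} \<and> a \<le> b \<and> b \<le> a + r} \<and>
     mset (map fst u) = repeat_mset i (mset [1..<m+1])}"

text \<open>A sorted word is determined by its letter multiplicities. Each row has
  \<open>r + 1\<close> places in the band and the prescribed total \<open>i\<close>, so the
  multiplicity at the last place is forced, and the remaining \<open>m * r\<close> lie between 0 and
  \<open>i\<close>.\<close>

lemma band_words_card: "finite (band_words m r i) \<and> card (band_words m r i) \<le> (i + 1) ^ (m * r)"
proof -
  note [simp del] = upt_Suc
  let ?I = "{1..m} \<times> {..<r}"
  define F where "F u = restrict (\<lambda>(a, s). count (mset u) (a, a + s)) ?I" for u :: "(nat \<times> nat) list"
  have row: "(\<Sum>s\<le>r. count (mset u) (a, a + s)) = i" if u: "u \<in> band_words m r i" and a: "a \<in> {1..m}" for u a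
  proof -
    have "(\<Sum>s\<le>r. count (mset u) (a, a + s)) = (\<Sum>x\<in>(\<lambda>s. (a, a + s)) ` {..r}. count (mset u) x)"
      by (simp add: sum.reindex inj_on_def)
    also have "\<dots> = sum (count (mset u)) (fst -` {a} \<inter> set_mset (mset u))"
    proof (rule sum.mono_neutral_right)
      show "fst -` {a} \<inter> set_mset (mset u) \<subseteq> (\<lambda>s. (a, a + s)) ` {..r}"
        using u by (fastforce simp: band_words_def image_iff le_iff_add)
    qed (auto simp: not_in_iff[symmetric])
    also have "\<dots> = count (mset (map fst u)) a" by (simp add: count_image_mset)
    also have "\<dots> = i" using u a distinct_count_atmost_1[of "[1..<m+1]"]
      by (simp add: band_words_def)
    finally show ?thesis .
  qed
  have inj: "inj_on F (band_words m r i)"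
  proof (rule inj_onI)
    fix u v assume u: "u \<in> band_words m r i" and v: "v \<in> band_words m r i" and eq: "F u = F v"
    have eq_less: "count (mset u) (a, a + s) = count (mset v) (a, a + s)" if "a \<in> {1..m}" "s < r" for a s
      using fun_cong[OF eq, of "(a, s)"] that by (simp add: F_def)
    have eq_r: "count (mset u) (a, a + r) = count (mset v) (a, a + r)" if a: "a \<in> {1..m}" for a
    proof -
      have "(\<Sum>s<r. count (mset u) (a, a + s)) = (\<Sum>s<r. count (mset v) (a, a + s))"
        using eq_less[OF a] by (intro sum.cong) auto
      with row[OF u a] row[OF v a] show ?thesis by (simp add: lessThan_Suc_atMost[symmetric])
    qed
    have "mset u = mset v"
    proof (rule multiset_eqI)
      fix x :: "nat \<times> nat"
      obtain a b where x: "x = (a, b)" by (cases x)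
      show "count (mset u) x = count (mset v) x"
      proof (cases "a \<in> {1..m} \<and> a \<le> b \<and> b \<le> a + r")
        case True
        then obtain s where "b = a + s" "s \<le> r" by (auto simp: le_iff_add)
        with True eq_less[of a s] eq_r[of a] show ?thesis unfolding x by (cases "s = r") auto
      next
        case False
        then have "x \<notin># mset u" "x \<notin># mset v" using u v unfolding x band_words_def by auto
        then show ?thesis by (simp only: not_in_iff)
      qed
    qed
    then show "u = v" using u v by (auto simp: band_words_def intro: properties_for_sort[symmetric] dest: properties_for_sort sorted_sort_id)
  qed
  have sub: "F ` band_words m r i \<subseteq> ?I \<rightarrow>\<^sub>E {..i}"
  proof (rule image_subsetI)
    fix u assume u: "u \<in> band_words m r i"
    have "count (mset u) (a, a + s) \<le> i" if "a \<in> {1..m}" "s < r" for a s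
      using member_le_sum[of s "{..r}" "\<lambda>s. count (mset u) (a, a + s)"] row[OF u that(1)] that by simp
    then show "F u \<in> ?I \<rightarrow>\<^sub>E {..i}" by (auto simp: F_def)
  qed
  have fin: "finite (?I \<rightarrow>\<^sub>E {..i})" by (intro finite_PiE) auto
  have "card (band_words m r i) \<le> card (?I \<rightarrow>\<^sub>E {..i})"
    using card_mono[OF fin sub] by (simp add: card_image[OF inj])
  also have "\<dots> = (i + 1) ^ (m * r)" by (simp add: card_PiE)
  finally show ?thesis using finite_imageD[OF finite_subset[OF sub fin] inj] by simp
qed

context quantum_grassmannian_setting
begin

abbreviation "BM \<equiv> band q m (n - m)"
abbreviation "DT \<equiv> qdet (scalar_op q) (net q m (2 * m)) [1..<m+1] {1..m}"

text \<open>\<open>X\<close> is regrouped as a square matrix times the band, and multiplicativity of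
  the quantum determinant turns the square part into the factor \<open>DT\<close>, common to all
  minors.\<close>

lemma psi_minor:
  assumes J: "J \<in> minor_indices m n"
  shows "\<psi> (qminor q m n J) = DT * fa_eval (case_prod BM) (fa_minor q m J)"
proof -
  have "\<psi> (qminor q m n J) = qdet (scalar_op q) X [1..<m+1] J"
    unfolding qminor_eq by (simp only: psi_cls fa_minor_carrier[OF J] fa_eval_minor[OF J])
  also have "\<dots> = qdet (scalar_op q) (matrix_prod m (net q m (2 * m)) BM) [1..<m+1] J"
  proof (rule qdet_cong)
    fix i j assume "j \<in> J"
    then have "1 \<le> j" "j \<le> m + (n - m)" using minor_indicesD(3)[OF J] mn by auto
    from net_eq_net_band[OF this, of q i] mn show "X i j = matrix_prod m (net q m (2 * m)) BM i j"
      by (simp add: mult_2)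
  qed
  also have "\<dots> = DT * qdet (scalar_op q) BM [1..<m+1] J"
  proof (rule qdet_matrix_prod)
    show "quantum_matrix (scalar_op q) (scalar_op (inverse q)) m n BM"
      using quantum_matrix_band[OF q, of m "n - m"] mn by simp
  qed (use minor_indicesD[OF J] in \<open>auto simp: net_band_commute scalar_op_inverse[OF q] intro: scalar_op_central[symmetric]\<close>)
  finally show ?thesis by (simp only: fa_eval_minor[OF J])
qed

text \<open>\<open>DT\<close> is built from the first \<open>2 * m\<close> steps and the band from
  later ones, whose variables commute with it. In a product of minors all factors \<open>DT\<close>
  can therefore be collected in front.\<close>

lemma DT_commute: "DT ^ i * fa_eval (case_prod BM) g = fa_eval (case_prod BM) g * DT ^ i"
proof -
  have 1: "BM a b * DT = DT * BM a b" for a b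
    by (rule qdet_commute) (simp_all add: net_band_commute scalar_op_central)
  have 2: "DT * eval_word (case_prod BM) w = eval_word (case_prod BM) w * DT" for w
    unfolding eval_word_def
  proof (rule commute_prod_list)
    fix x show "DT * case_prod BM x = case_prod BM x * DT" by (cases x) (simp only: prod.case 1)
  qed
  have "DT * (scalar_op c * eval_word (case_prod BM) w) = scalar_op c * eval_word (case_prod BM) w * DT" for c w
    using 2[of w] scalar_op_left_commute[of DT c "eval_word (case_prod BM) w"] by (simp only: mult.assoc)
  then have 3: "DT * fa_eval (case_prod BM) g = fa_eval (case_prod BM) g * DT"
    unfolding fa_eval_def sum_distrib_left sum_distrib_right by simp
  show ?thesis
  proof (induction i)
    case (Suc i)
    have "DT ^ Suc i * fa_eval (case_prod BM) g = DT * (DT ^ i * fa_eval (case_prod BM) g)"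
      by (simp only: power_Suc mult.assoc)
    also have "\<dots> = DT * fa_eval (case_prod BM) g * DT ^ i" by (simp only: Suc mult.assoc)
    also have "\<dots> = fa_eval (case_prod BM) g * DT ^ Suc i" by (simp only: 3 power_Suc mult.assoc)
    finally show ?case .
  qed simp
qed

definition graded_image :: "nat \<Rightarrow> (nat \<times> nat \<Rightarrow> nat, 'k) linop set" where
  "graded_image i = (\<lambda>g. DT ^ i * fa_eval (case_prod BM) g) ` graded m n i"

lemma graded_image_subspace: "linop.subspace (graded_image i)"
proof (rule linop.subspaceI)
  have "DT ^ i * fa_eval (case_prod BM) 0 \<in> graded_image i"
    unfolding graded_image_def by (intro imageI graded_closed)
  then show "0 \<in> graded_image i" by simp
  fix x y assume "x \<in> graded_image i" "y \<in> graded_image i"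
  then obtain g h where "g \<in> graded m n i" "h \<in> graded m n i"
    "x = DT ^ i * fa_eval (case_prod BM) g" "y = DT ^ i * fa_eval (case_prod BM) h"
    by (auto simp: graded_image_def)
  then show "x + y \<in> graded_image i"
    unfolding graded_image_def
    by (intro image_eqI[of _ _ "g + h"]) (simp_all add: fa_eval_add distrib_left graded_closed(1))
next
  fix c x assume "x \<in> graded_image i"
  then obtain g where "g \<in> graded m n i" "x = DT ^ i * fa_eval (case_prod BM) g"
    by (auto simp: graded_image_def)
  then show "scalar_op c * x \<in> graded_image i"
    unfolding graded_image_def
    by (intro image_eqI[of _ _ "fa_const c * g"])
      (simp_all add: fa_eval_mult graded_closed(3) scalar_op_left_commute)
qed

lemma graded_image_mult:
  assumes "x \<in> graded_image i" "y \<in> graded_image j"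
  shows "x * y \<in> graded_image (i + j)"
proof -
  obtain g h where g: "g \<in> graded m n i" and h: "h \<in> graded m n j"
    and xy: "x = DT ^ i * fa_eval (case_prod BM) g" "y = DT ^ j * fa_eval (case_prod BM) h"
    using assms by (auto simp: graded_image_def)
  have "x * y = DT ^ i * (fa_eval (case_prod BM) g * DT ^ j) * fa_eval (case_prod BM) h"
    unfolding xy by (simp only: mult.assoc)
  also have "\<dots> = DT ^ (i + j) * fa_eval (case_prod BM) (g * h)"
    unfolding DT_commute[symmetric] fa_eval_mult power_add by (simp only: mult.assoc)
  finally show ?thesis using graded_closed(2)[OF g h] by (simp add: graded_image_def)
qed

definition band_basis :: "nat \<Rightarrow> (nat \<times> nat \<Rightarrow> nat, 'k) linop set" where
  "band_basis i = (\<lambda>u. DT ^ i * prod_list (map (case_prod BM) u)) ` band_words m (n - m) i"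

text \<open>The band is itself a quantum matrix, so straightening is valid after evaluation on it.
  Straightening keeps the multiset of rows, and a word with a letter outside the band evaluates to
  0.\<close>

lemma graded_image_span: "graded_image i \<subseteq> linop.span (band_basis i)"
proof
  fix x assume "x \<in> graded_image i"
  then obtain g where g: "g \<in> graded m n i" and x: "x = DT ^ i * fa_eval (case_prod BM) g"
    by (auto simp: graded_image_def)
  obtain f where f: "f \<in> normal_forms m n {repeat_mset i (mset [1..<m+1])}" "g - f \<in> qmat_ideal q m n"
    using ex_normal_form[OF q, of g m n "{repeat_mset i (mset [1..<m+1])}"] g by (auto simp: graded_def)
  have "quantum_matrix (scalar_op q) (scalar_op (inverse q)) m n BM"
    using quantum_matrix_band[OF q, of m "n - m"] mn by simp
  from fa_eval_qmat_ideal[OF this f(2)] have "x = DT ^ i * fa_eval (case_prod BM) f"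
    unfolding x by (simp add: fa_eval_diff)
  also have "\<dots> = (\<Sum>w\<in>Poly_Mapping.keys f. scalar_op (Poly_Mapping.lookup f w) * (DT ^ i * eval_word (case_prod BM) w))"
    unfolding fa_eval_def sum_distrib_left by (simp only: scalar_op_left_commute)
  also have "\<dots> \<in> linop.span (band_basis i)"
  proof (intro linop.span_sum linop.span_scale)
    fix w assume w: "w \<in> Poly_Mapping.keys f"
    show "DT ^ i * eval_word (case_prod BM) w \<in> linop.span (band_basis i)"
    proof (cases "set (letters w) \<subseteq> {(a, b). a \<in> {1..m} \<and> a \<le> b \<and> b \<le> a + (n - m)}")
      case True
      then have "letters w \<in> band_words m (n - m) i" using f(1) w by (auto simp: band_words_def normal_forms_def)
      then show ?thesis unfolding band_basis_def eval_word_def by (intro linop.span_base imageI)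
    next
      case False
      then obtain a b where ab: "(a, b) \<in> set (letters w)" "\<not> (a \<in> {1..m} \<and> a \<le> b \<and> b \<le> a + (n - m))" by auto
      moreover have "a \<in> {1..m}" using f(1) w ab(1) by (force simp: normal_forms_def)
      ultimately have "BM a b = 0" by (intro band_eq_0) auto
      with ab(1) have "0 \<in> set (map (case_prod BM) (letters w))" by force
      then have "eval_word (case_prod BM) w = 0"
        unfolding eval_word_def by (metis in_set_conv_decomp mult_zero_left mult_zero_right prod_list.Cons prod_list.append)
      then show ?thesis by (simp add: linop.span_zero)
    qed
  qed
  finally show "x \<in> linop.span (band_basis i)" .
qed

lemma subspace_power_image:
  assumes W: "fin_dim_generating_subspace GQ SC W"
    and min: "\<And>E. subalgebra SC E GQ \<Longrightarrow> qminors q m n \<subseteq> E \<Longrightarrow> W \<subseteq> E"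
    and "a \<in> subspace_power GQ SC W i"
  shows "\<psi> a \<in> graded_image i"
  using assms(3)
proof (induction i arbitrary: a)
  case 0
  then obtain c where c: "a = cls (fa_const c)" by (auto simp: qmat_scalars_def)
  have "DT ^ 0 * fa_eval (case_prod BM) (fa_const c) \<in> graded_image 0"
    unfolding graded_image_def by (intro imageI graded_closed(5))
  then show ?case by (simp add: c psi_scalar)
next
  case (Suc i)
  have sub: "subalgebra SC W GQ" using W by (simp add: fin_dim_generating_subspace_def)
  have "W \<subseteq> {a \<in> carrier GQ. \<psi> a \<in> graded_image 1}"
  proof (rule min[OF psi_preimage_subspace[OF graded_image_subspace]])
    show "qminors q m n \<subseteq> {a \<in> carrier GQ. \<psi> a \<in> graded_image 1}"
    proof
      fix a assume a: "a \<in> qminors q m n"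
      then obtain J where J: "J \<in> minor_indices m n" "a = qminor q m n J" by (auto simp: qminors_def)
      have "\<psi> a \<in> graded_image 1"
        unfolding J(2) psi_minor[OF J(1)] graded_image_def
        by (rule image_eqI[OF _ fa_minor_graded[OF J(1)]]) simp
      with a qminors_subset_GQ show "a \<in> {a \<in> carrier GQ. \<psi> a \<in> graded_image 1}" by blast
    qed
  qed
  then have W1: "\<psi> v \<in> graded_image 1" "v \<in> carrier MQ" if "v \<in> W" for v
    using that GQ_subset by blast+
  have pc: "a \<in> carrier MQ" if "a \<in> subspace_power GQ SC W j" for a j
    using GQ.subspaceD(1)[OF GQ.subspace_power_subspace[OF sub] that] GQ_subset by blast
  from Suc.prems have "a \<in> ideal_prod GQ (subspace_power GQ SC W i) W" by simp
  then show ?case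
  proof induction
    case (prod a v)
    then show ?case
      using graded_image_mult[OF Suc.IH[OF prod(1)] W1(1)[OF prod(2)]] psi_simps(1)[OF pc[OF prod(1)] W1(2)[OF prod(2)]]
      by simp
  next
    case (sum a b)
    then have "a \<in> carrier MQ" "b \<in> carrier MQ" using pc[of _ "Suc i"] by simp_all
    then show ?case using sum.IH psi_simps(2)[of a b] linop.subspace_add[OF graded_image_subspace] by simp
  qed
qed

text \<open>Degree \<open>i\<close> contributes at most \<open>(i + 1) ^ (m * (n - m))\<close>
  spanning operators, and the sum over the \<open>N + 1\<close> degrees adds one to the
  exponent.\<close>

lemma independent_length_bound:
  assumes W: "fin_dim_generating_subspace GQ SC W"
    and min: "\<And>E. subalgebra SC E GQ \<Longrightarrow> qminors q m n \<subseteq> E \<Longrightarrow> W \<subseteq> E"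
    and Us: "GQ.independent SC Us" "set Us \<subseteq> subspace_power_sum GQ SC W N"
  shows "length Us \<le> (N + 1) ^ (m * (n - m) + 1)"
proof -
  have sub: "subalgebra SC W GQ" using W by (simp add: fin_dim_generating_subspace_def)
  define B where "B = (\<Union>i\<le>N. band_basis i)"
  have fin: "finite (band_basis i)" and card: "card (band_basis i) \<le> (i + 1) ^ (m * (n - m))" for i
    using band_words_card[of m "n - m" i] card_image_le[of "band_words m (n - m) i"]
    by (auto simp: band_basis_def intro: order_trans)
  have "\<psi> a \<in> linop.span B" if "a \<in> subspace_power_sum GQ SC W N" for a
  proof (rule GQ.subspace_power_sum_induct[OF sub that])
    fix i x assume i: "i \<le> N" and x: "x \<in> subspace_power GQ SC W i"
    have "linop.span (band_basis i) \<subseteq> linop.span B"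
      by (rule linop.span_mono) (use i in \<open>auto simp: B_def\<close>)
    then show "\<psi> x \<in> linop.span B" using subspace_power_image[OF W min x] graded_image_span by blast
  next
    fix x y assume xy: "x \<in> carrier GQ" "y \<in> carrier GQ" "\<psi> x \<in> linop.span B" "\<psi> y \<in> linop.span B"
    then have "x \<in> carrier MQ" "y \<in> carrier MQ" using GQ_subset by blast+
    then show "\<psi> (x \<oplus>\<^bsub>GQ\<^esub> y) \<in> linop.span B" using psi_simps(2)[of x y] linop.span_add[OF xy(3,4)] by simp
  qed
  then have "\<psi> ` set Us \<subseteq> linop.span B" using Us(2) by blast
  then have "card (\<psi> ` set Us) \<le> card B"
    using psi_independent[OF Us(1)] fin by (intro conjunct2[OF linop.independent_span_bound]) (auto simp: B_def)
  also have "card B \<le> (\<Sum>i\<le>N. card (band_basis i))" unfolding B_def by (rule card_UN_le) simp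
  also have "\<dots> \<le> (\<Sum>i\<le>N. (N + 1) ^ (m * (n - m)))"
    by (intro sum_mono order_trans[OF card] power_mono) auto
  finally show ?thesis using psi_independent[OF Us(1)] by simp
qed

end

section \<open>The lower bound and the length of maximal paths\<close>

lemma count_diag_word:
  assumes J: "J \<in> minor_indices m n" and i: "i \<in> {1..m}"
  shows "count (mset (diag_word m J)) (i, c) = (if elem_at J i = c then 1 else 0)"
proof -
  have "distinct (diag_word m J)" by (simp add: diag_word_def distinct_zipI1)
  then have "count (mset (diag_word m J)) (i, c) = (if (i, c) \<in> set (diag_word m J) then 1 else 0)"
    by (simp only: distinct_count_atmost_1)
  moreover have "(i, c) \<in> set (diag_word m J) \<longleftrightarrow> elem_at J i = c"
    unfolding diag_word_eq[OF J] using i by (auto simp del: upt_Suc)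
  ultimately show ?thesis by simp
qed

lemma count_concat_replicate:
  "count (mset (concat (map f (concat (map (\<lambda>t. replicate (b t) (J t)) ts))))) x
     = (\<Sum>t\<leftarrow>ts. b t * count (mset (f (J t))) x)"
proof (induction ts)
  case (Cons t ts)
  have "count (mset (concat (replicate k u))) x = k * count (mset u) x" for k u by (induction k) auto
  with Cons show ?case by simp
qed simp

definition index_chain :: "nat \<Rightarrow> nat \<Rightarrow> nat set list \<Rightarrow> bool" where
  "index_chain m n ps \<longleftrightarrow> ps \<noteq> [] \<and> set ps \<subseteq> minor_indices m n \<and>
     (\<forall>i. Suc i < length ps \<longrightarrow> index_le m (ps ! i) (ps ! Suc i) \<and> index_rank m (ps ! Suc i) = Suc (index_rank m (ps ! i)))"

lemma index_chain_le:
  assumes "index_chain m n ps" "s \<le> t" "t < length ps"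
  shows "index_le m (ps ! s) (ps ! t)"
  using assms(2,3)
proof (induction t rule: dec_induct)
  case (step t)
  then have "index_le m (ps ! s) (ps ! t)" "index_le m (ps ! t) (ps ! Suc t)"
    using assms(1) by (auto simp: index_chain_def)
  then show ?case unfolding index_le_def by (blast intro: order_trans)
qed (simp add: index_le_def)

text \<open>A new entry at every step makes the matrices counting the entries \<open>(i, j\<^sub>i)\<close> along a chain triangular.\<close>

lemma index_chain_new_entry:
  assumes ch: "index_chain m n ps" and t: "t < length ps" and m: "1 \<le> m"
  obtains i where "i \<in> {1..m}" "\<And>s. s < t \<Longrightarrow> elem_at (ps ! s) i \<noteq> elem_at (ps ! t) i"
proof (cases t)
  case 0
  then show ?thesis using that[of 1] m by simp
next
  case (Suc r)
  have r: "index_rank m (ps ! r) < index_rank m (ps ! t)" "index_le m (ps ! r) (ps ! t)"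
    using ch t Suc by (auto simp: index_chain_def)
  have "\<exists>i\<in>{1..m}. elem_at (ps ! r) i < elem_at (ps ! t) i"
  proof (rule ccontr)
    assume "\<not> ?thesis"
    then have "index_rank m (ps ! t) \<le> index_rank m (ps ! r)"
      unfolding index_rank_def by (intro sum_mono) (auto simp: not_less)
    with r(1) show False by simp
  qed
  then obtain i where i: "i \<in> {1..m}" "elem_at (ps ! r) i < elem_at (ps ! t) i" by blast
  have "elem_at (ps ! s) i \<noteq> elem_at (ps ! t) i" if "s < t" for s
  proof -
    have "index_le m (ps ! s) (ps ! r)" by (rule index_chain_le[OF ch]) (use that Suc t in auto)
    then have "elem_at (ps ! s) i \<le> elem_at (ps ! r) i" using i(1) by (simp add: index_le_def)
    with i(2) show ?thesis by simp
  qed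
  with i(1) that show ?thesis by blast
qed

definition chain_word :: "nat set list \<Rightarrow> (nat \<Rightarrow> nat) \<Rightarrow> nat set list" where
  "chain_word ps b = concat (map (\<lambda>t. replicate (b t) (ps ! t)) [0..<length ps])"

text \<open>Let \<open>u\<close> be the last index at which the exponents differ. The letter for an
  entry new at \<open>u\<close> does not occur in the minors before \<open>u\<close>, and the minors
  after \<open>u\<close> contribute equally on both sides, so its multiplicity determines the
  exponent at \<open>u\<close>.\<close>

lemma chain_word_inj:
  assumes ch: "index_chain m n ps" and m: "1 \<le> m"
    and eq: "mset (concat (map (diag_word m) (chain_word ps b))) = mset (concat (map (diag_word m) (chain_word ps b')))"
    and t: "t < length ps"
  shows "b t = b' t"
proof (rule ccontr)
  let ?d = "length ps"
  assume "b t \<noteq> b' t"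
  define S where "S = {t. t < ?d \<and> b t \<noteq> b' t}"
  define u where "u = Max S"
  have "finite S" "S \<noteq> {}" using t \<open>b t \<noteq> b' t\<close> by (auto simp: S_def)
  then have "u \<in> S" unfolding u_def by (rule Max_in)
  then have u: "u < ?d" "b u \<noteq> b' u" by (auto simp: S_def)
  have above: "b s = b' s" if "u < s" "s < ?d" for s
  proof (rule ccontr)
    assume "b s \<noteq> b' s"
    then have "s \<le> u" unfolding u_def using \<open>finite S\<close> that by (intro Max_ge) (auto simp: S_def)
    with that show False by simp
  qed
  obtain i where i: "i \<in> {1..m}" "\<And>s. s < u \<Longrightarrow> elem_at (ps ! s) i \<noteq> elem_at (ps ! u) i"
    using index_chain_new_entry[OF ch u(1) m] by blast
  define e where "e s = (if elem_at (ps ! s) i = elem_at (ps ! u) i then 1 else 0 :: nat)" for s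
  have cnt: "count (mset (concat (map (diag_word m) (chain_word ps b)))) (i, elem_at (ps ! u) i) = (\<Sum>s<?d. b s * e s)" for b
  proof -
    have "count (mset (concat (map (diag_word m) (chain_word ps b)))) (i, elem_at (ps ! u) i)
      = (\<Sum>s<?d. b s * count (mset (diag_word m (ps ! s))) (i, elem_at (ps ! u) i))"
      unfolding chain_word_def count_concat_replicate by (simp add: sum_list_distinct_conv_sum_set atLeast0LessThan)
    also have "\<dots> = (\<Sum>s<?d. b s * e s)"
    proof (intro sum.cong refl)
      fix s assume "s \<in> {..<?d}"
      then have "ps ! s \<in> minor_indices m n" using ch by (auto simp: index_chain_def)
      from count_diag_word[OF this i(1)]
      show "b s * count (mset (diag_word m (ps ! s))) (i, elem_at (ps ! u) i) = b s * e s" by (simp add: e_def)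
    qed
    finally show ?thesis .
  qed
  have split: "(\<Sum>s<?d. b s * e s) = b u * e u + (\<Sum>s\<in>{..<?d} - {u}. b s * e s)" for b
    using u(1) by (intro sum.remove) auto
  have "b s * e s = b' s * e s" if "s \<in> {..<?d} - {u}" for s
    using that i(2)[of s] above[of s] by (cases "s < u") (auto simp: e_def)
  then have "(\<Sum>s\<in>{..<?d} - {u}. b s * e s) = (\<Sum>s\<in>{..<?d} - {u}. b' s * e s)" by (intro sum.cong) auto
  moreover have "(\<Sum>s<?d. b s * e s) = (\<Sum>s<?d. b' s * e s)"
    using cnt[of b] cnt[of b'] unfolding eq by simp
  ultimately have "b u * e u = b' u * e u" unfolding split[of b] split[of b'] by simp
  with u(2) show False by (simp add: e_def)
qed

context quantum_grassmannian_setting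
begin

lemma independent_of_leads:
  assumes "distinct bs" "inj_on v (set bs)"
    and u: "\<And>b. b \<in> set bs \<Longrightarrow> u b \<in> carrier GQ" "\<And>b. b \<in> set bs \<Longrightarrow> op_leads (net_weight m n) (\<psi> (u b)) (v b)"
  shows "GQ.independent SC (map u bs)"
  using assms
proof (induction bs rule: list.induct)
  case (Cons b bs)
  have Us: "set (map u bs) \<subseteq> carrier GQ" using Cons.prems(3) by auto
  have "u b \<notin> GQ.Span SC (map u bs)"
  proof
    assume "u b \<in> GQ.Span SC (map u bs)"
    from psi_Span[OF Us this] have "\<psi> (u b) \<in> linop.span ((\<lambda>b. \<psi> (u b)) ` set bs)"
      by (simp add: image_image)
    then obtain c where c: "\<psi> (u b) = (\<Sum>x\<in>(\<lambda>b. \<psi> (u b)) ` set bs. scalar_op (c x) * x)"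
      by (subst (asm) linop.span_finite) auto
    have "inj_on (\<lambda>b. \<psi> (u b)) (set bs)"
    proof (rule inj_onI)
      fix x y assume xy: "x \<in> set bs" "y \<in> set bs" "\<psi> (u x) = \<psi> (u y)"
      have "v x = v y" by (rule op_leads_unique[OF Cons.prems(4)]) (use xy Cons.prems(4)[of y] in auto)
      with xy Cons.prems(2) show "x = y" by (auto simp: inj_on_def)
    qed
    with c have c': "\<psi> (u b) = (\<Sum>x\<in>set bs. scalar_op (c (\<psi> (u x))) * \<psi> (u x))"
      by (simp add: sum.reindex)
    \<comment> \<open>The coefficient \<open>-1\<close> at \<open>b\<close> turns the expansion of
      \<open>\<psi> (u b)\<close> into a vanishing combination, as required for comparing
      leaders.\<close>
    define c'' where "c'' x = (if x = b then -1 else c (\<psi> (u x)))" for x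
    have "(\<Sum>x\<in>set (b # bs). scalar_op (c'' x) * \<psi> (u x)) =
        - \<psi> (u b) + (\<Sum>x\<in>set bs. scalar_op (c'' x) * \<psi> (u x))"
      using Cons.prems(1) by (simp add: c''_def scalar_op_minus)
    also have "(\<Sum>x\<in>set bs. scalar_op (c'' x) * \<psi> (u x)) = \<psi> (u b)"
      unfolding c' using Cons.prems(1) by (intro sum.cong) (auto simp: c''_def)
    finally have "(\<Sum>x\<in>set (b # bs). scalar_op (c'' x) * \<psi> (u x)) = 0" by simp
    from op_leads_independent[where w = "net_weight m n", OF net_weight_add _ Cons.prems(2,4) this, of b]
    show False by (simp add: c''_def)
  qed
  moreover have "GQ.independent SC (map u bs)"
    using Cons.prems by (intro Cons.IH) (auto simp: inj_on_def)
  ultimately show ?case using Cons.prems(3)[of b] by (auto intro: GQ.li_Cons)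
qed simp

definition minor_monomial :: "nat set list \<Rightarrow> ((nat \<times> nat) fword \<Rightarrow>\<^sub>0 'k) set" where
  "minor_monomial Js = cls (prod_list (map (fa_minor q m) Js))"

lemma fa_minor_product_carrier:
  assumes "set Js \<subseteq> minor_indices m n"
  shows "prod_list (map (fa_minor q m) Js) \<in> carrier FA"
proof (rule free_algebra_prod_list)
  fix p assume "p \<in> set (map (fa_minor q m) Js)"
  then obtain J where "p = fa_minor q m J" "J \<in> minor_indices m n" using assms by auto
  then show "p \<in> carrier FA" by (simp only: fa_minor_carrier)
qed

lemma minor_monomial_in_power_sum:
  assumes W: "subalgebra SC W GQ" "qminors q m n \<subseteq> W" and "set Js \<subseteq> minor_indices m n"
  shows "minor_monomial Js \<in> subspace_power_sum GQ SC W (length Js)"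
  using assms(3)
proof (induction Js)
  case Nil
  have "minor_monomial [] = cls (fa_const 1)" by (simp add: minor_monomial_def fa_const_1)
  then show ?case by (auto simp: qmat_scalars_def)
next
  case (Cons J Js)
  have J: "J \<in> minor_indices m n" using Cons.prems by simp
  have Js: "prod_list (map (fa_minor q m) Js) \<in> carrier FA"
    using Cons.prems by (intro fa_minor_product_carrier) auto
  have "qminor q m n J \<in> subspace_power_sum GQ SC W 1"
    using GQ.subset_subspace_power_sum[OF W(1)] W(2) J by (auto simp: qminors_def)
  then have "qminor q m n J \<otimes>\<^bsub>GQ\<^esub> minor_monomial Js \<in> subspace_power_sum GQ SC W (1 + length Js)"
    using Cons by (intro GQ.subspace_power_sum_mult[OF W(1)]) auto
  moreover have "qminor q m n J \<otimes>\<^bsub>GQ\<^esub> minor_monomial Js = minor_monomial (J # Js)"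
    unfolding minor_monomial_def qminor_eq GQ_simps(1) using cls_simps(1)[OF fa_minor_carrier[OF J] Js] by simp
  ultimately show ?case by simp
qed

lemma minor_monomial_leads:
  assumes "set Js \<subseteq> minor_indices m n"
  shows "op_leads (net_weight m n) (\<psi> (minor_monomial Js)) (word_vec m n (concat (map (diag_word m) Js)))"
proof -
  have "prod_list (map (fa_minor q m) Js) \<in> carrier FA"
    by (rule fa_minor_product_carrier[OF assms])
  then have "\<psi> (minor_monomial Js) = prod_list (map (\<lambda>J. fa_eval (case_prod X) (fa_minor q m J)) Js)"
    unfolding minor_monomial_def by (simp only: psi_cls fa_eval_prod_list map_map o_def)
  moreover have "op_leads (net_weight m n) (prod_list (map (\<lambda>J. fa_eval (case_prod X) (fa_minor q m J)) Js))
     (sum_list (rev (map (\<lambda>J. word_vec m n (diag_word m J)) Js)))"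
  proof (rule op_leads_prod_list[where w = "net_weight m n", OF net_weight_add])
    fix J assume "J \<in> set Js"
    with assms have J: "J \<in> minor_indices m n" by blast
    show "op_leads (net_weight m n) (fa_eval (case_prod X) (fa_minor q m J)) (word_vec m n (diag_word m J))"
      unfolding fa_eval_minor[OF J] by (rule qdet_net_leads[OF q mn J])
  qed
  moreover have "sum_list (rev (map (\<lambda>J. word_vec m n (diag_word m J)) Js)) = word_vec m n (concat (map (diag_word m) Js))"
    unfolding sum_list_rev by (induction Js) (simp_all add: word_vec_def)
  ultimately show ?thesis by simp
qed

text \<open>Exponents up to \<open>N div length ps\<close> on each minor of the chain keep the total
  degree within \<open>N\<close>. The resulting monomials, with factors in the order of the chain,
  have distinct leading exponents.\<close>

lemma ex_independent_monomials:
  assumes W: "subalgebra SC W GQ" "qminors q m n \<subseteq> W" and ch: "index_chain m n ps"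
  shows "\<exists>Us. GQ.independent SC Us \<and> set Us \<subseteq> subspace_power_sum GQ SC W N \<and>
     (N div length ps + 1) ^ length ps \<le> length Us"
proof -
  let ?d = "length ps"
  define B where "B = ({..<?d} \<rightarrow>\<^sub>E {..N div ?d})"
  have fB: "finite B" and cB: "card B = (N div ?d + 1) ^ ?d"
    by (simp_all add: B_def finite_PiE card_PiE)
  obtain bs where bs: "set bs = B" "distinct bs" using finite_distinct_list[OF fB] by blast
  have mi: "set (chain_word ps b) \<subseteq> minor_indices m n" for b
    using ch by (auto simp: chain_word_def index_chain_def dest!: subsetD)
  have len: "length (chain_word ps b) \<le> N" if b: "b \<in> B" for b
  proof -
    have "length (chain_word ps b) = (\<Sum>t<?d. b t)"
      by (simp add: chain_word_def length_concat o_def sum_list_distinct_conv_sum_set atLeast0LessThan)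
    also have "\<dots> \<le> (\<Sum>t<?d. N div ?d)" using b by (intro sum_mono) (auto simp: B_def dest: PiE_mem)
    also have "\<dots> \<le> N" by simp
    finally show ?thesis .
  qed
  have mem: "minor_monomial (chain_word ps b) \<in> subspace_power_sum GQ SC W N" if "b \<in> B" for b
    using minor_monomial_in_power_sum[OF W mi] GQ.subspace_power_sum_mono[OF W(1) len[OF that]] by blast
  have inj: "inj_on (\<lambda>b. word_vec m n (concat (map (diag_word m) (chain_word ps b)))) B"
  proof (rule inj_onI)
    fix b b' assume b: "b \<in> B" "b' \<in> B"
      "word_vec m n (concat (map (diag_word m) (chain_word ps b))) = word_vec m n (concat (map (diag_word m) (chain_word ps b')))"
    have grid: "set (concat (map (diag_word m) (chain_word ps b))) \<subseteq> {1..m} \<times> {1..n}" for b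
      using set_diag_word mi[of b] by fastforce
    have "mset (concat (map (diag_word m) (chain_word ps b))) = mset (concat (map (diag_word m) (chain_word ps b')))"
      by (rule word_vec_inj[OF grid grid mn b(3)])
    then have "b t = b' t" if "t < ?d" for t using chain_word_inj[OF ch m _ that] by blast
    with b(1,2) show "b = b'" unfolding B_def by (intro PiE_ext) auto
  qed
  have "GQ.independent SC (map (\<lambda>b. minor_monomial (chain_word ps b)) bs)"
  proof (rule independent_of_leads[OF bs(2)])
    show "inj_on (\<lambda>b. word_vec m n (concat (map (diag_word m) (chain_word ps b)))) (set bs)"
      using inj bs(1) by simp
    show "minor_monomial (chain_word ps b) \<in> carrier GQ" if "b \<in> set bs" for b
      using mem[of b] that bs(1) GQ.subspaceD(1)[OF GQ.subspace_power_sum_subspace[OF W(1)]] by blast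
  qed (rule minor_monomial_leads[OF mi])
  then show ?thesis
    using mem bs cB distinct_card[OF bs(2)] by (intro exI[of _ "map (\<lambda>b. minor_monomial (chain_word ps b)) bs"]) auto
qed

lemma GKdim_eq_chain_length:
  assumes ch: "index_chain m n ps" and len: "length ps = m * (n - m) + 1"
  shows "GKdim GQ SC = ereal (real (m * (n - m) + 1))"
proof -
  obtain W where W: "fin_dim_generating_subspace GQ SC W" "qminors q m n \<subseteq> W"
    and min: "\<And>E. subalgebra SC E GQ \<Longrightarrow> qminors q m n \<subseteq> E \<Longrightarrow> W \<subseteq> E"
    using ex_minor_span by blast
  have sub: "subalgebra SC W GQ" using W(1) by (simp add: fin_dim_generating_subspace_def)
  show ?thesis
  proof (rule GQ.GKdim_eqI[OF W(1)])
    show "length Us \<le> (N + 1) ^ (m * (n - m) + 1)"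
      if "GQ.independent SC Us" "set Us \<subseteq> subspace_power_sum GQ SC W N" for N Us
      by (rule independent_length_bound[OF W(1) min that])
    show "\<exists>Us. GQ.independent SC Us \<and> set Us \<subseteq> subspace_power_sum GQ SC W N \<and>
       (N div (m * (n - m) + 1) + 1) ^ (m * (n - m) + 1) \<le> length Us" for N
      using ex_independent_monomials[OF sub W(2) ch, of N] unfolding len .
  qed simp
qed

section \<open>Saturated paths of minors as chains of index sets\<close>

lemma minor_le_iff:
  assumes "A \<in> minor_indices m n" "B \<in> minor_indices m n"
  shows "minor_le q m n (qminor q m n A) (qminor q m n B) \<longleftrightarrow> index_le m A B"
  using assms inj_onD[OF qminor_inj[OF q mn]] unfolding minor_le_def index_le_def by metis

lemma minor_less_iff:
  assumes "A \<in> minor_indices m n" "B \<in> minor_indices m n"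
  shows "minor_less q m n (qminor q m n A) (qminor q m n B) \<longleftrightarrow> index_le m A B \<and> A \<noteq> B"
  using minor_le_iff[OF assms] assms inj_onD[OF qminor_inj[OF q mn]] unfolding minor_less_def by blast

text \<open>If the rank jumped by more than one, \<open>ex_index_between\<close> would supply an
  intermediate minor. If it rises by exactly one, strict monotonicity of the rank leaves no room for
  one.\<close>

lemma minor_cover_iff:
  assumes A: "A \<in> minor_indices m n" and B: "B \<in> minor_indices m n"
  shows "minor_less q m n (qminor q m n A) (qminor q m n B) \<and>
     \<not> (\<exists>d \<in> qminors q m n. minor_less q m n (qminor q m n A) d \<and> minor_less q m n d (qminor q m n B))
     \<longleftrightarrow> index_le m A B \<and> index_rank m B = Suc (index_rank m A)" (is "?L \<longleftrightarrow> ?R")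
proof
  assume L: ?L
  then have le: "index_le m A B" "A \<noteq> B" using minor_less_iff[OF A B] by auto
  obtain C where C: "C \<in> minor_indices m n" "index_le m A C" "index_le m C B" "index_rank m C = Suc (index_rank m A)"
    using ex_index_between[OF A B le] by blast
  have "A \<noteq> C" using C(4) by auto
  have "C = B"
  proof (rule ccontr)
    assume "C \<noteq> B"
    then have "minor_less q m n (qminor q m n A) (qminor q m n C)" "minor_less q m n (qminor q m n C) (qminor q m n B)"
      using minor_less_iff A B C \<open>A \<noteq> C\<close> by auto
    moreover have "qminor q m n C \<in> qminors q m n" using C(1) by (simp add: qminors_def)
    ultimately show False using L by blast
  qed
  with C le show ?R by simp
next
  assume R: ?R
  then have "A \<noteq> B" by auto
  have False if d: "d \<in> qminors q m n" "minor_less q m n (qminor q m n A) d" "minor_less q m n d (qminor q m n B)" for d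
  proof -
    obtain C where C: "C \<in> minor_indices m n" "d = qminor q m n C" using d(1) by (auto simp: qminors_def)
    have "index_rank m A < index_rank m C" "index_rank m C < index_rank m B"
      using d(2,3) minor_less_iff[OF A C(1)] minor_less_iff[OF C(1) B] index_rank_less[OF A C(1)] index_rank_less[OF C(1) B]
      unfolding C(2) by auto
    with R show False by simp
  qed
  with R \<open>A \<noteq> B\<close> minor_less_iff[OF A B] show ?L by blast
qed

lemma saturated_path_iff:
  assumes ps: "set ps \<subseteq> minor_indices m n"
  shows "saturated_path q m n a b (map (qminor q m n) ps) \<longleftrightarrow>
     index_chain m n ps \<and> qminor q m n (hd ps) = a \<and> qminor q m n (last ps) = b"
proof (cases "ps = []")
  case False
  have "(\<forall>i. Suc i < length ps \<longrightarrow>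
      minor_less q m n (map (qminor q m n) ps ! i) (map (qminor q m n) ps ! Suc i) \<and>
      \<not> (\<exists>d\<in>qminors q m n. minor_less q m n (map (qminor q m n) ps ! i) d \<and> minor_less q m n d (map (qminor q m n) ps ! Suc i)))
    \<longleftrightarrow> (\<forall>i. Suc i < length ps \<longrightarrow> index_le m (ps ! i) (ps ! Suc i) \<and> index_rank m (ps ! Suc i) = Suc (index_rank m (ps ! i)))"
  proof (intro all_cong1 imp_cong refl)
    fix i assume i: "Suc i < length ps"
    then have "ps ! i \<in> minor_indices m n" "ps ! Suc i \<in> minor_indices m n" using ps by (auto dest!: subsetD)
    from minor_cover_iff[OF this] i
    show "(minor_less q m n (map (qminor q m n) ps ! i) (map (qminor q m n) ps ! Suc i) \<and>
      \<not> (\<exists>d\<in>qminors q m n. minor_less q m n (map (qminor q m n) ps ! i) d \<and> minor_less q m n d (map (qminor q m n) ps ! Suc i)))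
      \<longleftrightarrow> index_le m (ps ! i) (ps ! Suc i) \<and> index_rank m (ps ! Suc i) = Suc (index_rank m (ps ! i))"
      by (simp only: nth_map Suc_lessD)
  qed
  then show ?thesis
    using False ps unfolding saturated_path_def index_chain_def
    by (auto simp: hd_map last_map qminors_def simp del: nth_map)
qed (simp add: saturated_path_def index_chain_def)

text \<open>Each of the \<open>m\<close> entries moves by \<open>n - m\<close> between the two
  extremes, which is where \<open>m * (n - m)\<close> comes from.\<close>

lemma first_last_index:
  "{1..m} \<in> minor_indices m n" "{n - m + 1..n} \<in> minor_indices m n"
  "index_le m {1..m} {n - m + 1..n}"
  "index_rank m {n - m + 1..n} = index_rank m {1..m} + m * (n - m)"
proof -
  note first = elem_at_interval[of 0 m n] and last = elem_at_interval[of "n - m" m n]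
  show "{1..m} \<in> minor_indices m n" "{n - m + 1..n} \<in> minor_indices m n"
    using first(1) last(1) mn by auto
  have el: "elem_at {1..m} i = i" "elem_at {n - m + 1..n} i = n - m + i" if "i \<in> {1..m}" for i
    using first(2)[of i] last(2)[of i] mn that by auto
  show "index_le m {1..m} {n - m + 1..n}" using el by (simp add: index_le_def)
  have "index_rank m {n - m + 1..n} = (\<Sum>i=1..m. (n - m) + i)"
    unfolding index_rank_def by (intro sum.cong refl el)
  also have "\<dots> = m * (n - m) + (\<Sum>i=1..m. i)" by (simp add: sum.distrib)
  also have "(\<Sum>i=1..m. i) = index_rank m {1..m}"
    unfolding index_rank_def by (intro sum.cong refl el(1)[symmetric])
  finally show "index_rank m {n - m + 1..n} = index_rank m {1..m} + m * (n - m)" by simp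
qed

lemma maximal_path_iff:
  assumes "set ps \<subseteq> minor_indices m n"
  shows "maximal_path q m n (map (qminor q m n) ps) \<longleftrightarrow>
     index_chain m n ps \<and> hd ps = {1..m} \<and> last ps = {n - m + 1..n}"
proof (cases "ps = []")
  case False
  then have "hd ps \<in> minor_indices m n" "last ps \<in> minor_indices m n" using assms by auto
  then show ?thesis
    unfolding maximal_path_def saturated_path_iff[OF assms]
    by (simp only: inj_on_eq_iff[OF qminor_inj[OF q mn]] first_last_index(1,2))
qed (simp add: maximal_path_def saturated_path_def index_chain_def)

text \<open>Each step gains one in rank, so the rank difference counts the steps; the chain has one
  element more.\<close>

lemma index_chain_length:
  assumes "index_chain m n ps" "hd ps = {1..m}" "last ps = {n - m + 1..n}"
  shows "length ps = m * (n - m) + 1"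
proof -
  have ne: "ps \<noteq> []" using assms(1) by (simp add: index_chain_def)
  have "index_rank m (ps ! (length ps - 1)) = index_rank m (ps ! 0) + (length ps - 1)"
    by (rule index_rank_chain) (use assms(1) ne in \<open>auto simp: index_chain_def\<close>)
  then have "m * (n - m) = length ps - 1"
    using first_last_index(4) assms(2,3) ne by (simp add: hd_conv_nth last_conv_nth)
  with ne show ?thesis by (cases ps) auto
qed

lemma ex_maximal_index_chain:
  "\<exists>ps. index_chain m n ps \<and> hd ps = {1..m} \<and> last ps = {n - m + 1..n}"
  using ex_index_chain[OF first_last_index(1-3)] unfolding index_chain_def by blast

lemma maximal_path_length_eq: "maximal_path_length q m n = m * (n - m) + 1"
  unfolding maximal_path_length_def
proof (rule the_equality)
  obtain ps where ps: "index_chain m n ps" "hd ps = {1..m}" "last ps = {n - m + 1..n}"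
    using ex_maximal_index_chain by blast
  then have "maximal_path q m n (map (qminor q m n) ps)"
    using maximal_path_iff by (simp add: index_chain_def)
  with index_chain_length[OF ps] show "\<exists>p. maximal_path q m n p \<and> m * (n - m) + 1 = length p"
    by (intro exI[of _ "map (qminor q m n) ps"]) simp
next
  fix l assume "\<exists>p. maximal_path q m n p \<and> l = length p"
  then obtain p where p: "maximal_path q m n p" "l = length p" by blast
  \<comment> \<open>The entries of a path are minors, so every path is the image of a list of index
    sets, and the count for index chains applies.\<close>
  then have "p \<in> lists (qminor q m n ` minor_indices m n)"
    by (simp add: maximal_path_def saturated_path_def qminors_def lists_eq_set)
  then obtain ps where ps: "set ps \<subseteq> minor_indices m n" "p = map (qminor q m n) ps"
    unfolding lists_image by (auto simp: lists_eq_set)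
  with p(1) maximal_path_iff[OF ps(1)] index_chain_length show "l = m * (n - m) + 1"
    using p(2) by simp
qed

end

theorem proposition2p9:
  fixes q :: "'k::field" and m n \<alpha> :: nat
  assumes "q \<noteq> 0" and "1 \<le> m" and "m \<le> n"
    and "\<alpha> = maximal_path_length q m n"
  shows "GKdim (quantum_grassmannian q m n) (qmat_scalars q m n) = ereal (real \<alpha>)
         \<and> \<alpha> = m * (n - m) + 1"
proof -
  interpret quantum_grassmannian_setting q m n by unfold_locales fact+
  obtain ps where "index_chain m n ps" "hd ps = {1..m}" "last ps = {n - m + 1..n}"
    using ex_maximal_index_chain by blast
  then have "GKdim (quantum_grassmannian q m n) (qmat_scalars q m n) = ereal (real (m * (n - m) + 1))"
    by (intro GKdim_eq_chain_length index_chain_length)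
  then show ?thesis using assms(4) maximal_path_length_eq by simp
qed

end
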